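(* Let $X\in\mathcal{M}_{g,n}$. There exists a constant $C_X>0$ (depending only on $X$) such that for all $0<\xi\le 1$ and all $0<\varepsilon\le 2$ there exists a closed geodesic $\gamma_\varepsilon$ on $X$ that is $\varepsilon$-dense on $X^\xi$ and whose length satisfies $$\ell(\gamma_\varepsilon)\le C_X\,\frac{1}{\varepsilon}\left(\log\frac{1}{\varepsilon}+\log\frac{1}{\xi}\right).$$
   Context: $\mathcal{M}_{g,n}$ denotes the moduli space of complete connected orientable finite-area hyperbolic surfaces of genus $g$ with $n$ cusps, where $2g+n\ge 3$. A cusp region of area $\xi$ is a portion of the surface isometric to $\{z\in\mathbb{H}:\operatorname{Im} z\ge 1\}/(z\mapsto z+\xi)$. For $X\in\mathcal{M}_{g,n}$ and $0<\xi\le 2$, $X^\xi$ is the closure of the complement in $X$ of all cusp regions of area $\xi$; thus $X^\xi$ is a surface of genus $g$ with $n$ boundary components, each a horocycle of length $\xi$. A geodesic $\gamma$ is $\varepsilon$-dense on a subset $Y\subset X$ if every point of $Y$ is at distance at most $\varepsilon$ from $\gamma$. $\ell$ denotes hyperbolic length.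
   Formalization: The factor log(1/ε)+log(1/ξ) is replaced by max(log 2, log(1/ε)+log(1/ξ)), since the printed bound is negative at ε=2, ξ=1 and tends to 0 as εξ→1, hence false there; for εξ≤1/2 the bound is exactly as printed. *)

theory Defs
  imports "HOL-Analysis.Analysis"
begin

section \<open>The hyperbolic plane\<close>

definition upper_half_plane :: "complex set" where
  "upper_half_plane = {z. Im z > 0}"

text \<open>The distance of the Riemannian metric \<open>(dx\<^sup>2 + dy\<^sup>2) / y\<^sup>2\<close>; meaningful only on the
  upper half-plane.\<close>

definition hyp_dist :: "complex \<Rightarrow> complex \<Rightarrow> real" where
  "hyp_dist z w = arcosh (1 + (cmod (z - w))\<^sup>2 / (2 * Im z * Im w))"

definition hyp_area :: "complex set \<Rightarrow> ennreal" where
  "hyp_area A = (\<integral>\<^sup>+z\<in>A. ennreal (1 / (Im z)\<^sup>2) \<partial>lborel)"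


section \<open>Lengths of curves and geodesics in a metric space\<close>

definition curve_length :: "('a \<Rightarrow> 'a \<Rightarrow> real) \<Rightarrow> (real \<Rightarrow> 'a) \<Rightarrow> real \<Rightarrow> real \<Rightarrow> ereal" where
  "curve_length d c a b =
     (SUP ts\<in>{ts. sorted ts \<and> set ts \<subseteq> {a..b}}.
        ereal (\<Sum>i<length ts - 1. d (c (ts ! i)) (c (ts ! Suc i))))"

text \<open>The infimum is taken in the extended reals, so this condition also forces any two points to be
  joined by a curve of finite length. For a surface it says that \<open>d\<close> is the distance function of
  the Riemannian metric, and not merely a metric that agrees with it locally.\<close>

definition length_metric :: "'a set \<Rightarrow> ('a \<Rightarrow> 'a \<Rightarrow> real) \<Rightarrow> bool" where
  "length_metric M d \<longleftrightarrow>
     (\<forall>x\<in>M. \<forall>y\<in>M. ereal (d x y) =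
        (INF c\<in>{c. continuous_map (top_of_set {0..1}) (Metric_space.mtopology M d) c \<and>
                   c 0 = x \<and> c 1 = y}.
           curve_length d c 0 1))"

text \<open>Geodesics are parametrised by arc length; being geodesic is a local condition, also at the
  base point, since the parametrisation is periodic on the whole line. The period \<open>L\<close> need not be
  the least one.\<close>

definition closed_geodesic ::
    "'a set \<Rightarrow> ('a \<Rightarrow> 'a \<Rightarrow> real) \<Rightarrow> (real \<Rightarrow> 'a) \<Rightarrow> real \<Rightarrow> bool" where
  "closed_geodesic M d \<gamma> L \<longleftrightarrow>
     L > 0 \<and> (\<forall>t. \<gamma> t \<in> M) \<and> (\<forall>t. \<gamma> (t + L) = \<gamma> t) \<and>
     (\<forall>t. \<exists>e>0. \<forall>s\<in>{t-e<..<t+e}. \<forall>s'\<in>{t-e<..<t+e}. d (\<gamma> s) (\<gamma> s') = \<bar>s - s'\<bar>)"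

definition dense_within ::
    "('a \<Rightarrow> 'a \<Rightarrow> real) \<Rightarrow> real \<Rightarrow> (real \<Rightarrow> 'a) \<Rightarrow> 'a set \<Rightarrow> bool" where
  "dense_within d \<epsilon> \<gamma> Y \<longleftrightarrow> (\<forall>y\<in>Y. \<exists>t. d y (\<gamma> t) \<le> \<epsilon>)"


section \<open>Hyperbolic surfaces\<close>

definition isometric_chart ::
    "'a set \<Rightarrow> ('a \<Rightarrow> 'a \<Rightarrow> real) \<Rightarrow> 'a set \<Rightarrow> ('a \<Rightarrow> complex) \<Rightarrow> bool" where
  "isometric_chart M d U \<phi> \<longleftrightarrow>
     openin (Metric_space.mtopology M d) U \<and> open (\<phi> ` U) \<and> \<phi> ` U \<subseteq> upper_half_plane \<and>
     (\<forall>x\<in>U. \<forall>y\<in>U. hyp_dist (\<phi> x) (\<phi> y) = d x y)"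

definition hyperbolic_surface :: "'a set \<Rightarrow> ('a \<Rightarrow> 'a \<Rightarrow> real) \<Rightarrow> bool" where
  "hyperbolic_surface M d \<longleftrightarrow>
     Metric_space M d \<and> M \<noteq> {} \<and> length_metric M d \<and>
     (\<forall>p\<in>M. \<exists>U \<phi>. p \<in> U \<and> isometric_chart M d U \<phi>)"

text \<open>Transition maps between isometric charts are isometries between open subsets of the hyperbolic
  plane; such a map preserves the orientation iff it is holomorphic.\<close>

definition orientable_surface :: "'a set \<Rightarrow> ('a \<Rightarrow> 'a \<Rightarrow> real) \<Rightarrow> bool" where
  "orientable_surface M d \<longleftrightarrow>
     (\<exists>\<A>. (\<forall>(U, \<phi>)\<in>\<A>. isometric_chart M d U \<phi>) \<and> M \<subseteq> (\<Union>(U, \<phi>)\<in>\<A>. U) \<and>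
          (\<forall>(U, \<phi>)\<in>\<A>. \<forall>(V, \<psi>)\<in>\<A>. (\<psi> \<circ> inv_into U \<phi>) holomorphic_on \<phi> ` (U \<inter> V)))"

text \<open>The total area: a supremum over finite disjoint families of Borel pieces \<open>E\<close>, each measured
  in an isometric chart.\<close>

definition surface_area :: "'a set \<Rightarrow> ('a \<Rightarrow> 'a \<Rightarrow> real) \<Rightarrow> ennreal" where
  "surface_area M d =
     (SUP F\<in>{F. finite F \<and>
               (\<forall>(E, U, \<phi>)\<in>F. isometric_chart M d U \<phi> \<and> E \<subseteq> U \<and> \<phi> ` E \<in> sets borel) \<and>
               (\<forall>p\<in>F. \<forall>q\<in>F. p \<noteq> q \<longrightarrow> fst p \<inter> fst q = {})}.
        \<Sum>(E, U, \<phi>)\<in>F. hyp_area (\<phi> ` E))"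

text \<open>The genus is the largest number of pairwise disjoint simple closed curves whose union does not
  separate the surface.\<close>

definition nonseparating_curves :: "'a topology \<Rightarrow> 'a set set \<Rightarrow> bool" where
  "nonseparating_curves X S \<longleftrightarrow>
     finite S \<and> pairwise disjnt S \<and>
     (\<forall>c\<in>S. c \<subseteq> topspace X \<and>
            subtopology X c homeomorphic_space top_of_set (sphere (0::complex) 1)) \<and>
     connected_space (subtopology X (topspace X - \<Union>S))"

definition has_genus :: "'a topology \<Rightarrow> nat \<Rightarrow> bool" where
  "has_genus X g \<longleftrightarrow>
     (\<exists>S. nonseparating_curves X S \<and> card S = g) \<and>
     (\<forall>S. nonseparating_curves X S \<longrightarrow> card S \<le> g)"

text \<open>A cusp region is the image of a locally isometric injection of
  \<open>{z. Im z \<ge> 1} / (z \<mapsto> z + \<xi>)\<close>, given here by its lift \<open>f\<close>. The isometry is one of Riemannian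
  surfaces, hence stated locally: \<open>d\<close> may take shortcuts outside the region.\<close>

definition cusp_region :: "'a set \<Rightarrow> ('a \<Rightarrow> 'a \<Rightarrow> real) \<Rightarrow> real \<Rightarrow> 'a set \<Rightarrow> bool" where
  "cusp_region M d \<xi> R \<longleftrightarrow>
     R \<subseteq> M \<and>
     (\<exists>f. f ` {z. Im z \<ge> 1} = R \<and>
        (\<forall>z\<in>{z. Im z \<ge> 1}. \<forall>w\<in>{z. Im z \<ge> 1}.
           f z = f w \<longleftrightarrow> (\<exists>k::int. w = z + of_int k * of_real \<xi>)) \<and>
        (\<forall>z\<in>{z. Im z \<ge> 1}. \<exists>e>0. \<forall>u\<in>{z. Im z \<ge> 1}. \<forall>v\<in>{z. Im z \<ge> 1}.
           hyp_dist z u < e \<and> hyp_dist z v < e \<longrightarrow> d (f u) (f v) = hyp_dist u v))"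

definition truncated_surface :: "'a set \<Rightarrow> ('a \<Rightarrow> 'a \<Rightarrow> real) \<Rightarrow> real \<Rightarrow> 'a set" where
  "truncated_surface M d \<xi> =
     Metric_space.mtopology M d closure_of (M - \<Union>{R. cusp_region M d \<xi> R})"

text \<open>For \<open>0 < \<xi> \<le> 2\<close>, every cusp has exactly one cusp region of area \<open>\<xi>\<close>, so the cusps are
  counted by their regions of area 1.\<close>

definition has_cusps :: "'a set \<Rightarrow> ('a \<Rightarrow> 'a \<Rightarrow> real) \<Rightarrow> nat \<Rightarrow> bool" where
  "has_cusps M d n \<longleftrightarrow> finite {R. cusp_region M d 1 R} \<and> card {R. cusp_region M d 1 R} = n"

text \<open>The surface \<open>(M, d)\<close> represents a point of the moduli space of signature \<open>(g, n)\<close>, whose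
  points are isometry classes of such surfaces.\<close>

definition represents_moduli :: "nat \<Rightarrow> nat \<Rightarrow> 'a set \<Rightarrow> ('a \<Rightarrow> 'a \<Rightarrow> real) \<Rightarrow> bool" where
  "represents_moduli g n M d \<longleftrightarrow>
     hyperbolic_surface M d \<and>
     Metric_space.mcomplete M d \<and>
     connected_space (Metric_space.mtopology M d) \<and>
     orientable_surface M d \<and>
     surface_area M d < \<infinity> \<and>
     has_genus (Metric_space.mtopology M d) g \<and>
     has_cusps M d n"

end

theory Submission
  imports Defs "HOL-Complex_Analysis.Complex_Analysis"
begin

text \<open>The developing map presents the surface as the quotient of the upper half plane by a discrete
torsion-free group. By a Margulis lemma (a commutator with the element of least displacement is
displaced even less) and finiteness of the area, the thick part is cobounded and the rest consists of
disjoint horoballs. An arc of \<open>\<bar>z\<bar> = R\<close> whose chord meets the complement of the horoballs does not lie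
in one of them, hence contains a thick point, so orbit points reach \<open>\<bar>z\<bar> \<ge> R\<close> at
displacement \<open>O(log R)\<close>, in every frame of a bounded set.

The part of the surface off the cusp regions is covered by boundedly many rectangles of height
\<open>O(1 / \<xi>)\<close>, hence up to \<open>\<epsilon>\<close> by \<open>O(1 / \<epsilon>)\<close> vertical segments. For \<open>\<rho>\<close> of order \<open>\<epsilon> \<xi>\<^sup>2\<close>, consecutive
segments are linked by group elements of displacement \<open>O(log (1 / \<rho>))\<close> that map the complement of a
cone of width \<open>\<rho>\<close> at the lower end of one segment into a cone of width \<open>\<rho>\<close> at the upper end of the
other. By ping-pong the cyclic product is hyperbolic and its axis runs close to every segment; its
translation length is at most the sum of the displacements.\<close>

section \<open>The group \<open>SL(2, \<real>)\<close> and the hyperbolic plane\<close>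

text \<open>The power of \<open>1/\<epsilon>\<close> is decided by what is visited: density needs
  about \<open>1/\<epsilon>\<^sup>2\<close> points but only about \<open>1/\<epsilon>\<close> long
  segments, so each segment is run through whole and a transition may cost no more than a logarithm.
  Transitions must exist between arbitrary frames with one constant. Cusps are the obstacle, since
  orbit points need not come close to a geodesic that climbs into a cusp; asking only for large
  modulus, not for a given boundary point, leaves a whole arc to choose from.

  The scale \<open>\<epsilon> \<xi>\<^sup>2\<close> arises because an axis whose ends are perturbed
  by \<open>\<rho>\<close> leaves the vertical line by about \<open>\<rho> Y\<^sup>2\<close> at
  height \<open>Y\<close>, and heights reach order \<open>1/\<xi>\<close>.

  Ping-pong takes place on lines of the real plane instead of boundary points, so that infinity is
  not special. Elements are therefore matrices, and the sign is carried along by \<open>mneg\<close>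
  and \<open>triv\<close>.

  For \<open>1 < \<epsilon> \<le> 2\<close> and \<open>\<xi> = 1\<close> the sum of the two
  logarithms is negative while lengths are positive; hence the maximum with \<open>ln 2\<close> in
  the final bound.\<close>

typedef sl2 = "{(a, b, c, d). a * d - b * c = (1::real)}"
  by (rule exI[of _ "(1, 0, 0, 1)"]) simp

definition ea :: "sl2 \<Rightarrow> real" where "ea A = fst (Rep_sl2 A)"
definition eb :: "sl2 \<Rightarrow> real" where "eb A = fst (snd (Rep_sl2 A))"
definition ec :: "sl2 \<Rightarrow> real" where "ec A = fst (snd (snd (Rep_sl2 A)))"
definition ed :: "sl2 \<Rightarrow> real" where "ed A = snd (snd (snd (Rep_sl2 A)))"

definition mk :: "real \<Rightarrow> real \<Rightarrow> real \<Rightarrow> real \<Rightarrow> sl2" where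
  "mk a b c d = Abs_sl2 (a, b, c, d)"

lemma sl2_det: "ea A * ed A - eb A * ec A = 1"
  using Rep_sl2[of A] by (auto simp: ea_def eb_def ec_def ed_def split: prod.splits)

lemma sl2_eqI: "ea A = ea B \<Longrightarrow> eb A = eb B \<Longrightarrow> ec A = ec B \<Longrightarrow> ed A = ed B \<Longrightarrow> A = B"
  by (simp add: ea_def eb_def ec_def ed_def Rep_sl2_inject[symmetric] prod_eq_iff)

lemma mk_entries:
  assumes "a * d - b * c = 1"
  shows "ea (mk a b c d) = a" "eb (mk a b c d) = b" "ec (mk a b c d) = c" "ed (mk a b c d) = d"
  using assms by (simp_all add: ea_def eb_def ec_def ed_def mk_def Abs_sl2_inverse)

instantiation sl2 :: monoid_mult
begin
definition "1 = mk 1 0 0 1"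
definition "A * B = mk (ea A * ea B + eb A * ec B) (ea A * eb B + eb A * ed B)
                       (ec A * ea B + ed A * ec B) (ec A * eb B + ed A * ed B)"

lemma times_entries_aux:
  "(ea A * ea B + eb A * ec B) * (ec A * eb B + ed A * ed B) -
   (ea A * eb B + eb A * ed B) * (ec A * ea B + ed A * ec B) = 1"
proof -
  have "(ea A * ea B + eb A * ec B) * (ec A * eb B + ed A * ed B) -
   (ea A * eb B + eb A * ed B) * (ec A * ea B + ed A * ec B)
   = (ea A * ed A - eb A * ec A) * (ea B * ed B - eb B * ec B)"
    by (simp add: algebra_simps)
  then show ?thesis by (simp add: sl2_det)
qed

lemma times_entries_raw:
  "ea (A * B) = ea A * ea B + eb A * ec B" "eb (A * B) = ea A * eb B + eb A * ed B"
  "ec (A * B) = ec A * ea B + ed A * ec B" "ed (A * B) = ec A * eb B + ed A * ed B"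
  unfolding times_sl2_def using times_entries_aux by (simp_all add: mk_entries)

lemma one_entries_raw:
  "ea 1 = 1" "eb 1 = 0" "ec 1 = 0" "ed 1 = 1"
  unfolding one_sl2_def by (simp_all add: mk_entries)

instance
  by standard (auto intro!: sl2_eqI simp: times_entries_raw one_entries_raw algebra_simps)
end

lemmas times_entries [simp] = times_entries_raw
lemmas one_entries [simp] = one_entries_raw

definition minv :: "sl2 \<Rightarrow> sl2" where
  "minv A = mk (ed A) (- eb A) (- ec A) (ea A)"

definition mneg :: "sl2 \<Rightarrow> sl2" where
  "mneg A = mk (- ea A) (- eb A) (- ec A) (- ed A)"

lemma minv_entries [simp]:
  "ea (minv A) = ed A" "eb (minv A) = - eb A" "ec (minv A) = - ec A" "ed (minv A) = ea A"
  using sl2_det[of A] unfolding minv_def by (simp_all add: mk_entries algebra_simps)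

lemma mneg_entries [simp]:
  "ea (mneg A) = - ea A" "eb (mneg A) = - eb A" "ec (mneg A) = - ec A" "ed (mneg A) = - ed A"
  using sl2_det[of A] unfolding mneg_def by (simp_all add: mk_entries algebra_simps)

lemma minv_left [simp]: "minv A * A = 1" and minv_right [simp]: "A * minv A = 1"
  using sl2_det[of A] by (auto intro!: sl2_eqI simp: algebra_simps)

lemma minv_minv [simp]: "minv (minv A) = A"
  and minv_one [simp]: "minv 1 = 1"
  and minv_mult: "minv (A * B) = minv B * minv A"
  and mneg_mneg [simp]: "mneg (mneg A) = A"
  and mneg_mult_left: "mneg A * B = mneg (A * B)"
  and mneg_mult_right: "A * mneg B = mneg (A * B)"
  by (auto intro!: sl2_eqI simp: algebra_simps)

lemma minv_left_assoc [simp]: "minv A * (A * B) = B"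
  and minv_right_assoc [simp]: "A * (minv A * B) = B"
  by (simp_all add: mult.assoc[symmetric])

section \<open>The Moebius action and the hyperbolic distance\<close>

definition mob :: "sl2 \<Rightarrow> complex \<Rightarrow> complex" where
  "mob A z = (of_real (ea A) * z + of_real (eb A)) / (of_real (ec A) * z + of_real (ed A))"

abbreviation cden :: "sl2 \<Rightarrow> complex \<Rightarrow> complex" where
  "cden A z \<equiv> of_real (ec A) * z + of_real (ed A)"

lemma cden_nz:
  assumes "Im z > 0" shows "cden A z \<noteq> 0"
proof
  assume h: "cden A z = 0"
  then have "Im (cden A z) = 0" by simp
  then have c: "ec A = 0" using assms by simp
  then have "ed A = 0" using h by simp
  then show False using c sl2_det[of A] by simp
qed

lemma cmod_cden: "(cmod (cden A z))\<^sup>2 = (ec A * Re z + ed A)\<^sup>2 + (ec A * Im z)\<^sup>2"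
  by (simp add: cmod_power2)

lemma Im_mob:
  assumes "Im z > 0" shows "Im (mob A z) = Im z / (cmod (cden A z))\<^sup>2"
proof -
  have "Im (mob A z) * (cmod (cden A z))\<^sup>2 = Im z"
  proof -
    have nz: "(cmod (cden A z))\<^sup>2 \<noteq> 0" using cden_nz[OF assms, of A] by simp
    have "Im (mob A z) = (Im (of_real (ea A) * z + of_real (eb A)) * Re (cden A z)
        - Re (of_real (ea A) * z + of_real (eb A)) * Im (cden A z)) / (cmod (cden A z))\<^sup>2"
      unfolding mob_def by (simp only: Im_divide cmod_power2)
    also have "\<dots> = (ea A * ed A - eb A * ec A) * Im z / (cmod (cden A z))\<^sup>2"
      by (simp add: algebra_simps)
    finally show ?thesis using nz by (simp add: sl2_det)
  qed
  then show ?thesis using cden_nz[OF assms, of A] by (simp add: field_simps)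
qed

lemma Im_mob_pos [simp]: "Im z > 0 \<Longrightarrow> Im (mob A z) > 0"
  using cden_nz[of z A] by (simp add: Im_mob)

lemma mob_one [simp]: "mob 1 z = z"
  by (simp add: mob_def)

lemma mob_mult:
  assumes "Im z > 0" shows "mob (A * B) z = mob A (mob B z)"
proof -
  have 1: "cden B z \<noteq> 0" using cden_nz[OF assms] .
  have 2: "cden A (mob B z) \<noteq> 0" using cden_nz[of "mob B z"] assms by simp
  have e0: "cden (A * B) z = of_real (ec A) * (of_real (ea B) * z + of_real (eb B)) + of_real (ed A) * cden B z"
    by (simp add: algebra_simps)
  have gen: "x * (n / D) + y = (x * n + y * D) / D" if "D \<noteq> 0" for x y n D :: complex
    using that by (simp add: add_divide_distrib)
  have e: "cden A (mob B z) = cden (A * B) z / cden B z"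
    unfolding e0 mob_def by (rule gen[OF 1])
  have e1: "of_real (ea (A * B)) * z + of_real (eb (A * B)) =
      of_real (ea A) * (of_real (ea B) * z + of_real (eb B)) + of_real (eb A) * cden B z"
    by (simp add: algebra_simps)
  have e2: "of_real (ea A) * mob B z + of_real (eb A) =
     (of_real (ea (A * B)) * z + of_real (eb (A * B))) / cden B z"
    unfolding e1 mob_def by (rule gen[OF 1])
  have "mob A (mob B z) = ((of_real (ea (A * B)) * z + of_real (eb (A * B))) / cden B z) / (cden (A * B) z / cden B z)"
    unfolding mob_def[of A] e e2 ..
  also have "\<dots> = mob (A * B) z" unfolding mob_def using 1 by simp
  finally show ?thesis ..
qed

lemma mob_minv [simp]:
  "Im z > 0 \<Longrightarrow> mob (minv A) (mob A z) = z" "Im z > 0 \<Longrightarrow> mob A (mob (minv A) z) = z"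
  using mob_mult[of z "minv A" A] mob_mult[of z A "minv A"] by simp_all

lemma mob_mneg [simp]: "mob (mneg A) z = mob A z"
proof -
  have "mob (mneg A) z = (- (of_real (ea A) * z + of_real (eb A))) / (- cden A z)"
    unfolding mob_def by (simp add: algebra_simps)
  then show ?thesis by (simp only: minus_divide_divide mob_def)
qed

lemma mob_inj:
  assumes z: "Im z > 0" "Im w > 0"
  shows "mob A z = mob A w \<longleftrightarrow> z = w"
proof
  assume "mob A z = mob A w"
  then have "mob (minv A) (mob A z) = mob (minv A) (mob A w)" by simp
  then show "z = w" using z by simp
qed simp

lemma of_real_det: "complex_of_real (ea A) * of_real (ed A) = 1 + of_real (eb A) * of_real (ec A)"
proof -
  have "ea A * ed A = 1 + eb A * ec A" using sl2_det[of A] by simp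
  then have "complex_of_real (ea A * ed A) = complex_of_real (1 + eb A * ec A)" by (rule arg_cong)
  then show ?thesis by simp
qed

lemma mob_diff:
  assumes "Im z > 0" "Im w > 0"
  shows "cmod (mob A z - mob A w) = cmod (z - w) / (cmod (cden A z) * cmod (cden A w))"
proof -
  have 1: "cden A z \<noteq> 0" "cden A w \<noteq> 0" using cden_nz assms by auto
  have d: "complex_of_real (ea A) * of_real (ed A) = 1 + of_real (eb A) * of_real (ec A)"
    by (rule of_real_det)
  have "mob A z - mob A w = (z - w) / (cden A z * cden A w)"
  proof -
    have "(of_real (ea A) * z + of_real (eb A)) * cden A w - (of_real (ea A) * w + of_real (eb A)) * cden A z
       = (of_real (ea A) * of_real (ed A) - of_real (eb A) * of_real (ec A)) * (z - w)"
      by (simp add: algebra_simps)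
    also have "\<dots> = z - w" by (simp add: d)
    finally show ?thesis unfolding mob_def using 1 by (simp add: diff_frac_eq)
  qed
  then show ?thesis by (simp add: norm_divide norm_mult)
qed

lemma mob_has_deriv:
  assumes "Im z > 0"
  shows "(mob A has_field_derivative 1 / (cden A z)\<^sup>2) (at z within S)"
proof -
  have 1: "cden A z \<noteq> 0" using cden_nz assms by auto
  have d: "complex_of_real (ea A) * of_real (ed A) = 1 + of_real (eb A) * of_real (ec A)"
    by (rule of_real_det)
  have "((\<lambda>z. (of_real (ea A) * z + of_real (eb A)) / cden A z) has_field_derivative
     (of_real (ea A) * cden A z - (of_real (ea A) * z + of_real (eb A)) * of_real (ec A)) / (cden A z * cden A z)) (at z within S)"
    using 1 by (auto intro!: derivative_eq_intros)
  moreover have "of_real (ea A) * cden A z - (of_real (ea A) * z + of_real (eb A)) * of_real (ec A) = 1"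
    using d by (simp add: algebra_simps)
  ultimately show ?thesis unfolding mob_def[abs_def] by (simp add: power2_eq_square)
qed

lemma mob_holomorphic: "S \<subseteq> {z. Im z > 0} \<Longrightarrow> mob A holomorphic_on S"
  unfolding holomorphic_on_def field_differentiable_def using mob_has_deriv by blast

lemma hyp_dist_mob [simp]:
  assumes "Im z > 0" "Im w > 0"
  shows "hyp_dist (mob A z) (mob A w) = hyp_dist z w"
proof -
  have "cden A z \<noteq> 0" "cden A w \<noteq> 0" using cden_nz assms by auto
  then have "(cmod (mob A z - mob A w))\<^sup>2 / (2 * Im (mob A z) * Im (mob A w)) = (cmod (z - w))\<^sup>2 / (2 * Im z * Im w)"
    using assms by (simp add: mob_diff Im_mob power_mult_distrib power_divide)
  then show ?thesis unfolding hyp_dist_def by simp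
qed

lemma hyp_dist_commute: "hyp_dist z w = hyp_dist w z"
  unfolding hyp_dist_def by (simp add: norm_minus_commute mult.commute mult.left_commute)

lemma cosh_hyp_dist:
  assumes "Im z > 0" "Im w > 0"
  shows "cosh (hyp_dist z w) = 1 + (cmod (z - w))\<^sup>2 / (2 * Im z * Im w)"
  unfolding hyp_dist_def using assms by (intro cosh_arcosh_real) simp

lemma hyp_dist_nonneg:
  assumes "Im z > 0" "Im w > 0"
  shows "0 \<le> hyp_dist z w"
  unfolding hyp_dist_def using assms by (intro arcosh_nonneg_real) simp

lemma hyp_dist_self [simp]: "hyp_dist z z = 0"
  by (simp add: hyp_dist_def)

lemma hyp_dist_eq_0:
  assumes "Im z > 0" "Im w > 0"
  shows "hyp_dist z w = 0 \<longleftrightarrow> z = w"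
proof
  assume "hyp_dist z w = 0"
  then have "(cmod (z - w))\<^sup>2 / (2 * Im z * Im w) = 0" using cosh_hyp_dist[OF assms] by simp
  then show "z = w" using assms by simp
qed simp

lemma cosh_mono_iff: "0 \<le> x \<Longrightarrow> 0 \<le> y \<Longrightarrow> cosh (x::real) \<le> cosh y \<longleftrightarrow> x \<le> y"
  by (rule cosh_real_nonneg_le_iff)

lemma cosh_double_half: "cosh (x::real) = 1 + 2 * (sinh (x/2))\<^sup>2" "cosh (x::real) = 2 * (cosh (x/2))\<^sup>2 - 1"
proof -
  have "cosh x = (cosh (x/2))\<^sup>2 + (sinh (x/2))\<^sup>2" using cosh_double[of "x/2"] by simp
  moreover have "(cosh (x/2))\<^sup>2 = (sinh (x/2))\<^sup>2 + 1" by (rule cosh_square_eq)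
  ultimately show "cosh x = 1 + 2 * (sinh (x/2))\<^sup>2" "cosh x = 2 * (cosh (x/2))\<^sup>2 - 1" by auto
qed

lemma sinh_half_hyp_dist:
  assumes "Im z > 0" "Im w > 0"
  shows "sinh (hyp_dist z w / 2) = cmod (z - w) / (2 * sqrt (Im z * Im w))"
proof -
  have "(sinh (hyp_dist z w / 2))\<^sup>2 = (cmod (z - w) / (2 * sqrt (Im z * Im w)))\<^sup>2"
    using cosh_hyp_dist[OF assms] cosh_double_half(1)[of "hyp_dist z w"] assms
    by (simp add: power_divide power_mult_distrib)
  moreover have "sinh (hyp_dist z w / 2) \<ge> 0" using hyp_dist_nonneg[OF assms] by simp
  ultimately show ?thesis using assms by (simp add: power2_eq_iff_nonneg)
qed

lemma cosh_half_hyp_dist: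
  assumes "Im z > 0" "Im w > 0"
  shows "cosh (hyp_dist z w / 2) = cmod (z - cnj w) / (2 * sqrt (Im z * Im w))"
proof -
  have "(cmod (z - cnj w))\<^sup>2 = (cmod (z - w))\<^sup>2 + 4 * Im z * Im w"
    unfolding cmod_power2 by (simp add: power2_eq_square algebra_simps)
  moreover have "2 * (cosh (hyp_dist z w / 2))\<^sup>2 - 1 = 1 + (cmod (z - w))\<^sup>2 / (2 * Im z * Im w)"
    using cosh_hyp_dist[OF assms] cosh_double_half(2)[of "hyp_dist z w"] by simp
  ultimately have "(cosh (hyp_dist z w / 2))\<^sup>2 = (cmod (z - cnj w) / (2 * sqrt (Im z * Im w)))\<^sup>2"
    using assms by (simp add: power_divide power_mult_distrib field_simps)
  then show ?thesis using assms by (simp add: power2_eq_iff_nonneg)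
qed

text \<open>Ptolemy's inequality for \<open>z, v, w, cnj v\<close>.\<close>

lemma hyp_dist_triangle:
  assumes "Im z > 0" "Im v > 0" "Im w > 0"
  shows "hyp_dist z w \<le> hyp_dist z v + hyp_dist v w"
proof -
  define a where "a = hyp_dist z v" define b where "b = hyp_dist v w"
  have s: "sqrt (Im z * Im w) > 0" "sqrt (Im z) > 0" "sqrt (Im v) > 0" "sqrt (Im w) > 0" using assms by auto
  have "(z - w) * (v - cnj v) = (z - v) * (w - cnj v) + (z - cnj v) * (v - w)"
    by (simp add: algebra_simps)
  then have "cmod ((z - w) * (v - cnj v)) \<le> cmod ((z - v) * (w - cnj v)) + cmod ((z - cnj v) * (v - w))"
    by (simp only: norm_triangle_ineq)
  then have "cmod (z - w) * cmod (v - cnj v) \<le> cmod (z - v) * cmod (w - cnj v) + cmod (z - cnj v) * cmod (v - w)"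
    by (simp only: norm_mult)
  moreover have "cmod (v - cnj v) = 2 * Im v" using assms by (simp add: complex_diff_cnj norm_mult)
  ultimately have p: "cmod (z - w) * (2 * Im v) \<le> cmod (z - v) * cmod (w - cnj v) + cmod (z - cnj v) * cmod (v - w)"
    by simp
  have sv: "Im v = sqrt (Im v) * sqrt (Im v)" using assms by simp
  have "sinh ((a + b) / 2) = sinh (a/2) * cosh (b/2) + cosh (a/2) * sinh (b/2)"
    by (simp add: add_divide_distrib sinh_add)
  also have "\<dots> = (cmod (z - v) * cmod (w - cnj v) + cmod (z - cnj v) * cmod (v - w)) / (4 * sqrt (Im z * Im v) * sqrt (Im v * Im w))"
    unfolding a_def b_def sinh_half_hyp_dist[OF assms(1,2)] cosh_half_hyp_dist[OF assms(1,2)]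
      sinh_half_hyp_dist[OF assms(2,3)] hyp_dist_commute[of v w] cosh_half_hyp_dist[OF assms(3,2)]
    using hyp_dist_commute[of v w] sinh_half_hyp_dist[OF assms(2,3)] sinh_half_hyp_dist[OF assms(3,2)]
    by (simp add: add_divide_distrib norm_minus_commute mult.commute)
  also have "\<dots> \<ge> (cmod (z - w) * (2 * Im v)) / (4 * sqrt (Im z * Im v) * sqrt (Im v * Im w))"
    using p assms by (intro divide_right_mono) auto
  also have "(cmod (z - w) * (2 * Im v)) / (4 * sqrt (Im z * Im v) * sqrt (Im v * Im w)) = cmod (z - w) / (2 * sqrt (Im z * Im w))"
  proof -
    have gen: "X * (2 * (r * r)) / (4 * (p * r) * (r * q)) = X / (2 * (p * q))" if "r \<noteq> 0" for X p q r :: real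
      using that by simp
    show ?thesis using gen[of "sqrt (Im v)" "cmod (z - w)" "sqrt (Im z)" "sqrt (Im w)"] s sv
      by (simp add: real_sqrt_mult)
  qed
  also have "\<dots> = sinh (hyp_dist z w / 2)" using sinh_half_hyp_dist[of z w] assms by simp
  finally have "hyp_dist z w / 2 \<le> (a + b) / 2" by simp
  then show ?thesis by (simp add: a_def b_def)
qed

lemma le_sinh: "0 \<le> (x::real) \<Longrightarrow> x \<le> sinh x"
proof -
  assume x: "0 \<le> x"
  have "sinh 0 - 0 \<le> sinh x - x"
  proof (rule DERIV_nonneg_imp_nondecreasing[OF x, where f = "\<lambda>x. sinh x - x"])
    fix t :: real
    have "((\<lambda>x. sinh x - x) has_real_derivative (cosh t - 1)) (at t)"
      by (auto intro!: derivative_eq_intros)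
    then show "\<exists>y. ((\<lambda>x. sinh x - x) has_real_derivative y) (at t) \<and> 0 \<le> y"
      using cosh_real_ge_1[of t] by auto
  qed
  then show ?thesis by simp
qed

lemma hyp_dist_le_euclid:
  assumes "Im z > 0" "Im w > 0"
  shows "hyp_dist z w \<le> cmod (z - w) / sqrt (Im z * Im w)"
proof -
  have "hyp_dist z w / 2 \<le> sinh (hyp_dist z w / 2)"
    using hyp_dist_nonneg[OF assms] by (intro le_sinh) simp
  then show ?thesis using sinh_half_hyp_dist[OF assms] by simp
qed

section \<open>Hyperbolic balls\<close>

definition hball :: "complex \<Rightarrow> real \<Rightarrow> complex set" where
  "hball z r = {w. Im w > 0 \<and> hyp_dist z w < r}"

lemma hball_pos: "w \<in> hball z r \<Longrightarrow> Im w > 0"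
  by (simp add: hball_def)

lemma centre_in_hball [simp]: "Im z > 0 \<Longrightarrow> z \<in> hball z r \<longleftrightarrow> r > 0"
  by (simp add: hball_def)

lemma hball_sym: "Im z > 0 \<Longrightarrow> Im w > 0 \<Longrightarrow> w \<in> hball z r \<longleftrightarrow> z \<in> hball w r"
  by (simp add: hball_def hyp_dist_commute)

lemma hball_mono: "r \<le> s \<Longrightarrow> hball z r \<subseteq> hball z s"
  by (auto simp: hball_def)

text \<open>Both membership conditions are quadratic inequalities in \<open>w\<close>, and
  \<open>cosh\<^sup>2 = sinh\<^sup>2 + 1\<close> turns one into the other. Openness and convexity of
  \<open>hball\<close> follow, and with convexity the connectedness of intersections of two balls,
  on which continuation relies.\<close>

lemma hball_eq:
  assumes z: "Im z > 0" and r: "r > 0"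
  shows "hball z r = ball (Complex (Re z) (Im z * cosh r)) (Im z * sinh r)"
proof (rule set_eqI)
  fix w
  let ?c = "Complex (Re z) (Im z * cosh r)"
  have sq: "(cmod (?c - w))\<^sup>2 - (Im z * sinh r)\<^sup>2 = (cmod (z - w))\<^sup>2 - 2 * Im z * Im w * (cosh r - 1)"
  proof -
    have "(cosh r)\<^sup>2 = (sinh r)\<^sup>2 + 1" by (rule cosh_square_eq)
    then have c: "(Im z * cosh r)\<^sup>2 = (Im z * sinh r)\<^sup>2 + (Im z)\<^sup>2" by (simp add: power_mult_distrib algebra_simps)
    have "(cmod (?c - w))\<^sup>2 = (Re z - Re w)\<^sup>2 + ((Im z * cosh r)\<^sup>2 - 2 * Im z * cosh r * Im w + (Im w)\<^sup>2)"
      by (simp add: cmod_power2 power2_diff)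
    moreover have "(cmod (z - w))\<^sup>2 = (Re z - Re w)\<^sup>2 + ((Im z)\<^sup>2 - 2 * Im z * Im w + (Im w)\<^sup>2)"
      by (simp add: cmod_power2 power2_diff)
    ultimately show ?thesis using c by (simp add: algebra_simps)
  qed
  have ball: "w \<in> ball ?c (Im z * sinh r) \<longleftrightarrow> (cmod (?c - w))\<^sup>2 < (Im z * sinh r)\<^sup>2"
  proof -
    have "Im z * sinh r \<ge> 0" using z r by simp
    then show ?thesis unfolding mem_ball dist_norm by (metis norm_ge_zero power2_less_imp_less power_strict_mono pos2)
  qed
  have hb: "hyp_dist z w < r \<longleftrightarrow> (cmod (z - w))\<^sup>2 < 2 * Im z * Im w * (cosh r - 1)" if w: "Im w > 0"
  proof -
    have "hyp_dist z w < r \<longleftrightarrow> cosh (hyp_dist z w) < cosh r"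
      using hyp_dist_nonneg[OF z w] r by (simp add: cosh_real_nonneg_less_iff)
    also have "\<dots> \<longleftrightarrow> (cmod (z - w))\<^sup>2 < 2 * Im z * Im w * (cosh r - 1)"
      unfolding cosh_hyp_dist[OF z w] using z w by (auto simp: field_simps)
    finally show ?thesis .
  qed
  show "w \<in> hball z r \<longleftrightarrow> w \<in> ball ?c (Im z * sinh r)"
  proof
    assume "w \<in> hball z r"
    then have "(cmod (?c - w))\<^sup>2 < (Im z * sinh r)\<^sup>2" using hb sq by (simp add: hball_def)
    then show "w \<in> ball ?c (Im z * sinh r)" using ball by blast
  next
    assume h: "w \<in> ball ?c (Im z * sinh r)"
    have "\<bar>Im (?c - w)\<bar> < Im z * sinh r" using h abs_Im_le_cmod[of "?c - w"] by (simp add: dist_norm)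
    then have "Im w > Im z * (cosh r - sinh r)" by (auto simp: algebra_simps abs_less_iff)
    moreover have "Im z * (cosh r - sinh r) > 0" using z by (simp add: cosh_minus_sinh)
    ultimately have w: "Im w > 0" by linarith
    have "(cmod (?c - w))\<^sup>2 < (Im z * sinh r)\<^sup>2" using ball h by blast
    then show "w \<in> hball z r" using hb[OF w] w sq by (simp add: hball_def)
  qed
qed

lemma hball_empty: "Im z > 0 \<Longrightarrow> r \<le> 0 \<Longrightarrow> hball z r = {}"
  using hyp_dist_nonneg[of z] by (fastforce simp: hball_def)

lemma open_hball [simp]: "Im z > 0 \<Longrightarrow> open (hball z r)"
  by (cases "r > 0") (simp_all add: hball_eq hball_empty)

lemma convex_hball: "Im z > 0 \<Longrightarrow> convex (hball z r)"
  by (cases "r > 0") (simp_all add: hball_eq hball_empty)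

lemma hball_subset_ball:
  assumes z: "Im z > 0" and e: "e > 0"
  shows "\<exists>\<delta>>0. hball z \<delta> \<subseteq> ball z e"
proof (intro exI conjI)
  \<comment> \<open>With this radius the top of the hyperbolic ball, at height
    \<open>Im z * exp ?\<delta>\<close>, lies exactly at Euclidean distance \<open>e\<close> above
    \<open>z\<close>; it is the farthest point of the ball.\<close>
  let ?\<delta> = "ln (1 + e / Im z)"
  show d: "?\<delta> > 0" using assms by (simp add: ln_gt_zero)
  have ex: "exp ?\<delta> = 1 + e / Im z" using assms by (subst exp_ln) (auto intro: add_pos_pos)
  show "hball z ?\<delta> \<subseteq> ball z e"
  proof
    fix w assume "w \<in> hball z ?\<delta>"
    then have "w \<in> ball (Complex (Re z) (Im z * cosh ?\<delta>)) (Im z * sinh ?\<delta>)" using hball_eq[OF z d] by simp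
    then have 1: "cmod (Complex (Re z) (Im z * cosh ?\<delta>) - w) < Im z * sinh ?\<delta>" by (simp add: dist_norm)
    have "z - Complex (Re z) (Im z * cosh ?\<delta>) = of_real (Im z * (1 - cosh ?\<delta>)) * \<i>"
      by (simp add: complex_eq_iff algebra_simps)
    then have "cmod (z - Complex (Re z) (Im z * cosh ?\<delta>)) = \<bar>Im z * (1 - cosh ?\<delta>)\<bar>"
      by (simp only: norm_mult norm_of_real norm_ii mult_1_right)
    then have "cmod (z - Complex (Re z) (Im z * cosh ?\<delta>)) = Im z * (cosh ?\<delta> - 1)"
      using z cosh_real_ge_1[of ?\<delta>] by (simp add: abs_mult)
    then have "cmod (z - w) < Im z * (cosh ?\<delta> - 1) + Im z * sinh ?\<delta>"
      using 1 norm_triangle_ineq[of "z - Complex (Re z) (Im z * cosh ?\<delta>)" "Complex (Re z) (Im z * cosh ?\<delta>) - w"] by simp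
    also have "\<dots> = Im z * (cosh ?\<delta> + sinh ?\<delta> - 1)" by (simp add: algebra_simps)
    also have "\<dots> = e" unfolding cosh_plus_sinh ex using z by simp
    finally show "w \<in> ball z e" by (simp add: dist_norm)
  qed
qed

lemma hball_in_open:
  assumes "Im z > 0" "open S" "z \<in> S"
  shows "\<exists>\<delta>>0. hball z \<delta> \<subseteq> S"
proof -
  obtain e where "e > 0" "ball z e \<subseteq> S" using assms(2,3) open_contains_ball by blast
  then show ?thesis using hball_subset_ball[OF assms(1), of e] by blast
qed

lemma open_upper_half_plane: "open upper_half_plane"
  by (simp add: upper_half_plane_def open_halfspace_Im_gt)

lemma mob_in_hball:
  assumes "Im z > 0" "Im w > 0"
  shows "mob A w \<in> hball (mob A z) r \<longleftrightarrow> w \<in> hball z r"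
  using assms by (simp add: hball_def)

lemma hball_triangle: "Im z > 0 \<Longrightarrow> w \<in> hball z r \<Longrightarrow> u \<in> hball w s \<Longrightarrow> u \<in> hball z (r + s)"
  using hyp_dist_triangle[of z w u] by (auto simp: hball_def)

lemma hyp_dist_imag_axis:
  assumes "s > 0" "t > 0"
  shows "hyp_dist (of_real s * \<i>) (of_real t * \<i>) = \<bar>ln s - ln t\<bar>"
proof -
  have "of_real s * \<i> - of_real t * \<i> = of_real (s - t) * \<i>" by (simp add: algebra_simps)
  then have "cmod (of_real s * \<i> - of_real t * \<i>) = \<bar>s - t\<bar>" by (simp only: norm_mult norm_of_real norm_ii mult_1_right)
  then have "cosh (hyp_dist (of_real s * \<i>) (of_real t * \<i>)) = 1 + (s - t)\<^sup>2 / (2 * s * t)"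
    using cosh_hyp_dist[of "of_real s * \<i>" "of_real t * \<i>"] assms by simp
  also have "\<dots> = (s / t + inverse (s / t)) / 2"
    using assms by (simp add: field_simps power2_eq_square)
  also have "\<dots> = cosh (ln (s / t))" using assms by (subst cosh_ln_real) auto
  also have "\<dots> = cosh (ln s - ln t)" using assms by (simp add: ln_div)
  finally show ?thesis using hyp_dist_nonneg[of "of_real s * \<i>" "of_real t * \<i>"] assms by simp
qed

section \<open>Normal forms for points, and rigidity of holomorphic isometries\<close>

definition frame :: "complex \<Rightarrow> sl2" where
  "frame z = mk (sqrt (Im z)) (Re z / sqrt (Im z)) 0 (1 / sqrt (Im z))"

lemma mob_frame:
  assumes "Im z > 0" shows "mob (frame z) \<i> = z"
proof -
  have "sqrt (Im z) * (1 / sqrt (Im z)) - Re z / sqrt (Im z) * 0 = 1" using assms by simp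
  from mk_entries[OF this] have "mob (frame z) \<i> = (of_real (sqrt (Im z)) * \<i> + of_real (Re z / sqrt (Im z))) / of_real (1 / sqrt (Im z))"
    unfolding frame_def mob_def by simp
  also have "\<dots> = of_real (sqrt (Im z) * sqrt (Im z)) * \<i> + of_real (Re z)"
    using assms by (simp add: field_simps flip: of_real_mult)
  also have "\<dots> = z" using assms by (simp add: complex_eq_iff)
  finally show ?thesis .
qed

lemma mob_minv_frame: "Im z > 0 \<Longrightarrow> mob (minv (frame z)) z = \<i>"
  using mob_minv(1)[of \<i> "frame z"] mob_frame[of z] by simp

definition rot :: "real \<Rightarrow> sl2" where
  "rot \<theta> = mk (cos \<theta>) (sin \<theta>) (- sin \<theta>) (cos \<theta>)"

lemma rot_entries: "ea (rot \<theta>) = cos \<theta>" "eb (rot \<theta>) = sin \<theta>" "ec (rot \<theta>) = - sin \<theta>" "ed (rot \<theta>) = cos \<theta>"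
  unfolding rot_def using sin_cos_squared_add2[of \<theta>] by (simp_all add: mk_entries power2_eq_square)

lemma mob_rot_ii: "mob (rot \<theta>) \<i> = \<i>"
proof -
  have "of_real (ea (rot \<theta>)) * \<i> + of_real (eb (rot \<theta>)) = \<i> * cden (rot \<theta>) \<i>"
    by (simp add: rot_entries complex_eq_iff algebra_simps)
  then show ?thesis unfolding mob_def using cden_nz[of \<i> "rot \<theta>"] by simp
qed

lemma mob_rot_half_pi: "mob (rot (pi / 2)) w = - 1 / w"
  by (simp add: mob_def rot_entries)

text \<open>The angle is found by continuity instead of being computed: \<open>rot (pi/2)\<close>
  acts as \<open>z \<mapsto> -1/z\<close>, which reverses the sign of the real part, so the real
  part vanishes at some angle between \<open>0\<close> and \<open>pi/2\<close>.\<close>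

lemma rotate_to_axis:
  assumes w: "Im w > 0"
  shows "\<exists>A t. t \<ge> 1 \<and> mob A \<i> = \<i> \<and> mob A w = of_real t * \<i>"
proof -
  define f where "f \<theta> = Re (mob (rot \<theta>) w)" for \<theta>
  have cont: "continuous_on {0..pi/2} f"
  proof -
    have "cden (rot \<theta>) w \<noteq> 0" for \<theta> using cden_nz[OF w] .
    then show ?thesis unfolding f_def mob_def rot_entries
      by (intro continuous_intros) (auto simp: rot_entries)
  qed
  have f0: "f 0 = Re w" by (simp add: f_def mob_def rot_entries)
  have f1: "f (pi/2) = - Re w / (cmod w)\<^sup>2"
    unfolding f_def mob_rot_half_pi by (simp add: Re_divide cmod_power2)
  have "\<exists>\<theta>. f \<theta> = 0"
  proof (cases "Re w \<le> 0")
    case True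
    then have "f 0 \<le> 0" "0 \<le> f (pi/2)" using f0 f1 by (auto simp: divide_nonpos_nonneg)
    then show ?thesis using IVT'[of f 0 0 "pi/2"] cont by auto
  next
    case False
    then have "f (pi/2) \<le> 0" "0 \<le> f 0" using f0 f1 by auto
    then show ?thesis using IVT2'[of f "pi/2" 0 0] cont by auto
  qed
  then obtain \<theta> where th: "Re (mob (rot \<theta>) w) = 0" unfolding f_def by blast
  define s where "s = Im (mob (rot \<theta>) w)"
  have s: "s > 0" unfolding s_def using w by simp
  have e: "mob (rot \<theta>) w = of_real s * \<i>" using th by (simp add: s_def complex_eq_iff)
  show ?thesis
  proof (cases "s \<ge> 1")
    case True then show ?thesis using e mob_rot_ii by blast
  next
    case False
    \<comment> \<open>If the rotated point lies below \<open>\<i>\<close>, a further half turn about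
      \<open>\<i>\<close> takes it from height \<open>s\<close> to height
      \<open>1/s\<close>.\<close>
    let ?A = "rot (pi/2) * rot \<theta>"
    have "mob ?A \<i> = \<i>" by (simp add: mob_mult mob_rot_ii)
    moreover have "mob ?A w = of_real (1 / s) * \<i>"
      using w s by (simp add: mob_mult e mob_rot_half_pi complex_eq_iff Re_divide Im_divide power2_eq_square)
    moreover have "1 / s \<ge> 1" using False s by simp
    ultimately show ?thesis by blast
  qed
qed

text \<open>Every geodesic is an image of the imaginary axis. Statements about the segment between
  two points can thus be checked on the axis, where distances are differences of logarithms.\<close>

lemma two_point_normal_form:
  assumes "Im z > 0" "Im w > 0"
  shows "\<exists>A t. t \<ge> 1 \<and> mob A z = \<i> \<and> mob A w = of_real t * \<i> \<and> hyp_dist z w = ln t"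
proof -
  obtain A t where A: "t \<ge> 1" "mob A \<i> = \<i>" "mob A (mob (minv (frame z)) w) = of_real t * \<i>"
    using rotate_to_axis[of "mob (minv (frame z)) w"] assms by auto
  let ?B = "A * minv (frame z)"
  have 1: "mob ?B z = \<i>" "mob ?B w = of_real t * \<i>" using A assms by (simp_all add: mob_mult mob_minv_frame)
  have "hyp_dist z w = hyp_dist (of_real 1 * \<i>) (of_real t * \<i>)"
    using hyp_dist_mob[OF assms, of ?B] 1 by simp
  also have "\<dots> = ln t" using A(1) by (subst hyp_dist_imag_axis) auto
  finally show ?thesis using 1 A(1) by blast
qed

text \<open>The two values of \<open>cosh\<close> determine \<open>Im z\<close> and
  \<open>(cmod z)\<^sup>2\<close>, hence \<open>z\<close> up to reflection in the imaginary
  axis.\<close>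

lemma two_fixed_distances:
  assumes z: "Im z > 0" and z': "Im z' > 0" and t: "t > 1"
    and 1: "hyp_dist \<i> z = hyp_dist \<i> z'" and 2: "hyp_dist (of_real t * \<i>) z = hyp_dist (of_real t * \<i>) z'"
  shows "z' = z \<or> z' = - cnj z"
proof -
  have e: "cosh (hyp_dist (of_real s * \<i>) u) = ((cmod u)\<^sup>2 + s\<^sup>2) / (2 * s * Im u)" if "s > 0" "Im u > 0" for s u
  proof -
    have "cosh (hyp_dist (of_real s * \<i>) u) = 1 + (cmod (of_real s * \<i> - u))\<^sup>2 / (2 * s * Im u)"
      using cosh_hyp_dist[of "of_real s * \<i>" u] that by simp
    also have "(cmod (of_real s * \<i> - u))\<^sup>2 = (cmod u)\<^sup>2 + s\<^sup>2 - 2 * s * Im u"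
      unfolding cmod_power2 by (simp add: power2_eq_square algebra_simps)
    also have "1 + ((cmod u)\<^sup>2 + s\<^sup>2 - 2 * s * Im u) / (2 * s * Im u) = ((cmod u)\<^sup>2 + s\<^sup>2) / (2 * s * Im u)"
      using that by (simp add: diff_divide_distrib)
    finally show ?thesis .
  qed
  define p q p' q' where "p = (cmod z)\<^sup>2" and "q = Im z" and "p' = (cmod z')\<^sup>2" and "q' = Im z'"
  have a: "(p + 1) / (2 * q) = (p' + 1) / (2 * q')"
    using e[of 1 z] e[of 1 z'] z z' 1 by (simp add: p_def q_def p'_def q'_def)
  have b: "(p + t\<^sup>2) / (2 * t * q) = (p' + t\<^sup>2) / (2 * t * q')"
    using e[of t z] e[of t z'] z z' 2 t by (simp add: p_def q_def p'_def q'_def)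
  have q: "q > 0" "q' > 0" using z z' by (auto simp: q_def q'_def)
  have a': "(p + 1) * q' = (p' + 1) * q" using a q by (simp add: frac_eq_eq)
  have b': "(p + t\<^sup>2) * q' = (p' + t\<^sup>2) * q" using b q t by (simp add: frac_eq_eq)
  have "(t\<^sup>2 - 1) * q' = (t\<^sup>2 - 1) * q" using a' b' by (simp add: algebra_simps)
  moreover have "t\<^sup>2 > 1" using t by (simp add: one_less_power)
  ultimately have qq: "q' = q" by simp
  then have "p = p'" using a' q by simp
  then have "(Re z)\<^sup>2 = (Re z')\<^sup>2" using qq by (simp add: p_def p'_def q_def q'_def cmod_power2)
  then have "Re z' = Re z \<or> Re z' = - Re z" by (auto simp: power2_eq_iff)
  then show ?thesis using qq by (auto simp: q_def q'_def complex_eq_iff)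
qed

lemma not_holomorphic_cnj:
  assumes "open N" "w \<in> N" "f holomorphic_on N" "\<And>u. u \<in> N \<Longrightarrow> f u = cnj u"
  shows False
proof -
  obtain D where D: "(f has_field_derivative D) (at w)"
    using assms(1-3) holomorphic_on_imp_differentiable_at field_differentiable_def by blast
  then have "(f has_derivative (\<lambda>h. D * h)) (at w)" by (simp add: has_field_derivative_def)
  then have "(cnj has_derivative (\<lambda>h. D * h)) (at w)"
    by (rule has_derivative_transform_within_open[OF _ assms(1,2)]) (simp add: assms(4))
  moreover have "(cnj has_derivative cnj) (at w)"
    using bounded_linear_cnj bounded_linear_imp_has_derivative by blast
  ultimately have "(\<lambda>h. D * h) = cnj" by (rule has_derivative_unique)
  then have "D * 1 = cnj 1" "D * \<i> = cnj \<i>" by metis+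
  then show False by simp
qed

text \<open>After moving two points and their images to the same pair on the imaginary axis, the map
  is at each point either the identity or the reflection in the axis. The set where it is not the
  identity is open, and a holomorphic map cannot be a reflection on an open set.\<close>

lemma holomorphic_isometry_is_mob:
  assumes W: "open W" "W \<subseteq> {z. Im z > 0}" "z0 \<in> W" and hol: "f holomorphic_on W"
    and im: "\<And>z. z \<in> W \<Longrightarrow> Im (f z) > 0"
    and iso: "\<And>z w. z \<in> W \<Longrightarrow> w \<in> W \<Longrightarrow> hyp_dist (f z) (f w) = hyp_dist z w"
  shows "\<exists>A s. s > 0 \<and> hball z0 s \<subseteq> W \<and> (\<forall>z\<in>hball z0 s. f z = mob A z)"
proof -
  have z0: "Im z0 > 0" using W by auto
  obtain s where s: "s > 0" "hball z0 s \<subseteq> W" using hball_in_open[OF z0 W(1,3)] by blast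
  have "hball z0 s \<noteq> {z0}" using not_open_singleton[of z0] open_hball[OF z0, of s] by metis
  then obtain w where w: "w \<in> hball z0 s" "w \<noteq> z0" using s z0 by fastforce
  have wp: "Im w > 0" "w \<in> W" using w s by (auto dest: hball_pos)
  obtain B t where B: "t \<ge> 1" "mob B z0 = \<i>" "mob B w = of_real t * \<i>" "hyp_dist z0 w = ln t"
    using two_point_normal_form[OF z0 wp(1)] by blast
  obtain C t' where C: "t' \<ge> 1" "mob C (f z0) = \<i>" "mob C (f w) = of_real t' * \<i>" "hyp_dist (f z0) (f w) = ln t'"
    using two_point_normal_form[OF im[OF W(3)] im[OF wp(2)]] by blast
  have "ln t = ln t'" using iso[OF W(3) wp(2)] B(4) C(4) by simp
  then have tt: "t' = t" using B(1) C(1) by simp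
  have t1: "t > 1" using B(1,2,3) w(2) mob_inj[OF z0 wp(1), of B] by (cases "t = 1") auto
  define V where "V = hball \<i> s"
  have V: "open V" "V \<subseteq> {z. Im z > 0}" by (auto simp: V_def hball_pos)
  define h where "h u = mob C (f (mob (minv B) u))" for u
  have Bi: "mob (minv B) \<i> = z0" using mob_minv(1)[OF z0, of B] B(2) by simp
  have inV: "mob (minv B) u \<in> hball z0 s" if "u \<in> V" for u
    using that mob_in_hball[of \<i> u "minv B" s] hball_pos unfolding V_def Bi by auto
  have Vi: "\<i> \<in> V" "of_real t * \<i> \<in> V"
    using s w(1) B(2,3) mob_in_hball[of z0 w B s] z0 wp by (auto simp: V_def)
  have hol2: "h holomorphic_on V"
  proof -
    have a: "(f \<circ> mob (minv B)) holomorphic_on V"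
    proof (rule holomorphic_on_compose)
      show "mob (minv B) holomorphic_on V" by (rule mob_holomorphic[OF V(2)])
      show "f holomorphic_on mob (minv B) ` V" using hol inV s(2) by (auto intro: holomorphic_on_subset)
    qed
    have "(mob C \<circ> (f \<circ> mob (minv B))) holomorphic_on V"
    proof (rule holomorphic_on_compose[OF a])
      show "mob C holomorphic_on (f \<circ> mob (minv B)) ` V"
        using im inV s(2) by (intro mob_holomorphic) auto
    qed
    then show ?thesis by (simp add: h_def[abs_def] comp_def)
  qed
  have hi: "h \<i> = \<i>" using Bi C(2) by (simp add: h_def)
  have ht: "h (of_real t * \<i>) = of_real t * \<i>"
    using mob_minv(1)[OF wp(1), of B] B(3) C(3) tt by (simp add: h_def)
  have hpos: "Im (h u) > 0" if "u \<in> V" for u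
    using im inV[OF that] s(2) unfolding h_def by auto
  have hiso: "hyp_dist (h u) (h v) = hyp_dist u v" if "u \<in> V" "v \<in> V" for u v
  proof -
    have "mob (minv B) u \<in> W" "mob (minv B) v \<in> W" using inV that s(2) by auto
    then show ?thesis unfolding h_def using im iso V(2) that by (simp add: subset_iff)
  qed
  have alt: "h u = u \<or> h u = - cnj u" if u: "u \<in> V" for u
    using two_fixed_distances[of u "h u" t] V(2) u hpos[OF u] t1 hiso[OF Vi(1) u] hiso[OF Vi(2) u] hi ht by auto
  have fx: "h u = u" if u: "u \<in> V" for u
  proof (rule ccontr)
    assume ne: "h u \<noteq> u"
    define N where "N = {u \<in> V. h u - u \<noteq> 0}"
    have "N = V \<inter> (\<lambda>u. h u - u) -` (- {0})" by (auto simp: N_def)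
    moreover have "continuous_on V (\<lambda>u. h u - u)"
      using hol2 by (intro continuous_intros holomorphic_on_imp_continuous_on)
    ultimately have "open N" using V(1) continuous_open_preimage[of V "\<lambda>u. h u - u" "- {0}"] by auto
    moreover have "u \<in> N" using u ne by (simp add: N_def)
    moreover have "(\<lambda>u. - h u) holomorphic_on N"
      by (intro holomorphic_intros holomorphic_on_subset[OF hol2]) (auto simp: N_def)
    moreover have "- h u = cnj u" if "u \<in> N" for u using alt[of u] that by (auto simp: N_def)
    ultimately show False by (rule not_holomorphic_cnj)
  qed
  have "f z = mob (minv C * B) z" if z: "z \<in> hball z0 s" for z
  proof -
    have zp: "Im z > 0" "z \<in> W" using z s by (auto dest: hball_pos)
    have "mob B z \<in> V" unfolding V_def using mob_in_hball[OF z0 zp(1), of B s] z B(2) by simp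
    from fx[OF this] have "mob C (f z) = mob B z" using zp by (simp add: h_def)
    then have "f z = mob (minv C) (mob B z)" using mob_minv(1)[OF im[OF zp(2)], of C] by simp
    then show ?thesis using zp by (simp add: mob_mult)
  qed
  then show ?thesis using s by blast
qed

text \<open>The kernel of the action on the half plane: elements are matrices, so both signs
  occur.\<close>

definition triv :: "sl2 \<Rightarrow> bool" where
  "triv A \<longleftrightarrow> A = 1 \<or> A = mneg 1"

lemma triv_iff: "triv A \<longleftrightarrow> eb A = 0 \<and> ec A = 0 \<and> ea A = ed A"
proof
  assume h: "eb A = 0 \<and> ec A = 0 \<and> ea A = ed A"
  then have "(ea A)\<^sup>2 = 1" using sl2_det[of A] by (simp add: power2_eq_square)
  then have "ea A = 1 \<or> ea A = -1" by (simp add: power2_eq_1_iff)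
  then show "triv A" unfolding triv_def using h by (auto intro: sl2_eqI)
qed (auto simp: triv_def)

lemma triv_mob: "triv A \<Longrightarrow> mob A z = z"
  unfolding triv_def by auto

lemma mob_fixed_iff:
  assumes "Im z > 0"
  shows "mob A z = z \<longleftrightarrow> ed A - ea A = - 2 * ec A * Re z \<and> eb A = - ec A * (cmod z)\<^sup>2"
proof -
  have "mob A z = z \<longleftrightarrow> of_real (ea A) * z + of_real (eb A) = z * cden A z"
    unfolding mob_def using cden_nz[OF assms, of A] by (simp add: divide_eq_eq)
  also have "\<dots> \<longleftrightarrow> ea A * Re z + eb A = ec A * ((Re z)\<^sup>2 - (Im z)\<^sup>2) + ed A * Re z \<and>
       ea A * Im z = (2 * ec A * Re z + ed A) * Im z"
    by (simp add: complex_eq_iff algebra_simps power2_eq_square)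
  also have "\<dots> \<longleftrightarrow> ea A * Re z + eb A = ec A * ((Re z)\<^sup>2 - (Im z)\<^sup>2) + ed A * Re z \<and>
       ed A - ea A = - 2 * ec A * Re z"
    using assms by auto
  also have "\<dots> \<longleftrightarrow> ed A - ea A = - 2 * ec A * Re z \<and> eb A = - ec A * (cmod z)\<^sup>2"
  proof -
    have "ea A * Re z + eb A = ec A * ((Re z)\<^sup>2 - (Im z)\<^sup>2) + ed A * Re z \<longleftrightarrow> eb A = - ec A * (cmod z)\<^sup>2"
      if h: "ed A - ea A = - 2 * ec A * Re z"
    proof -
      have ea: "ea A = ed A + 2 * ec A * Re z" using h by simp
      have "ea A * Re z + eb A - (ec A * ((Re z)\<^sup>2 - (Im z)\<^sup>2) + ed A * Re z) = eb A + ec A * (cmod z)\<^sup>2"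
        unfolding ea cmod_power2 by (simp add: power2_eq_square algebra_simps)
      then show ?thesis by auto
    qed
    then show ?thesis by blast
  qed
  finally show ?thesis .
qed

lemma two_fixed_points_triv:
  assumes "Im z > 0" "Im w > 0" "z \<noteq> w" "mob A z = z" "mob A w = w"
  shows "triv A"
proof -
  have z: "ed A - ea A = - 2 * ec A * Re z" "eb A = - ec A * (cmod z)\<^sup>2"
    and w: "ed A - ea A = - 2 * ec A * Re w" "eb A = - ec A * (cmod w)\<^sup>2"
    using assms mob_fixed_iff by blast+
  have "ec A = 0"
  proof (rule ccontr)
    assume "ec A \<noteq> 0"
    then have "Re z = Re w" "(cmod z)\<^sup>2 = (cmod w)\<^sup>2" using z w by auto
    then have "(Im z)\<^sup>2 = (Im w)\<^sup>2" by (simp add: cmod_power2)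
    then have "Im z = Im w" using assms(1,2) by (simp add: power2_eq_iff)
    then show False using \<open>Re z = Re w\<close> assms(3) by (simp add: complex_eq_iff)
  qed
  then show ?thesis using z by (simp add: triv_iff)
qed

lemma mob_id_on_open_triv:
  assumes "open S" "z \<in> S" "Im z > 0" "\<And>u. u \<in> S \<Longrightarrow> mob A u = u"
  shows "triv A"
proof -
  have o: "open (S \<inter> {u. Im u > 0})" using assms(1) open_upper_half_plane by (auto simp: upper_half_plane_def)
  then have "S \<inter> {u. Im u > 0} \<noteq> {z}" using not_open_singleton[of z] by metis
  then obtain w where "w \<in> S" "Im w > 0" "w \<noteq> z" using assms(2,3) by blast
  then show ?thesis using two_fixed_points_triv[of z w A] assms by auto
qed

section \<open>The developing map\<close>

text \<open>A fixed oriented atlas is part of the data. Holomorphic transitions are what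
  orientability contributes: continuation along charts then never leaves
  \<open>SL(2, \<real>)\<close> for an orientation reversing isometry.\<close>

locale hsurf = Metric_space M d for M :: "'a set" and d :: "'a \<Rightarrow> 'a \<Rightarrow> real" +
  fixes \<A> :: "('a set \<times> ('a \<Rightarrow> complex)) set"
  assumes complete: "mcomplete"
    and conn: "connected_space mtopology"
    and nonempty: "M \<noteq> {}"
    and lengthm: "length_metric M d"
    and charts: "(U, \<phi>) \<in> \<A> \<Longrightarrow> isometric_chart M d U \<phi>"
    and cover: "p \<in> M \<Longrightarrow> \<exists>U \<phi>. (U, \<phi>) \<in> \<A> \<and> p \<in> U"
    and holo: "(U, \<phi>) \<in> \<A> \<Longrightarrow> (V, \<psi>) \<in> \<A> \<Longrightarrow> (\<psi> \<circ> inv_into U \<phi>) holomorphic_on \<phi> ` (U \<inter> V)"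
begin

lemma chart_sub: "(U, \<phi>) \<in> \<A> \<Longrightarrow> p \<in> U \<Longrightarrow> p \<in> M"
  using charts[of U \<phi>] openin_mtopology unfolding isometric_chart_def by blast

lemma chart_pos: "(U, \<phi>) \<in> \<A> \<Longrightarrow> p \<in> U \<Longrightarrow> Im (\<phi> p) > 0"
  using charts[of U \<phi>] unfolding isometric_chart_def upper_half_plane_def by blast

lemma chart_dist: "(U, \<phi>) \<in> \<A> \<Longrightarrow> p \<in> U \<Longrightarrow> q \<in> U \<Longrightarrow> hyp_dist (\<phi> p) (\<phi> q) = d p q"
  using charts[of U \<phi>] unfolding isometric_chart_def by blast

lemma chart_inj: "(U, \<phi>) \<in> \<A> \<Longrightarrow> p \<in> U \<Longrightarrow> q \<in> U \<Longrightarrow> \<phi> p = \<phi> q \<Longrightarrow> p = q"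
  using chart_dist[of U \<phi> p q] chart_sub[of U \<phi>] by simp

lemma chart_inv: "(U, \<phi>) \<in> \<A> \<Longrightarrow> p \<in> U \<Longrightarrow> inv_into U \<phi> (\<phi> p) = p"
  using chart_inj[of U \<phi>] by (intro inv_into_f_f inj_onI) auto

lemma chart_ball:
  assumes "(U, \<phi>) \<in> \<A>" "p \<in> U"
  shows "\<exists>\<delta>>0. mball p \<delta> \<subseteq> U \<and> hball (\<phi> p) \<delta> \<subseteq> \<phi> ` U"
proof -
  have c: "openin mtopology U" "open (\<phi> ` U)" using charts[OF assms(1)] unfolding isometric_chart_def by auto
  obtain r where r: "r > 0" "mball p r \<subseteq> U" using c(1) assms(2) openin_mtopology by blast
  obtain s where s: "s > 0" "hball (\<phi> p) s \<subseteq> \<phi> ` U"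
    using hball_in_open[OF chart_pos[OF assms] c(2)] assms(2) by blast
  have "mball p (min r s) \<subseteq> U" "hball (\<phi> p) (min r s) \<subseteq> \<phi> ` U"
    using r(2) s(2) mball_subset_concentric[of "min r s" r p] hball_mono[of "min r s" s "\<phi> p"] by auto
  then show ?thesis using r(1) s(1) by (intro exI[of _ "min r s"]) auto
qed

text \<open>The developing map is used in the inverse direction, from the half plane to the surface,
  where it is single valued: near \<open>z\<close> the map is an inverse chart composed with a
  Moebius map.\<close>

definition dev :: "(complex \<Rightarrow> 'a) \<Rightarrow> complex \<Rightarrow> bool" where
  "dev f z \<longleftrightarrow> (\<exists>U \<phi> A r. (U, \<phi>) \<in> \<A> \<and> r > 0 \<and> (\<forall>u\<in>hball z r. f u \<in> U \<and> \<phi> (f u) = mob A u))"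

lemma dev_isom:
  assumes "dev f z" "Im z > 0"
  shows "\<exists>r>0. \<forall>u\<in>hball z r. \<forall>v\<in>hball z r. f u \<in> M \<and> d (f u) (f v) = hyp_dist u v"
proof -
  obtain U \<phi> A r where U: "(U, \<phi>) \<in> \<A>" "r > 0" "\<And>u. u \<in> hball z r \<Longrightarrow> f u \<in> U \<and> \<phi> (f u) = mob A u"
    using assms(1) unfolding dev_def by blast
  have "f u \<in> M \<and> d (f u) (f v) = hyp_dist u v" if "u \<in> hball z r" "v \<in> hball z r" for u v
    using U(3)[OF that(1)] U(3)[OF that(2)] chart_dist[OF U(1), of "f u" "f v"] chart_sub[OF U(1), of "f u"]
      hball_pos[OF that(1)] hball_pos[OF that(2)] by simp
  then show ?thesis using U(2) by blast
qed

lemma dev_in_M: "dev f z \<Longrightarrow> Im z > 0 \<Longrightarrow> f z \<in> M"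
  using dev_isom[of f z] centre_in_hball[of z] by blast

lemma dev_cong:
  assumes "dev f z" "s > 0" "\<And>u. u \<in> hball z s \<Longrightarrow> h u = f u"
  shows "dev h z"
proof -
  obtain U \<phi> A r where U: "(U, \<phi>) \<in> \<A>" "r > 0" "\<And>u. u \<in> hball z r \<Longrightarrow> f u \<in> U \<and> \<phi> (f u) = mob A u"
    using assms(1) unfolding dev_def by blast
  have "\<forall>u\<in>hball z (min r s). h u \<in> U \<and> \<phi> (h u) = mob A u"
    using U(3) assms(3) by (auto simp: hball_def)
  then show ?thesis unfolding dev_def using U(1,2) assms(2) by (metis min_less_iff_conj)
qed

lemma dev_comp:
  assumes "dev f (mob A z)" "Im z > 0"
  shows "dev (\<lambda>u. f (mob A u)) z"
proof -
  obtain U \<phi> B r where U: "(U, \<phi>) \<in> \<A>" "r > 0" "\<And>u. u \<in> hball (mob A z) r \<Longrightarrow> f u \<in> U \<and> \<phi> (f u) = mob B u"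
    using assms(1) unfolding dev_def by blast
  have "\<forall>u\<in>hball z r. f (mob A u) \<in> U \<and> \<phi> (f (mob A u)) = mob (B * A) u"
  proof
    fix u assume u: "u \<in> hball z r"
    have up: "Im u > 0" using u hball_pos by blast
    then show "f (mob A u) \<in> U \<and> \<phi> (f (mob A u)) = mob (B * A) u"
      using U(3)[of "mob A u"] u mob_in_hball[OF assms(2) up] by (simp add: mob_mult)
  qed
  then show ?thesis unfolding dev_def using U(1,2) by blast
qed

lemma dev_chart_inv:
  assumes "(U, \<phi>) \<in> \<A>" "w \<in> \<phi> ` U"
  shows "dev (inv_into U \<phi>) w"
proof -
  have "open (\<phi> ` U)" "Im w > 0" using charts[OF assms(1)] chart_pos[OF assms(1)] assms(2) unfolding isometric_chart_def by auto
  then obtain r where r: "r > 0" "hball w r \<subseteq> \<phi> ` U" using hball_in_open assms(2) by blast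
  have "\<forall>u\<in>hball w r. inv_into U \<phi> u \<in> U \<and> \<phi> (inv_into U \<phi> u) = mob 1 u"
    using r(2) by (auto intro: inv_into_into f_inv_into_f)
  then show ?thesis unfolding dev_def using assms(1) r(1) by blast
qed

text \<open>The transition between charts at the common value is a holomorphic isometry, hence a
  Moebius map. This is the source of both uniqueness of continuation and deck
  transformations.\<close>

lemma dev_germ:
  assumes f: "dev f z" and h: "dev h w" and z: "Im z > 0" and w: "Im w > 0" and eq: "f z = h w"
  shows "\<exists>B r. r > 0 \<and> mob B z = w \<and> (\<forall>u\<in>hball z r. h (mob B u) = f u)"
proof -
  obtain U \<phi> A1 r1 where U: "(U, \<phi>) \<in> \<A>" "r1 > 0" "\<And>u. u \<in> hball z r1 \<Longrightarrow> f u \<in> U \<and> \<phi> (f u) = mob A1 u"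
    using f unfolding dev_def by blast
  obtain V \<psi> A2 r2 where V: "(V, \<psi>) \<in> \<A>" "r2 > 0" "\<And>u. u \<in> hball w r2 \<Longrightarrow> h u \<in> V \<and> \<psi> (h u) = mob A2 u"
    using h unfolding dev_def by blast
  let ?p = "f z"
  have p: "?p \<in> U" "?p \<in> V" "\<phi> ?p = mob A1 z" "\<psi> ?p = mob A2 w"
    using U(2) U(3)[of z] V(2) V(3)[of w] z w eq by auto
  define W where "W = \<phi> ` (U \<inter> V)"
  define \<tau> where "\<tau> = \<psi> \<circ> inv_into U \<phi>"
  have tau: "\<tau> (\<phi> q) = \<psi> q" if "q \<in> U" for q using chart_inv[OF U(1) that] by (simp add: \<tau>_def)
  have Wpos: "W \<subseteq> {z. Im z > 0}" using chart_pos[OF U(1)] by (auto simp: W_def)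
  have "open W"
  proof (rule openI)
    fix x assume "x \<in> W"
    then obtain q where q: "q \<in> U" "q \<in> V" "x = \<phi> q" by (auto simp: W_def)
    obtain r where r: "r > 0" "hball (\<phi> q) r \<subseteq> \<phi> ` U" using chart_ball[OF U(1) q(1)] by blast
    obtain s where s: "s > 0" "mball q s \<subseteq> V" using chart_ball[OF V(1) q(2)] by blast
    have xp: "Im x > 0" using q chart_pos[OF U(1)] by auto
    have "hball x (min r s) \<subseteq> W"
    proof
      fix y assume y: "y \<in> hball x (min r s)"
      then have "y \<in> hball (\<phi> q) r" using q(3) by (simp add: hball_def)
      then obtain q' where q': "q' \<in> U" "y = \<phi> q'" using r(2) by blast
      have "d q q' < s" using chart_dist[OF U(1) q(1) q'(1)] y q(3) q'(2) by (simp add: hball_def)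
      then have "q' \<in> V" using s(2) chart_sub[OF U(1)] q(1) q'(1) by auto
      then show "y \<in> W" using q' by (auto simp: W_def)
    qed
    moreover have "open (hball x (min r s))" "x \<in> hball x (min r s)" using xp r(1) s(1) by auto
    ultimately show "\<exists>e>0. ball x e \<subseteq> W" using open_contains_ball[of "hball x (min r s)"] by (meson subset_trans)
  qed
  moreover have "\<phi> ?p \<in> W" unfolding W_def using p(1,2) by blast
  moreover have "\<tau> holomorphic_on W" unfolding \<tau>_def W_def by (rule holo[OF U(1) V(1)])
  moreover have "Im (\<tau> x) > 0" if "x \<in> W" for x using that tau chart_pos[OF V(1)] by (auto simp: W_def)
  moreover have "hyp_dist (\<tau> x) (\<tau> y) = hyp_dist x y" if "x \<in> W" "y \<in> W" for x y
    using that tau chart_dist[OF U(1)] chart_dist[OF V(1)] by (auto simp: W_def)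
  ultimately obtain C s where C: "s > 0" "hball (\<phi> ?p) s \<subseteq> W" "\<And>x. x \<in> hball (\<phi> ?p) s \<Longrightarrow> \<tau> x = mob C x"
    using holomorphic_isometry_is_mob[of W "\<phi> ?p" \<tau>] Wpos by blast
  define B where "B = minv A2 * (C * A1)"
  define r where "r = min r1 (min s r2)"
  have r: "r > 0" using U V C by (auto simp: r_def)
  have A2B: "mob A2 (mob B u) = mob C (mob A1 u)" if "Im u > 0" for u
    using that by (simp add: B_def mob_mult)
  have key: "\<psi> (f u) = mob A2 (mob B u) \<and> f u \<in> V" if u: "u \<in> hball z r" for u
  proof -
    have up: "Im u > 0" using u hball_pos by blast
    have fu: "f u \<in> U" "\<phi> (f u) = mob A1 u" using U(3)[of u] u by (auto simp: r_def hball_def)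
    have "mob A1 u \<in> hball (\<phi> ?p) s" unfolding p(3) using mob_in_hball[OF z up] u by (auto simp: r_def hball_def)
    then have 1: "\<tau> (\<phi> (f u)) = mob C (mob A1 u)" "\<phi> (f u) \<in> W" using C fu by auto
    then have "f u \<in> V" unfolding W_def using fu(1) chart_inj[OF U(1)] by (metis IntD1 IntD2 imageE)
    moreover have "\<psi> (f u) = mob C (mob A1 u)" using tau[OF fu(1)] 1 by simp
    ultimately show ?thesis using A2B[OF up] by simp
  qed
  have "mob A2 (mob B z) = mob A2 w" using key[of z] z r p(4) by simp
  then have Bz: "mob B z = w" using mob_inj[of "mob B z" w A2] z w by simp
  have "h (mob B u) = f u" if u: "u \<in> hball z r" for u
  proof -
    have up: "Im u > 0" using u hball_pos by blast
    have "mob B u \<in> hball (mob B z) r2" using mob_in_hball[OF z up, of B r2] u by (auto simp: r_def hball_def)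
    then have "h (mob B u) \<in> V" "\<psi> (h (mob B u)) = mob A2 (mob B u)" using V(3) Bz by auto
    then show ?thesis using key[OF u] chart_inj[OF V(1)] by metis
  qed
  then show ?thesis using r Bz by blast
qed

text \<open>An identity theorem: the set of points near which both maps agree is open and also
  closed in \<open>D\<close>. At a point outside it either the values differ, and then they differ
  nearby, or the germs differ by a Moebius map, which would be trivial if points of agreement were
  arbitrarily near.\<close>

lemma dev_unique:
  assumes D: "open D" "connected D" "D \<subseteq> {z. Im z > 0}"
    and f: "\<And>z. z \<in> D \<Longrightarrow> dev f z" and h: "\<And>z. z \<in> D \<Longrightarrow> dev h z"
    and z0: "z0 \<in> D" "r0 > 0" "\<And>u. u \<in> hball z0 r0 \<Longrightarrow> f u = h u"
    and z: "z \<in> D"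
  shows "f z = h z"
proof -
  define S where "S = {z \<in> D. \<exists>r>0. \<forall>u\<in>hball z r. f u = h u}"
  have "open S"
  proof (rule openI)
    fix x assume "x \<in> S"
    then obtain r where r: "x \<in> D" "r > 0" "\<And>u. u \<in> hball x r \<Longrightarrow> f u = h u" by (auto simp: S_def)
    have xp: "Im x > 0" using r D by auto
    have "D \<inter> hball x (r/2) \<subseteq> S"
    proof
      fix y assume y: "y \<in> D \<inter> hball x (r/2)"
      then have "\<forall>u\<in>hball y (r/2). f u = h u" using hball_triangle[OF xp, of y "r/2" _ "r/2"] r(3) by simp
      then show "y \<in> S" using y r(2) by (auto simp: S_def intro!: exI[of _ "r/2"])
    qed
    moreover have "open (D \<inter> hball x (r/2))" "x \<in> D \<inter> hball x (r/2)" using D(1) xp r by auto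
    ultimately show "\<exists>e>0. ball x e \<subseteq> S" using open_contains_ball[of "D \<inter> hball x (r/2)"] by (meson subset_trans)
  qed
  moreover have "open (D - S)"
  proof (rule openI)
    fix x assume x: "x \<in> D - S"
    have xp: "Im x > 0" using x D by auto
    obtain rf where rf: "rf > 0" "\<And>u v. u \<in> hball x rf \<Longrightarrow> v \<in> hball x rf \<Longrightarrow> f u \<in> M \<and> d (f u) (f v) = hyp_dist u v"
      using dev_isom[OF f xp] x by blast
    obtain rh where rh: "rh > 0" "\<And>u v. u \<in> hball x rh \<Longrightarrow> v \<in> hball x rh \<Longrightarrow> h u \<in> M \<and> d (h u) (h v) = hyp_dist u v"
      using dev_isom[OF h xp] x by blast
    have "\<exists>r>0. hball x r \<inter> S = {}"
    proof (cases "f x = h x")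
      case False
      have fhM: "f x \<in> M" "h x \<in> M" using rf(2)[of x x] rh(2)[of x x] rf(1) rh(1) xp by simp_all
      define e where "e = d (f x) (h x)"
      have e: "e > 0" using False fhM by (simp add: e_def)
      define r where "r = min (e/2) (min rf rh)"
      have r: "r > 0" using e rf rh by (auto simp: r_def)
      have "f u \<noteq> h u" if u: "u \<in> hball x r" for u
      proof
        assume eq: "f u = h u"
        have u': "u \<in> hball x rf" "u \<in> hball x rh" "hyp_dist x u < e/2" using u by (auto simp: r_def hball_def)
        have "d (f x) (f u) < e/2" using rf(2)[of x u] u' xp rf(1) by simp
        moreover have "d (h x) (h u) < e/2" using rh(2)[of x u] u' xp rh(1) by simp
        moreover have "d (f x) (h x) \<le> d (f x) (f u) + d (h x) (h u)"
          using triangle'[of "f x" "f u" "h x"] fhM rf(2)[OF u'(1) u'(1)] eq by simp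
        ultimately show False by (simp add: e_def)
      qed
      moreover have "f u = h u" if "u \<in> S" for u
        using that D(3) by (force simp: S_def)
      ultimately show ?thesis using r by blast
    next
      case True
      obtain B r where B: "r > 0" "mob B x = x" "\<And>u. u \<in> hball x r \<Longrightarrow> h (mob B u) = f u"
        using dev_germ[OF f h xp xp True] x by blast
      define s where "s = min r rh"
      have s: "s > 0" using B rh by (simp add: s_def)
      have "hball x s \<inter> S = {}"
      proof (rule ccontr)
        assume "hball x s \<inter> S \<noteq> {}"
        then obtain y where y: "y \<in> hball x s" "y \<in> S" by blast
        then obtain t where t: "t > 0" "\<And>u. u \<in> hball y t \<Longrightarrow> f u = h u" by (auto simp: S_def)
        have yp: "Im y > 0" using y hball_pos by blast
        \<comment> \<open>\<open>h\<close> is isometric, hence injective, near \<open>x\<close>; so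
          \<open>h (mob B u) = h u\<close> forces \<open>mob B u = u\<close>.\<close>
        have "mob B u = u" if u: "u \<in> hball x s \<inter> hball y t" for u
        proof -
          have up: "Im u > 0" using u hball_pos by blast
          have ur: "u \<in> hball x r" "u \<in> hball x rh" using u by (auto simp: s_def hball_def)
          then have "h (mob B u) = h u" using B(3) t(2) u by simp
          moreover have "mob B u \<in> hball x rh" using mob_in_hball[OF xp up, of B rh] B(2) ur by simp
          ultimately have "hyp_dist (mob B u) u = 0"
            using rh(2)[of "mob B u" u] rh(2)[of u u] ur by simp
          then show ?thesis using hyp_dist_eq_0[of "mob B u" u] up by simp
        qed
        then have "triv B"
          using mob_id_on_open_triv[of "hball x s \<inter> hball y t" y B] y xp yp t(1) by (simp add: open_Int)
        then have "\<forall>u\<in>hball x r. f u = h u" using B(3) triv_mob by metis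
        then have "x \<in> S" using x B(1) by (auto simp: S_def)
        then show False using x by blast
      qed
      then show ?thesis using s by blast
    qed
    then obtain r where r: "r > 0" "hball x r \<inter> S = {}" by blast
    have "open (D \<inter> hball x r)" "x \<in> D \<inter> hball x r" "D \<inter> hball x r \<subseteq> D - S" using D(1) xp r x by auto
    then show "\<exists>e>0. ball x e \<subseteq> D - S" using open_contains_ball[of "D \<inter> hball x r"] by (meson subset_trans)
  qed
  moreover have "S \<inter> D \<noteq> {}" using z0 by (auto simp: S_def)
  ultimately have "(D - S) \<inter> D = {}" using connectedD[OF D(2), of S "D - S"] by blast
  then have "z \<in> S" using z by blast
  then show ?thesis using D(3) by (force simp: S_def)
qed

section \<open>Continuation over growing balls\<close>

lemma local_lipschitz_chain:
  assumes ab: "a \<le> b"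
    and loc: "\<And>x. a \<le> x \<Longrightarrow> x \<le> b \<Longrightarrow> \<exists>e>0. \<forall>s t. \<bar>s - x\<bar> < e \<and> \<bar>t - x\<bar> < e \<longrightarrow>
       c s \<in> M \<and> c t \<in> M \<and> d (c s) (c t) \<le> K * \<bar>s - t\<bar>"
  shows "d (c a) (c b) \<le> K * (b - a)"
proof -
  define P where "P a b \<longleftrightarrow> c a \<in> M \<and> c b \<in> M \<and> d (c a) (c b) \<le> K * (b - a)" for a b
  have "P a b"
  proof (rule Bolzano[OF ab])
    fix a b e assume "P a b" "P b e"
    then show "P a e" unfolding P_def using triangle[of "c a" "c b" "c e"] by (auto simp: algebra_simps)
  next
    fix x assume "a \<le> x" "x \<le> b"
    then obtain e where e: "e > 0" "\<And>s t. \<bar>s - x\<bar> < e \<Longrightarrow> \<bar>t - x\<bar> < e \<Longrightarrow>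
       c s \<in> M \<and> c t \<in> M \<and> d (c s) (c t) \<le> K * \<bar>s - t\<bar>" using loc[of x] by blast
    have "P a b" if "a \<le> x" "x \<le> b" "b - a < e" for a b
    proof -
      have "\<bar>a - x\<bar> < e" "\<bar>b - x\<bar> < e" "\<bar>a - b\<bar> = b - a" using that by auto
      then show ?thesis using e(2)[of a b] unfolding P_def by simp
    qed
    then show "\<exists>e>0. \<forall>a b. a \<le> x \<and> x \<le> b \<and> b - a < e \<longrightarrow> P a b" using e(1) by blast
  qed
  then show ?thesis by (simp add: P_def)
qed

text \<open>Above height \<open>y0\<close> the hyperbolic length of a Euclidean segment is at most
  its Euclidean length divided by \<open>y0\<close>. The bound sends Cauchy sequences approaching
  the rim of a ball to Cauchy sequences on the surface.\<close>

lemma dev_lipschitz: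
  assumes D: "open D" "convex D" "y0 > 0" "\<And>z. z \<in> D \<Longrightarrow> Im z > y0"
    and f: "\<And>z. z \<in> D \<Longrightarrow> dev f z" and uv: "u \<in> D" "v \<in> D"
  shows "d (f u) (f v) \<le> cmod (u - v) / y0"
proof -
  define c where "c t = u + of_real t * (v - u)" for t :: real
  have cD: "c t \<in> D" if "0 \<le> t" "t \<le> 1" for t
  proof -
    have "c t = (1 - t) *\<^sub>R u + t *\<^sub>R v" by (simp add: c_def scaleR_conv_of_real algebra_simps)
    then show ?thesis using D(2) uv that unfolding convex_alt by auto
  qed
  have cc: "cmod (c s - c t) = \<bar>s - t\<bar> * cmod (u - v)" for s t
  proof -
    have "c s - c t = of_real (s - t) * (v - u)" by (simp add: c_def algebra_simps)
    then show ?thesis by (simp only: norm_mult norm_of_real norm_minus_commute)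
  qed
  have "d ((f \<circ> c) 0) ((f \<circ> c) 1) \<le> (cmod (u - v) / y0) * (1 - 0)"
  proof (rule local_lipschitz_chain)
    fix x :: real assume x: "0 \<le> x" "x \<le> 1"
    have cx: "c x \<in> D" using cD x by simp
    have cxp: "Im (c x) > 0" using D(3) D(4)[OF cx] by simp
    obtain r where r: "r > 0" "\<And>u v. u \<in> hball (c x) r \<Longrightarrow> v \<in> hball (c x) r \<Longrightarrow> f u \<in> M \<and> d (f u) (f v) = hyp_dist u v"
      using dev_isom[OF f[OF cx] cxp] by blast
    have "open (D \<inter> hball (c x) r)" "c x \<in> D \<inter> hball (c x) r" using D(1) cx cxp r(1) by auto
    moreover have "isCont c x" unfolding c_def by (intro continuous_intros)
    ultimately have "\<forall>\<^sub>F s in nhds x. c s \<in> D \<inter> hball (c x) r"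
      by (intro topological_tendstoD) (simp add: isCont_def tendsto_at_iff_tendsto_nhds)
    then obtain e where e: "e > 0" "\<And>s. \<bar>s - x\<bar> < e \<Longrightarrow> c s \<in> D \<inter> hball (c x) r"
      unfolding eventually_nhds_metric dist_real_def by blast
    show "\<exists>e>0. \<forall>s t. \<bar>s - x\<bar> < e \<and> \<bar>t - x\<bar> < e \<longrightarrow>
       (f \<circ> c) s \<in> M \<and> (f \<circ> c) t \<in> M \<and> d ((f \<circ> c) s) ((f \<circ> c) t) \<le> cmod (u - v) / y0 * \<bar>s - t\<bar>"
    proof (intro exI conjI allI impI)
      fix s t assume st: "\<bar>s - x\<bar> < e \<and> \<bar>t - x\<bar> < e"
      have a: "c s \<in> D" "c t \<in> D" "c s \<in> hball (c x) r" "c t \<in> hball (c x) r" using e(2) st by auto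
      show "(f \<circ> c) s \<in> M" "(f \<circ> c) t \<in> M" using r(2) a by auto
      have i: "Im (c s) > y0" "Im (c t) > y0" using D(4) a by auto
      have "y0 * y0 \<le> Im (c s) * Im (c t)" using i D(3) by (intro mult_mono) auto
      then have sq: "y0 \<le> sqrt (Im (c s) * Im (c t))" using D(3) by (intro real_le_rsqrt) (simp add: power2_eq_square)
      have "d (f (c s)) (f (c t)) = hyp_dist (c s) (c t)" using r(2) a by auto
      also have "\<dots> \<le> cmod (c s - c t) / sqrt (Im (c s) * Im (c t))" using i D(3) by (intro hyp_dist_le_euclid) auto
      also have "\<dots> \<le> cmod (c s - c t) / y0" by (rule divide_left_mono[OF sq norm_ge_zero mult_pos_pos[OF less_le_trans[OF D(3) sq] D(3)]])
      finally show "d ((f \<circ> c) s) ((f \<circ> c) t) \<le> cmod (u - v) / y0 * \<bar>s - t\<bar>" by (simp add: cc mult.commute)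
    qed (rule e(1))
  qed simp
  then show ?thesis by (simp add: c_def)
qed

text \<open>The inverse chart at \<open>f b\<close>, composed with the Moebius map that links its
  germ to that of \<open>f\<close>, is defined on the whole ball on which the chart has an image.
  The last clause records that points near \<open>f b\<close> are reached at their exact distance;
  it becomes the covering property in \<open>P_section\<close>.\<close>

lemma dev_extend_point:
  assumes b: "Im b > 0" and f: "dev f b" and U: "(U, \<phi>) \<in> \<A>" "f b \<in> U" "hball (\<phi> (f b)) \<delta> \<subseteq> \<phi> ` U"
  shows "\<exists>F. (\<forall>u\<in>hball b \<delta>. dev F u) \<and> (\<exists>r>0. \<forall>u\<in>hball b r. F u = f u) \<and>
     (\<forall>q\<in>U. d (f b) q < \<delta> \<longrightarrow> (\<exists>u\<in>hball b \<delta>. F u = q \<and> hyp_dist b u = d (f b) q))"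
proof -
  let ?w = "\<phi> (f b)"
  have wp: "Im ?w > 0" using chart_pos[OF U(1,2)] .
  have "f b = inv_into U \<phi> ?w" using chart_inv[OF U(1,2)] by simp
  then obtain B r where B: "r > 0" "mob B b = ?w" "\<And>u. u \<in> hball b r \<Longrightarrow> inv_into U \<phi> (mob B u) = f u"
    using dev_germ[OF f dev_chart_inv[OF U(1)] b wp] U(2) by blast
  define F where "F u = inv_into U \<phi> (mob B u)" for u
  have "dev F u" if u: "u \<in> hball b \<delta>" for u
  proof -
    have up: "Im u > 0" using u hball_pos by blast
    have "mob B u \<in> hball ?w \<delta>" using mob_in_hball[OF b up, of B \<delta>] u B(2) by simp
    then have "dev (inv_into U \<phi>) (mob B u)" using dev_chart_inv[OF U(1)] U(3) by blast
    then show ?thesis unfolding F_def by (rule dev_comp[OF _ up])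
  qed
  moreover have "\<exists>u\<in>hball b \<delta>. F u = q \<and> hyp_dist b u = d (f b) q" if q: "q \<in> U" "d (f b) q < \<delta>" for q
  proof -
    define u where "u = mob (minv B) (\<phi> q)"
    have qp: "Im (\<phi> q) > 0" using chart_pos[OF U(1) q(1)] .
    have Bu: "mob B u = \<phi> q" using qp by (simp add: u_def)
    have up: "Im u > 0" using qp by (simp add: u_def)
    have "hyp_dist b u = hyp_dist ?w (\<phi> q)" using hyp_dist_mob[OF b up, of B] B(2) Bu by simp
    also have "\<dots> = d (f b) q" using chart_dist[OF U(1,2) q(1)] .
    finally have "hyp_dist b u = d (f b) q" .
    moreover have "F u = q" using Bu chart_inv[OF U(1) q(1)] by (simp add: F_def)
    ultimately show ?thesis using up q(2) by (auto simp: hball_def)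
  qed
  ultimately show ?thesis using B(1,3) by (intro exI[of _ F]) (auto simp: F_def)
qed

lemma Im_hball_ii:
  assumes "w \<in> hball \<i> T" shows "Im w > exp (- T)"
proof -
  have T: "T > 0" using assms hball_empty[of \<i> T] by (cases "T > 0") auto
  have "w \<in> ball (Complex 0 (cosh T)) (sinh T)" using assms hball_eq[of \<i> T] T by simp
  then have "cmod (Complex 0 (cosh T) - w) < sinh T" by (simp add: dist_norm)
  then have "\<bar>cosh T - Im w\<bar> < sinh T" using abs_Im_le_cmod[of "Complex 0 (cosh T) - w"] by simp
  then have "Im w > cosh T - sinh T" by linarith
  then show ?thesis by (simp add: cosh_minus_sinh)
qed

text \<open>Completeness enters here. Points with ever smaller chart radius would accumulate in the
  closed ball; their images form a Cauchy sequence, which converges on the surface, and one chart at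
  the limit has a radius that serves all late members.\<close>

lemma dev_uniform_charts:
  assumes f: "\<And>z. z \<in> hball \<i> T \<Longrightarrow> dev f z"
  shows "\<exists>\<delta>>0. \<forall>b\<in>hball \<i> T. \<exists>U \<phi>. (U, \<phi>) \<in> \<A> \<and> f b \<in> U \<and> hball (\<phi> (f b)) \<delta> \<subseteq> \<phi> ` U"
proof (rule ccontr)
  assume neg: "\<not> ?thesis"
  define bad where "bad n b \<longleftrightarrow> b \<in> hball \<i> T \<and>
      (\<forall>U \<phi>. (U, \<phi>) \<in> \<A> \<longrightarrow> f b \<in> U \<longrightarrow> \<not> hball (\<phi> (f b)) (1 / real (Suc n)) \<subseteq> \<phi> ` U)" for n b
  have "\<exists>b. bad n b" for n
  proof -
    have pos: "1 / real (Suc n) > 0" by simp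
    have "\<not> (\<forall>b\<in>hball \<i> T. \<exists>U \<phi>. (U, \<phi>) \<in> \<A> \<and> f b \<in> U \<and> hball (\<phi> (f b)) (1 / real (Suc n)) \<subseteq> \<phi> ` U)"
      by (rule contrapos_nn[OF neg]) (rule exI[of _ "1 / real (Suc n)"], use pos in simp)
    then show ?thesis unfolding bad_def by blast
  qed
  then have "\<exists>b. \<forall>n. bad n (b n)" by (intro choice allI)
  then obtain b where b: "\<And>n. b n \<in> hball \<i> T"
    "\<And>n U \<phi>. (U, \<phi>) \<in> \<A> \<Longrightarrow> f (b n) \<in> U \<Longrightarrow> \<not> hball (\<phi> (f (b n))) (1 / real (Suc n)) \<subseteq> \<phi> ` U"
    unfolding bad_def by blast
  have T: "T > 0" using b(1)[of 0] hball_empty[of \<i> T] by (cases "T > 0") auto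
  have "range b \<subseteq> ball (Complex (Re \<i>) (Im \<i> * cosh T)) (Im \<i> * sinh T)" using b(1) hball_eq[of \<i> T] T by auto
  then have "bounded (range b)" by (rule bounded_subset[OF bounded_ball])
  then obtain l k where k: "strict_mono (k :: nat \<Rightarrow> nat)" "(b \<circ> k) \<longlonglongrightarrow> l"
    using bounded_imp_convergent_subsequence by blast
  have Cau: "Cauchy (b \<circ> k)" using k(2) LIMSEQ_imp_Cauchy by blast
  have bM: "f (b n) \<in> M" for n using dev_in_M[OF f[OF b(1)]] b(1) hball_pos by blast
  have lip: "d (f u) (f v) \<le> cmod (u - v) / exp (- T)" if "u \<in> hball \<i> T" "v \<in> hball \<i> T" for u v
    using that by (intro dev_lipschitz[of "hball \<i> T"] f Im_hball_ii) (auto intro: convex_hball)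
  have "MCauchy (\<lambda>n. f (b (k n)))"
    unfolding MCauchy_def
  proof (intro conjI allI impI)
    show "range (\<lambda>n. f (b (k n))) \<subseteq> M" using bM by auto
    fix e :: real assume e: "e > 0"
    have "e * exp (- T) > 0" using e by simp
    then obtain N where N: "\<And>m n. m \<ge> N \<Longrightarrow> n \<ge> N \<Longrightarrow> dist ((b \<circ> k) m) ((b \<circ> k) n) < e * exp (- T)"
      using Cau unfolding Cauchy_def by blast
    have "d (f (b (k n))) (f (b (k n'))) < e" if "N \<le> n" "N \<le> n'" for n n'
    proof -
      have "cmod (b (k n) - b (k n')) / exp (- T) < e"
        using N[OF that] by (simp add: dist_norm divide_less_eq)
      then show ?thesis using lip[OF b(1) b(1), of "k n" "k n'"] by linarith
    qed
    then show "\<exists>N. \<forall>n n'. N \<le> n \<longrightarrow> N \<le> n' \<longrightarrow> d (f (b (k n))) (f (b (k n'))) < e" by blast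
  qed
  then obtain p where p: "limitin mtopology (\<lambda>n. f (b (k n))) p sequentially"
    using complete unfolding mcomplete_def by blast
  have pM: "p \<in> M" using p limitin_mspace by blast
  obtain U \<phi> where U: "(U, \<phi>) \<in> \<A>" "p \<in> U" using cover[OF pM] by blast
  obtain \<delta> where \<delta>: "\<delta> > 0" "mball p \<delta> \<subseteq> U" "hball (\<phi> p) \<delta> \<subseteq> \<phi> ` U" using chart_ball[OF U] by blast
  have "\<forall>\<^sub>F n in sequentially. d (f (b (k n))) p < \<delta> / 2"
    using p half_gt_zero[OF \<delta>(1)] unfolding limitin_metric by (auto elim!: allE[of _ "\<delta>/2"] eventually_mono)
  moreover have "\<forall>\<^sub>F n in sequentially. 1 / real (Suc n) < \<delta> / 2"
    using order_tendstoD(2)[OF LIMSEQ_inverse_real_of_nat half_gt_zero[OF \<delta>(1)]] by (simp add: inverse_eq_divide)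
  ultimately have "\<forall>\<^sub>F n in sequentially. d (f (b (k n))) p < \<delta> / 2 \<and> 1 / real (Suc n) < \<delta> / 2"
    by (rule eventually_conj)
  then obtain n where n: "d (f (b (k n))) p < \<delta> / 2" "1 / real (Suc n) < \<delta> / 2"
    using eventually_happens'[OF sequentially_bot] by blast
  have kn: "1 / real (Suc (k n)) \<le> 1 / real (Suc n)"
    using seq_suble[OF k(1), of n] by (simp add: frac_le)
  let ?q = "f (b (k n))"
  have qU: "?q \<in> U" using n(1) \<delta>(1,2) pM bM by (auto simp: commute)
  have "hball (\<phi> ?q) (1 / real (Suc (k n))) \<subseteq> hball (\<phi> p) \<delta>"
  proof
    fix u assume u: "u \<in> hball (\<phi> ?q) (1 / real (Suc (k n)))"
    have "\<phi> ?q \<in> hball (\<phi> p) (\<delta> / 2)"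
      using chart_dist[OF U(1) U(2) qU] chart_pos[OF U(1) qU] n(1) by (simp add: hball_def commute)
    moreover have "u \<in> hball (\<phi> ?q) (\<delta> / 2)" using u kn n(2) by (simp add: hball_def)
    ultimately show "u \<in> hball (\<phi> p) \<delta>" using hball_triangle[OF chart_pos[OF U], of "\<phi> ?q" "\<delta>/2" u "\<delta>/2"] by simp
  qed
  then show False using b(2)[OF U(1) qU] \<delta>(3) by blast
qed

lemma point_towards_ii:
  assumes u: "Im u > 0" "hyp_dist \<i> u < T + \<delta>" and T: "T > 0" and \<delta>: "\<delta> > 0"
  shows "\<exists>b\<in>hball \<i> T. hyp_dist b u \<le> \<delta>"
proof -
  obtain A t where A: "t \<ge> 1" "mob A \<i> = \<i>" "mob A u = of_real t * \<i>" "hyp_dist \<i> u = ln t"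
    using two_point_normal_form[of \<i> u] u by auto
  \<comment> \<open>The point \<open>b\<close> is taken on the geodesic from \<open>\<i>\<close> to
    \<open>u\<close>, at distance \<open>\<delta>\<close> before \<open>u\<close>, or at
    \<open>\<i>\<close> itself if \<open>u\<close> is nearer than that.\<close>
  define \<sigma> where "\<sigma> = max 0 (ln t - \<delta>)"
  define b where "b = mob (minv A) (of_real (exp \<sigma>) * \<i>)"
  have lt: "0 \<le> ln t" using A(1) by simp
  have s: "0 \<le> \<sigma>" "\<sigma> < T" "\<bar>\<sigma> - ln t\<bar> \<le> \<delta>" using u(2) A(4) T \<delta> lt by (auto simp: \<sigma>_def)
  have bp: "Im b > 0" by (simp add: b_def)
  have Ab: "mob A b = of_real (exp \<sigma>) * \<i>" by (simp add: b_def)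
  have "hyp_dist \<i> b = hyp_dist (of_real 1 * \<i>) (of_real (exp \<sigma>) * \<i>)"
    using hyp_dist_mob[of \<i> b A] A(2) Ab bp by simp
  also have "\<dots> = \<sigma>" using s by (subst hyp_dist_imag_axis) auto
  finally have "b \<in> hball \<i> T" using s bp by (simp add: hball_def)
  moreover have "hyp_dist b u = hyp_dist (of_real (exp \<sigma>) * \<i>) (of_real t * \<i>)"
    using hyp_dist_mob[of b u A] A(3) Ab bp u by simp
  then have "hyp_dist b u \<le> \<delta>" using s A(1) by (simp add: hyp_dist_imag_axis)
  ultimately show ?thesis by blast
qed

text \<open>The extensions over balls of one common radius are glued. Intersections of balls are
  convex, hence connected, so agreement near one point spreads over each overlap.\<close>

lemma dev_extend_ball:
  assumes T: "T > 0" and f: "\<And>z. z \<in> hball \<i> T \<Longrightarrow> dev f z"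
  shows "\<exists>T' F. T' > T \<and> (\<forall>z\<in>hball \<i> T'. dev F z) \<and> (\<forall>z\<in>hball \<i> T. F z = f z)"
proof -
  have "\<exists>\<delta>>0. \<forall>b\<in>hball \<i> T. \<exists>U \<phi>. (U, \<phi>) \<in> \<A> \<and> f b \<in> U \<and> hball (\<phi> (f b)) \<delta> \<subseteq> \<phi> ` U"
    by (rule dev_uniform_charts) (rule f)
  then obtain \<delta> where \<delta>: "\<delta> > 0" "\<forall>b\<in>hball \<i> T. \<exists>U \<phi>. (U, \<phi>) \<in> \<A> \<and> f b \<in> U \<and> hball (\<phi> (f b)) \<delta> \<subseteq> \<phi> ` U"
    by (elim exE conjE) (rule that)
  define R where "R b F \<longleftrightarrow> (\<forall>u\<in>hball b \<delta>. dev F u) \<and> (\<exists>r>0. \<forall>u\<in>hball b r. F u = f u)" for b F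
  have R: "\<exists>F. R b F" if b: "b \<in> hball \<i> T" for b
  proof -
    obtain U \<phi> where U: "(U, \<phi>) \<in> \<A>" "f b \<in> U" "hball (\<phi> (f b)) \<delta> \<subseteq> \<phi> ` U"
      using bspec[OF \<delta>(2) b] by (elim exE conjE) (rule that)
    show ?thesis unfolding R_def using dev_extend_point[OF hball_pos[OF b] f[OF b] U] by blast
  qed
  define F where "F b = (SOME F. R b F)" for b
  have "R b (F b)" if "b \<in> hball \<i> T" for b
    unfolding F_def by (rule someI_ex[OF R[OF that]])
  then have F: "\<And>b u. b \<in> hball \<i> T \<Longrightarrow> u \<in> hball b \<delta> \<Longrightarrow> dev (F b) u"
     "\<And>b. b \<in> hball \<i> T \<Longrightarrow> \<exists>r>0. \<forall>u\<in>hball b r. F b u = f u"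
    by (simp_all add: R_def)
  have conv: "open (hball b \<delta> \<inter> hball c s) \<and> connected (hball b \<delta> \<inter> hball c s)" if "Im b > 0" "Im c > 0" for b c s
    using that by (auto intro!: open_Int convex_connected convex_Int convex_hball)
  have Ff: "F b u = f u" if b: "b \<in> hball \<i> T" and u: "u \<in> hball b \<delta>" "u \<in> hball \<i> T" for b u
  proof -
    have bp: "Im b > 0" using b hball_pos by blast
    obtain r where r: "r > 0" "\<And>u. u \<in> hball b r \<Longrightarrow> F b u = f u" using F(2)[OF b] by blast
    show ?thesis
    proof (rule dev_unique[of "hball b \<delta> \<inter> hball \<i> T" "F b" f b r u])
      show "open (hball b \<delta> \<inter> hball \<i> T)" "connected (hball b \<delta> \<inter> hball \<i> T)" using conv[OF bp, of \<i> T] by auto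
    qed (use bp b \<delta>(1) u r F(1)[OF b] f hball_pos in auto)
  qed
  \<comment> \<open>Half the radius suffices to put the centre \<open>c\<close> into the large ball
    around \<open>b\<close>; near \<open>c\<close> both extensions agree with \<open>f\<close>,
    hence with each other.\<close>
  have FF: "F b u = F c u" if b: "b \<in> hball \<i> T" "u \<in> hball b (\<delta>/2)" and c: "c \<in> hball \<i> T" "u \<in> hball c (\<delta>/2)" for b c u
  proof -
    have bp: "Im b > 0" and cp: "Im c > 0" and up: "Im u > 0" using b c hball_pos by blast+
    have cb: "c \<in> hball b \<delta>"
      using hball_triangle[OF bp b(2), of c "\<delta>/2"] c(2) hball_sym[OF up cp] by simp
    have "open (hball c \<delta> \<inter> hball b \<delta> \<inter> hball \<i> T)" using bp cp by (auto intro!: open_Int)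
    then obtain r where r: "r > 0" "hball c r \<subseteq> hball c \<delta> \<inter> hball b \<delta> \<inter> hball \<i> T"
      using hball_in_open[OF cp, of "hball c \<delta> \<inter> hball b \<delta> \<inter> hball \<i> T"] cb cp c(1) \<delta>(1) by auto
    show ?thesis
    proof (rule dev_unique[of "hball b \<delta> \<inter> hball c \<delta>" "F b" "F c" c r u])
      show "open (hball b \<delta> \<inter> hball c \<delta>)" "connected (hball b \<delta> \<inter> hball c \<delta>)" using conv[OF bp cp, of \<delta>] by auto
      show "F b v = F c v" if "v \<in> hball c r" for v
      proof -
        have "v \<in> hball c \<delta>" "v \<in> hball b \<delta>" "v \<in> hball \<i> T" using that r(2) by blast+
        then show ?thesis using Ff[OF b(1), of v] Ff[OF c(1), of v] by simp
      qed
      show "u \<in> hball b \<delta> \<inter> hball c \<delta>" using b c \<delta>(1) by (auto simp: hball_def)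
    qed (use cb cp \<delta>(1) r F(1)[OF b(1)] F(1)[OF c(1)] hball_pos in auto)
  qed
  define sel where "sel u = (SOME b. b \<in> hball \<i> T \<and> u \<in> hball b (\<delta>/2))" for u
  define G where "G u = F (sel u) u" for u
  have G: "G u = F b u" if "b \<in> hball \<i> T" "u \<in> hball b (\<delta>/2)" for b u
  proof -
    have "sel u \<in> hball \<i> T \<and> u \<in> hball (sel u) (\<delta>/2)"
      unfolding sel_def by (rule someI[of _ b]) (use that in blast)
    then show ?thesis unfolding G_def using FF that by blast
  qed
  \<comment> \<open>A quarter of the radius leaves room: \<open>u\<close> is within
    \<open>\<delta>/4\<close> of a centre, so a neighbourhood of \<open>u\<close> lies in the half
    ball on which \<open>G\<close> is given by a single extension.\<close>
  have "dev G u" if u: "u \<in> hball \<i> (T + \<delta>/4)" for u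
  proof -
    have up: "Im u > 0" using u hball_pos by blast
    obtain b where b: "b \<in> hball \<i> T" "hyp_dist b u \<le> \<delta>/4"
      using point_towards_ii[of u T "\<delta>/4"] u up T \<delta>(1) by (auto simp: hball_def)
    have bp: "Im b > 0" using b hball_pos by blast
    have ub: "u \<in> hball b (\<delta>/2)" using b(2) up \<delta>(1) by (simp add: hball_def)
    then obtain r where r: "r > 0" "hball u r \<subseteq> hball b (\<delta>/2)" using hball_in_open[OF up _ ub] bp by auto
    have "dev (F b) u" using F(1)[OF b(1)] ub \<delta>(1) by (auto simp: hball_def)
    then show ?thesis
    proof (rule dev_cong[OF _ r(1)])
      fix v assume "v \<in> hball u r"
      then show "G v = F b v" using G[OF b(1), of v] r(2) by auto
    qed
  qed
  moreover have "G u = f u" if u: "u \<in> hball \<i> T" for u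
    using G[OF u, of u] Ff[OF u, of u] u \<delta>(1) hball_pos[OF u] by auto
  ultimately show ?thesis using \<delta>(1) by (intro exI[of _ "T + \<delta>/4"] exI[of _ G]) auto
qed

text \<open>All radii over which the initial germ \<open>f0\<close> extends are considered.
  Extensions that start with the same germ agree, so they glue up to the supremum of the radii; were
  it finite, \<open>dev_extend_ball\<close> would go beyond it.\<close>

theorem developing_map_exists: "\<exists>P. \<forall>z. Im z > 0 \<longrightarrow> dev P z"
proof -
  obtain p where p: "p \<in> M" using nonempty by blast
  obtain U \<phi> where U: "(U, \<phi>) \<in> \<A>" "p \<in> U" using cover[OF p] by blast
  have pp: "Im (\<phi> p) > 0" using chart_pos[OF U] .
  define A where "A = frame (\<phi> p)"
  have A: "mob A \<i> = \<phi> p" using mob_frame[OF pp] by (simp add: A_def)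
  obtain r0 where r0: "r0 > 0" "hball (\<phi> p) r0 \<subseteq> \<phi> ` U" using chart_ball[OF U] by blast
  define f0 where "f0 u = inv_into U \<phi> (mob A u)" for u
  have f0: "dev f0 u" if u: "u \<in> hball \<i> r0" for u
  proof -
    have up: "Im u > 0" using u hball_pos by blast
    have "mob A u \<in> hball (\<phi> p) r0" using mob_in_hball[of \<i> u A r0] u up A by simp
    then have "dev (inv_into U \<phi>) (mob A u)" using dev_chart_inv[OF U(1)] r0(2) by blast
    then show ?thesis unfolding f0_def by (rule dev_comp[OF _ up])
  qed
  define Q where "Q T f \<longleftrightarrow> (\<forall>z\<in>hball \<i> T. dev f z) \<and> (\<forall>z\<in>hball \<i> r0. f z = f0 z)" for T f
  have Quniq: "f u = h u" if "r0 \<le> T" "r0 \<le> S" "Q T f" "Q S h" "u \<in> hball \<i> T" "u \<in> hball \<i> S" for T S f h u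
  proof (rule dev_unique[of "hball \<i> (min T S)" f h \<i> r0 u])
    show "open (hball \<i> (min T S))" "connected (hball \<i> (min T S))" by (simp_all add: convex_connected convex_hball)
  qed (use that r0(1) in \<open>auto simp: Q_def hball_def\<close>)
  define I where "I = {T. r0 \<le> T \<and> (\<exists>f. Q T f)}"
  have r0I: "r0 \<in> I" using f0 by (auto simp: I_def Q_def)
  define F where "F T = (SOME f. Q T f)" for T
  have F: "Q T (F T)" if "T \<in> I" for T
    using that someI_ex[of "Q T"] by (auto simp: I_def F_def)
  define G where "G u = F (SOME T. T \<in> I \<and> u \<in> hball \<i> T) u" for u
  have G: "G u = F T u" if T: "T \<in> I" "u \<in> hball \<i> T" for T u
  proof -
    define T' where "T' = (SOME T. T \<in> I \<and> u \<in> hball \<i> T)"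
    have T': "T' \<in> I" "u \<in> hball \<i> T'"
      unfolding T'_def using someI[of "\<lambda>T. T \<in> I \<and> u \<in> hball \<i> T" T] T by blast+
    have "r0 \<le> T'" "r0 \<le> T" using T T' by (auto simp: I_def)
    then show ?thesis unfolding G_def T'_def[symmetric] using Quniq F T T' by simp
  qed
  have Gdev: "dev G u" if T: "T \<in> I" "u \<in> hball \<i> T" for T u
  proof -
    have up: "Im u > 0" using T hball_pos by blast
    obtain r where r: "r > 0" "hball u r \<subseteq> hball \<i> T" using hball_in_open[OF up _ T(2)] by auto
    have "dev (F T) u" using F[OF T(1)] T(2) by (simp add: Q_def)
    then show ?thesis
    proof (rule dev_cong[OF _ r(1)])
      fix v assume "v \<in> hball u r"
      then show "G v = F T v" using G[OF T(1), of v] r(2) by auto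
    qed
  qed
  have G0: "G u = f0 u" if "u \<in> hball \<i> r0" for u
    using G[OF r0I that] F[OF r0I] that by (simp add: Q_def)
  have unb: "\<exists>T\<in>I. K < T" for K
  proof (rule ccontr)
    assume neg: "\<not> (\<exists>T\<in>I. K < T)"
    then have bd: "bdd_above I" by (intro bdd_aboveI[of _ K]) auto
    define s where "s = Sup I"
    have s: "r0 \<le> s" using cSup_upper[OF r0I bd] by (simp add: s_def)
    have Gs: "dev G z" if z: "z \<in> hball \<i> s" for z
    proof -
      have "hyp_dist \<i> z < Sup I" using z by (simp add: hball_def s_def)
      then obtain T where T: "T \<in> I" "hyp_dist \<i> z < T" using less_cSupE[of "hyp_dist \<i> z" I] r0I by blast
      then have "z \<in> hball \<i> T" using z by (simp add: hball_def)
      with T(1) show ?thesis by (rule Gdev)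
    qed
    have "\<exists>T' F. T' > s \<and> (\<forall>z\<in>hball \<i> T'. dev F z) \<and> (\<forall>z\<in>hball \<i> s. F z = G z)"
      by (rule dev_extend_ball[OF less_le_trans[OF r0(1) s]]) (rule Gs)
    then obtain T' H where H: "T' > s" "\<And>z. z \<in> hball \<i> T' \<Longrightarrow> dev H z" "\<And>z. z \<in> hball \<i> s \<Longrightarrow> H z = G z"
      by blast
    have "Q T' H" unfolding Q_def
    proof (intro conjI ballI)
      fix z assume "z \<in> hball \<i> r0"
      then show "H z = f0 z" using H(3)[of z] G0[of z] hball_mono[OF s, of \<i>] by auto
    qed (rule H(2))
    then have "T' \<in> I" using H(1) s unfolding I_def by (intro CollectI conjI exI[of _ H]) simp_all
    then show False using cSup_upper[OF _ bd, of T'] H(1) by (simp add: s_def)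
  qed
  have "dev G z" if z: "Im z > 0" for z
  proof -
    obtain T where T: "T \<in> I" "hyp_dist \<i> z < T" using unb by blast
    then have "z \<in> hball \<i> T" using z by (simp add: hball_def)
    with T(1) show ?thesis by (rule Gdev)
  qed
  then show ?thesis by blast
qed

end

section \<open>The deck group and the thick part\<close>

locale dsurf = hsurf +
  fixes P :: "complex \<Rightarrow> 'a"
  assumes P: "\<And>z. Im z > 0 \<Longrightarrow> dev P z"
begin

lemma P_in_M: "Im z > 0 \<Longrightarrow> P z \<in> M"
  using dev_in_M[OF P] by blast

lemma P_isom:
  assumes "Im z > 0"
  obtains r where "r > 0" "\<And>u v. u \<in> hball z r \<Longrightarrow> v \<in> hball z r \<Longrightarrow> d (P u) (P v) = hyp_dist u v"
  using dev_isom[OF P[OF assms] assms] by blast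

lemma P_geodesic:
  fixes A :: sl2
  shows "\<exists>e>0. \<forall>s t. \<bar>s - x\<bar> < e \<and> \<bar>t - x\<bar> < e \<longrightarrow>
    d (P (mob A (of_real (exp s) * \<i>))) (P (mob A (of_real (exp t) * \<i>))) = \<bar>s - t\<bar>"
proof -
  define z where "z = mob A (of_real (exp x) * \<i>)"
  have zp: "Im z > 0" by (simp add: z_def)
  obtain r where r: "r > 0" "\<And>u v. u \<in> hball z r \<Longrightarrow> v \<in> hball z r \<Longrightarrow> d (P u) (P v) = hyp_dist u v"
    using P_isom[OF zp] by blast
  have "d (P (mob A (of_real (exp s) * \<i>))) (P (mob A (of_real (exp t) * \<i>))) = \<bar>s - t\<bar>"
    if "\<bar>s - x\<bar> < r" "\<bar>t - x\<bar> < r" for s t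
  proof -
    have "mob A (of_real (exp y) * \<i>) \<in> hball z r" if "\<bar>y - x\<bar> < r" for y
      using that by (simp add: z_def hball_def hyp_dist_imag_axis)
    then show ?thesis using r(2) that by (simp add: hyp_dist_imag_axis)
  qed
  then show ?thesis using r(1) by blast
qed

lemma P_lipschitz:
  assumes u: "Im u > 0" and v: "Im v > 0"
  shows "d (P u) (P v) \<le> hyp_dist u v"
proof -
  obtain A t where A: "t \<ge> 1" "mob A u = \<i>" "mob A v = of_real t * \<i>" "hyp_dist u v = ln t"
    using two_point_normal_form[OF u v] by blast
  define c where "c s = P (mob (minv A) (of_real (exp s) * \<i>))" for s
  have "d (c 0) (c (ln t)) \<le> 1 * (ln t - 0)"
  proof (rule local_lipschitz_chain)
    fix x
    have "c s \<in> M" for s by (simp add: c_def P_in_M)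
    then show "\<exists>e>0. \<forall>s t. \<bar>s - x\<bar> < e \<and> \<bar>t - x\<bar> < e \<longrightarrow> c s \<in> M \<and> c t \<in> M \<and> d (c s) (c t) \<le> 1 * \<bar>s - t\<bar>"
      using P_geodesic[of x "minv A"] unfolding c_def by fastforce
  qed (use A(1) in simp)
  moreover have "c 0 = P u" using mob_minv(1)[OF u, of A] A(2) by (simp add: c_def)
  moreover have "c (ln t) = P v" using mob_minv(1)[OF v, of A] A(1,3) by (simp add: c_def)
  ultimately show ?thesis using A(4) by simp
qed

text \<open>The radius depends on the point \<open>p\<close> of the surface only, not on the
  preimage \<open>z\<close>: this uniformity is what distinguishes a covering from a local
  isometry.\<close>

lemma P_section:
  assumes p: "p \<in> M"
  obtains \<delta> where "\<delta> > 0" "\<And>z q. Im z > 0 \<Longrightarrow> q \<in> M \<Longrightarrow> d (P z) p < \<delta> \<Longrightarrow> d q p < \<delta> \<Longrightarrow>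
    \<exists>w. Im w > 0 \<and> P w = q \<and> hyp_dist z w = d (P z) q"
proof -
  obtain U \<phi> where U: "(U, \<phi>) \<in> \<A>" "p \<in> U" using cover[OF p] by blast
  obtain \<eta> where \<eta>: "\<eta> > 0" "mball p \<eta> \<subseteq> U" "hball (\<phi> p) \<eta> \<subseteq> \<phi> ` U" using chart_ball[OF U] by blast
  \<comment> \<open>A third of the chart radius: \<open>P z\<close> may be off \<open>p\<close> by
    \<open>\<delta>\<close>, and \<open>q\<close> is then within \<open>2 * \<delta>\<close> of
    \<open>P z\<close>, so everything stays in one chart.\<close>
  define \<delta> where "\<delta> = \<eta> / 3"
  have \<delta>: "\<delta> > 0" "3 * \<delta> = \<eta>" using \<eta>(1) by (auto simp: \<delta>_def)
  show ?thesis
  proof (rule that[OF \<delta>(1)])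
    fix z q assume z: "Im z > 0" and q: "q \<in> M" and zp: "d (P z) p < \<delta>" and qp: "d q p < \<delta>"
    have PzU: "P z \<in> U" and qU: "q \<in> U" using P_in_M[OF z] p q zp qp \<eta>(2) \<delta> by (auto simp: commute)
    have sub: "hball (\<phi> (P z)) (2 * \<delta>) \<subseteq> \<phi> ` U"
    proof
      fix u assume u: "u \<in> hball (\<phi> (P z)) (2 * \<delta>)"
      have "\<phi> (P z) \<in> hball (\<phi> p) \<delta>"
        using chart_dist[OF U PzU] chart_pos[OF U(1) PzU] zp by (simp add: hball_def commute)
      then have "u \<in> hball (\<phi> p) (\<delta> + 2 * \<delta>)" using hball_triangle[OF chart_pos[OF U]] u by blast
      then show "u \<in> \<phi> ` U" using \<eta>(3) \<delta>(2) by auto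
    qed
    from dev_extend_point[OF z P[OF z] U(1) PzU sub]
    obtain F where F: "\<forall>u\<in>hball z (2 * \<delta>). dev F u" "\<exists>r>0. \<forall>u\<in>hball z r. F u = P u"
      "\<forall>q\<in>U. d (P z) q < 2 * \<delta> \<longrightarrow> (\<exists>u\<in>hball z (2 * \<delta>). F u = q \<and> hyp_dist z u = d (P z) q)"
      by (rule exE, elim conjE) (rule that)
    obtain r where r: "r > 0" "\<forall>u\<in>hball z r. F u = P u" using F(2) by blast
    have "d (P z) q < 2 * \<delta>" using triangle[of "P z" p q] P_in_M[OF z] p q zp qp by (simp add: commute)
    then obtain w where w: "w \<in> hball z (2 * \<delta>)" "F w = q" "hyp_dist z w = d (P z) q" using F(3) qU by blast
    have "F w = P w"
    proof (rule dev_unique[of "hball z (2 * \<delta>)" F P z r w])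
      show "open (hball z (2 * \<delta>))" "connected (hball z (2 * \<delta>))" using z by (auto simp: convex_connected convex_hball)
    qed (use F(1) r w z \<delta>(1) hball_pos P in auto)
    then show "\<exists>w. Im w > 0 \<and> P w = q \<and> hyp_dist z w = d (P z) q" using w hball_pos by auto
  qed
qed

text \<open>The image is open and so is its complement. For the complement, \<open>P_section\<close>
  is applied from a point that is hit: if it lies within \<open>\<delta>\<close> of
  \<open>p\<close>, then \<open>p\<close> is hit as well.\<close>

lemma P_surj:
  assumes "q \<in> M" shows "\<exists>z. Im z > 0 \<and> P z = q"
proof -
  define S where "S = {q \<in> M. \<exists>z. Im z > 0 \<and> P z = q}"
  have "openin mtopology S"
    unfolding openin_mtopology
  proof (intro conjI allI impI)
    fix p assume "p \<in> S"
    then obtain z where z: "p \<in> M" "Im z > 0" "P z = p" by (auto simp: S_def)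
    obtain \<delta> where \<delta>: "\<delta> > 0" "\<And>z q. Im z > 0 \<Longrightarrow> q \<in> M \<Longrightarrow> d (P z) p < \<delta> \<Longrightarrow> d q p < \<delta> \<Longrightarrow>
      \<exists>w. Im w > 0 \<and> P w = q \<and> hyp_dist z w = d (P z) q" using P_section[OF z(1)] by blast
    have "mball p \<delta> \<subseteq> S"
    proof
      fix q assume q: "q \<in> mball p \<delta>"
      then have "\<exists>w. Im w > 0 \<and> P w = q \<and> hyp_dist z w = d (P z) q" using \<delta>(2)[OF z(2), of q] z(1,3) \<delta>(1) by (simp add: commute)
      then show "q \<in> S" using q by (auto simp: S_def)
    qed
    then show "\<exists>r>0. mball p r \<subseteq> S" using \<delta>(1) by blast
  qed (auto simp: S_def)
  moreover have "openin mtopology (M - S)"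
    unfolding openin_mtopology
  proof (intro conjI allI impI)
    fix p assume p: "p \<in> M - S"
    then have pM: "p \<in> M" by simp
    obtain \<delta> where \<delta>: "\<delta> > 0" "\<And>z q. Im z > 0 \<Longrightarrow> q \<in> M \<Longrightarrow> d (P z) p < \<delta> \<Longrightarrow> d q p < \<delta> \<Longrightarrow>
      \<exists>w. Im w > 0 \<and> P w = q \<and> hyp_dist z w = d (P z) q" using P_section[OF pM] by blast
    have "mball p \<delta> \<subseteq> M - S"
    proof
      fix q assume q: "q \<in> mball p \<delta>"
      have "q \<notin> S"
      proof
        assume "q \<in> S"
        then obtain z where z: "Im z > 0" "P z = q" by (auto simp: S_def)
        then have "\<exists>w. Im w > 0 \<and> P w = p \<and> hyp_dist z w = d (P z) p"
          using \<delta>(2)[OF z(1) pM] q pM \<delta>(1) by (simp add: commute)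
        then show False using p by (auto simp: S_def)
      qed
      then show "q \<in> M - S" using q by simp
    qed
    then show "\<exists>r>0. mball p r \<subseteq> M - S" using \<delta>(1) by blast
  qed auto
  moreover have "P \<i> \<in> S" using P_in_M[of \<i>] by (auto simp: S_def intro!: exI[of _ \<i>])
  ultimately have "M - S = {}"
    using conn unfolding connected_space_def topspace_mtopology
    by (metis Diff_disjoint Un_Diff_cancel Un_absorb2 empty_iff openin_subset subset_refl topspace_mtopology Un_commute)
  then show ?thesis using assms by (auto simp: S_def)
qed

text \<open>The full preimage of the deck group in \<open>SL(2, \<real>)\<close>; with every element
  it contains its negative.\<close>

definition Gam :: "sl2 set" where
  "Gam = {A. \<forall>z. Im z > 0 \<longrightarrow> P (mob A z) = P z}"

lemma GamD: "A \<in> Gam \<Longrightarrow> Im z > 0 \<Longrightarrow> P (mob A z) = P z"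
  by (simp add: Gam_def)

lemma Gam_one: "1 \<in> Gam" by (simp add: Gam_def)

lemma Gam_mult: "A \<in> Gam \<Longrightarrow> B \<in> Gam \<Longrightarrow> A * B \<in> Gam"
  by (simp add: Gam_def mob_mult)

lemma Gam_inv:
  assumes "A \<in> Gam" shows "minv A \<in> Gam"
  unfolding Gam_def
proof (intro CollectI allI impI)
  fix z assume "0 < Im z"
  then show "P (mob (minv A) z) = P z" using GamD[OF assms, of "mob (minv A) z"] by simp
qed

lemma Gam_neg: "A \<in> Gam \<Longrightarrow> mneg A \<in> Gam"
  by (simp add: Gam_def)

text \<open>Germs of \<open>P\<close> at two points of one fibre differ by a Moebius map, and
  \<open>dev_unique\<close> spreads the local invariance over the half plane.\<close>

lemma deck:
  assumes z: "Im z > 0" and w: "Im w > 0" and eq: "P z = P w"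
  shows "\<exists>A\<in>Gam. mob A z = w"
proof -
  obtain B r where B: "r > 0" "mob B z = w" "\<And>u. u \<in> hball z r \<Longrightarrow> P (mob B u) = P u"
    using dev_germ[OF P[OF z] P[OF w] z w eq] by blast
  have "P (mob B x) = P x" if x: "Im x > 0" for x
  proof (rule dev_unique[of upper_half_plane "\<lambda>u. P (mob B u)" P z r x])
    show "connected upper_half_plane" by (simp add: upper_half_plane_def convex_connected convex_halfspace_Im_gt)
    show "dev (\<lambda>u. P (mob B u)) u" if "u \<in> upper_half_plane" for u
      using that by (intro dev_comp P) (auto simp: upper_half_plane_def)
  qed (use z x B P open_upper_half_plane in \<open>auto simp: upper_half_plane_def\<close>)
  then show ?thesis using B(2) by (auto simp: Gam_def)
qed

text \<open>\<open>P\<close> is isometric, hence injective, on a ball about \<open>z\<close>. An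
  element that moves \<open>z\<close> by less than half the radius keeps the half ball inside that
  ball and must fix it pointwise. Freeness and discreteness are both read off from this.\<close>

lemma Gam_locally_trivial:
  assumes z: "Im z > 0"
  shows "\<exists>r>0. \<forall>A\<in>Gam. hyp_dist z (mob A z) < r \<longrightarrow> triv A"
proof -
  obtain r where r: "r > 0" "\<And>u v. u \<in> hball z r \<Longrightarrow> v \<in> hball z r \<Longrightarrow> d (P u) (P v) = hyp_dist u v"
    using P_isom[OF z] by blast
  have "triv A" if A: "A \<in> Gam" "hyp_dist z (mob A z) < r / 2" for A
  proof (rule mob_id_on_open_triv[of "hball z (r / 2)" z])
    fix u assume u: "u \<in> hball z (r / 2)"
    have up: "Im u > 0" using u hball_pos by blast
    have "mob A u \<in> hball (mob A z) (r / 2)" using mob_in_hball[OF z up] u by simp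
    moreover have "mob A z \<in> hball z (r / 2)" using A(2) z by (simp add: hball_def)
    ultimately have "mob A u \<in> hball z r" using hball_triangle[OF z, of "mob A z" "r/2" "mob A u" "r/2"] by simp
    moreover have "u \<in> hball z r" using u r(1) by (simp add: hball_def)
    ultimately have "hyp_dist (mob A u) u = d (P (mob A u)) (P u)" using r(2) by simp
    also have "\<dots> = 0" using GamD[OF A(1) up] P_in_M[OF up] by simp
    finally show "mob A u = u" using hyp_dist_eq_0[of "mob A u" u] up by simp
  qed (use z r(1) in auto)
  then show ?thesis using r(1) by (intro exI[of _ "r/2"]) auto
qed

lemma Gam_free: "A \<in> Gam \<Longrightarrow> Im z > 0 \<Longrightarrow> mob A z = z \<Longrightarrow> triv A"
  using Gam_locally_trivial[of z] by auto

end

text \<open>The right side is half the squared Frobenius norm: elements that move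
  \<open>\<i>\<close> by a bounded amount have bounded entries, so discreteness can be argued with
  matrices.\<close>

lemma cosh_disp_ii: "cosh (hyp_dist \<i> (mob A \<i>)) = ((ea A)\<^sup>2 + (eb A)\<^sup>2 + (ec A)\<^sup>2 + (ed A)\<^sup>2) / 2"
proof -
  define D where "D = (cmod (cden A \<i>))\<^sup>2"
  have D: "D = (ec A)\<^sup>2 + (ed A)\<^sup>2" by (simp add: D_def cmod_power2)
  have Dp: "D > 0" using cden_nz[of \<i> A] by (simp add: D_def)
  have im: "Im (mob A \<i>) = 1 / D" by (simp add: Im_mob D_def)
  have "\<i> - mob A \<i> = (\<i> * cden A \<i> - (of_real (ea A) * \<i> + of_real (eb A))) / cden A \<i>"
    unfolding mob_def using cden_nz[of \<i> A] by (simp add: diff_divide_distrib)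
  then have "(cmod (\<i> - mob A \<i>))\<^sup>2 = (cmod (\<i> * cden A \<i> - (of_real (ea A) * \<i> + of_real (eb A))))\<^sup>2 / D"
    by (simp only: norm_divide power_divide D_def)
  also have "(cmod (\<i> * cden A \<i> - (of_real (ea A) * \<i> + of_real (eb A))))\<^sup>2 = (ec A + eb A)\<^sup>2 + (ed A - ea A)\<^sup>2"
    unfolding cmod_power2 by (simp add: power2_eq_square algebra_simps)
  finally have "(cmod (\<i> - mob A \<i>))\<^sup>2 = ((ec A + eb A)\<^sup>2 + (ed A - ea A)\<^sup>2) / D" .
  then have "cosh (hyp_dist \<i> (mob A \<i>)) = 1 + ((ec A + eb A)\<^sup>2 + (ed A - ea A)\<^sup>2) / 2"
    using cosh_hyp_dist[of \<i> "mob A \<i>"] im Dp by simp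
  also have "\<dots> = ((ea A)\<^sup>2 + (eb A)\<^sup>2 + (ec A)\<^sup>2 + (ed A)\<^sup>2) / 2"
    using sl2_det[of A] by (simp add: power2_eq_square field_simps)
  finally show ?thesis .
qed

lemma cosh_disp_ii': "2 * cosh (hyp_dist \<i> (mob A \<i>)) - 2 = (ea A - ed A)\<^sup>2 + (eb A + ec A)\<^sup>2"
  using cosh_disp_ii[of A] sl2_det[of A] by (simp add: power2_eq_square field_simps)

lemma disp_conj:
  assumes "Im z > 0"
  shows "hyp_dist (mob B z) (mob (B * A * minv B) (mob B z)) = hyp_dist z (mob A z)"
proof -
  have "mob (B * A * minv B) (mob B z) = mob B (mob A z)" using assms by (simp add: mob_mult)
  then show ?thesis using assms by simp
qed

lemma disp_le:
  assumes "Im z > 0" "Im w > 0"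
  shows "hyp_dist w (mob A w) \<le> 2 * hyp_dist z w + hyp_dist z (mob A z)"
proof -
  have "hyp_dist w (mob A w) \<le> hyp_dist w z + hyp_dist z (mob A w)"
    by (rule hyp_dist_triangle) (use assms in auto)
  also have "hyp_dist z (mob A w) \<le> hyp_dist z (mob A z) + hyp_dist (mob A z) (mob A w)"
    by (rule hyp_dist_triangle) (use assms in auto)
  also have "hyp_dist (mob A z) (mob A w) = hyp_dist z w" using assms by simp
  finally show ?thesis by (simp add: hyp_dist_commute)
qed

context dsurf
begin

text \<open>Infinitely many matrices with bounded entries accumulate. For two of them that are
  close, \<open>minv A * B\<close> is near \<open>1\<close>, so it moves \<open>\<i>\<close> very
  little and is trivial.\<close>

lemma Gam_discrete: "finite {A \<in> Gam. hyp_dist \<i> (mob A \<i>) \<le> R}" (is "finite ?S")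
proof (rule ccontr)
  assume inf: "infinite ?S"
  define e where "e A = (ea A, eb A, ec A, ed A)" for A
  have inj: "inj_on e ?S" by (rule inj_onI) (auto simp: e_def intro: sl2_eqI)
  define K where "K = sqrt (2 * cosh R) + 1"
  have K: "K \<ge> 1" by (simp add: K_def)
  have ent: "\<bar>ea A\<bar> \<le> K \<and> \<bar>eb A\<bar> \<le> K \<and> \<bar>ec A\<bar> \<le> K \<and> \<bar>ed A\<bar> \<le> K" if "A \<in> ?S" for A
  proof -
    have "0 \<le> hyp_dist \<i> (mob A \<i>)" by (simp add: hyp_dist_nonneg)
    then have "cosh (hyp_dist \<i> (mob A \<i>)) \<le> cosh R" using that by (subst cosh_mono_iff) auto
    then have s: "(ea A)\<^sup>2 + (eb A)\<^sup>2 + (ec A)\<^sup>2 + (ed A)\<^sup>2 \<le> 2 * cosh R" using cosh_disp_ii[of A] by simp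
    have "\<bar>x\<bar> \<le> K" if "x\<^sup>2 \<le> 2 * cosh R" for x
      using real_le_rsqrt[of "\<bar>x\<bar>" "2 * cosh R"] that by (simp add: K_def)
    moreover have "(ea A)\<^sup>2 \<le> 2 * cosh R" "(eb A)\<^sup>2 \<le> 2 * cosh R" "(ec A)\<^sup>2 \<le> 2 * cosh R" "(ed A)\<^sup>2 \<le> 2 * cosh R"
      using s zero_le_power2[of "ea A"] zero_le_power2[of "eb A"] zero_le_power2[of "ec A"] zero_le_power2[of "ed A"] by linarith+
    ultimately show ?thesis by blast
  qed
  have "e ` ?S \<subseteq> {-K..K} \<times> {-K..K} \<times> {-K..K} \<times> {-K..K}"
    using ent by (force simp: e_def abs_le_iff)
  moreover have "compact ({-K..K} \<times> {-K..K} \<times> {-K..K} \<times> {-K..K})" by (intro compact_Times compact_Icc)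
  moreover have "infinite (e ` ?S)" using inf inj finite_image_iff by blast
  ultimately obtain l where l: "l islimpt (e ` ?S)" using Heine_Borel_imp_Bolzano_Weierstrass by blast
  obtain r where r: "r > 0" "\<And>A. A \<in> Gam \<Longrightarrow> hyp_dist \<i> (mob A \<i>) < r \<Longrightarrow> triv A"
    using Gam_locally_trivial[of \<i>] by auto
  \<comment> \<open>The first term gives \<open>K * \<epsilon> \<le> 1/8\<close>, which keeps the
    upper left entry of \<open>C\<close> positive and excludes \<open>mneg 1\<close>; the last one
    makes the displacement of \<open>\<i>\<close> by \<open>C\<close> smaller than
    \<open>r\<close>.\<close>
  define \<epsilon> where "\<epsilon> = min (1 / (8 * K)) (min (1/4) (sqrt (2 * cosh r - 2) / (16 * K)))"
  have cr: "2 * cosh r - 2 > 0" using r(1) cosh_real_one_iff[of r] cosh_real_ge_1[of r] by linarith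
  have \<epsilon>: "\<epsilon> > 0" using K cr by (simp add: \<epsilon>_def)
  obtain y where y: "y \<in> e ` ?S" "y \<noteq> l" "dist y l < \<epsilon> / 2" using l \<epsilon> unfolding islimpt_approachable by (meson half_gt_zero)
  have mpos: "min (\<epsilon> / 2) (dist y l) > 0" using \<epsilon> y(2) by simp
  obtain x where x: "x \<in> e ` ?S" "x \<noteq> l" "dist x l < min (\<epsilon> / 2) (dist y l)"
    using l mpos unfolding islimpt_approachable by blast
  have xy: "x \<noteq> y" "dist x y < \<epsilon>" using x(3) y(3) dist_triangle2[of x y l] by auto
  obtain A B where AB: "A \<in> ?S" "B \<in> ?S" "y = e A" "x = e B" using x y by blast
  have d4: "\<bar>ea B - ea A\<bar> < \<epsilon> \<and> \<bar>eb B - eb A\<bar> < \<epsilon> \<and> \<bar>ec B - ec A\<bar> < \<epsilon> \<and> \<bar>ed B - ed A\<bar> < \<epsilon>"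
  proof -
    have 1: "dist (e B) (e A) < \<epsilon>" using xy AB by simp
    have "dist (fst (e B)) (fst (e A)) < \<epsilon>" using dist_fst_le[of "e B" "e A"] 1 by linarith
    moreover have "dist (snd (e B)) (snd (e A)) < \<epsilon>" using dist_snd_le[of "e B" "e A"] 1 by linarith
    moreover from this have "dist (fst (snd (e B))) (fst (snd (e A))) < \<epsilon>" "dist (snd (snd (e B))) (snd (snd (e A))) < \<epsilon>"
      using dist_fst_le[of "snd (e B)" "snd (e A)"] dist_snd_le[of "snd (e B)" "snd (e A)"] by linarith+
    moreover from this have "dist (fst (snd (snd (e B)))) (fst (snd (snd (e A)))) < \<epsilon>" "dist (snd (snd (snd (e B)))) (snd (snd (snd (e A)))) < \<epsilon>"
      using dist_fst_le[of "snd (snd (e B))" "snd (snd (e A))"] dist_snd_le[of "snd (snd (e B))" "snd (snd (e A))"] by linarith+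
    ultimately show ?thesis by (simp add: e_def dist_real_def)
  qed
  define C where "C = minv A * B"
  have CG: "C \<in> Gam" using AB Gam_mult Gam_inv by (auto simp: C_def)
  have eA: "\<bar>ea A\<bar> \<le> K" "\<bar>eb A\<bar> \<le> K" "\<bar>ec A\<bar> \<le> K" "\<bar>ed A\<bar> \<le> K" using ent[OF AB(1)] by auto
  have pr: "\<bar>p * q\<bar> \<le> K * \<epsilon>" if "\<bar>p\<bar> \<le> K" "\<bar>q\<bar> < \<epsilon>" for p q
    using that K by (simp add: abs_mult mult_mono)
  have tri: "\<bar>p * q - p' * q'\<bar> \<le> 2 * (K * \<epsilon>)" if "\<bar>p\<bar> \<le> K" "\<bar>q\<bar> < \<epsilon>" "\<bar>p'\<bar> \<le> K" "\<bar>q'\<bar> < \<epsilon>" for p q p' q'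
    using abs_triangle_ineq4[of "p * q" "p' * q'"] pr[of p q] pr[of p' q'] that by simp
  have Ca: "ea C - 1 = ed A * (ea B - ea A) - eb A * (ec B - ec A)"
    and Cd: "ed C - 1 = ea A * (ed B - ed A) - ec A * (eb B - eb A)"
    and Cb: "eb C = ed A * (eb B - eb A) - eb A * (ed B - ed A)"
    and Cc: "ec C = ea A * (ec B - ec A) - ec A * (ea B - ea A)"
    using sl2_det[of A] by (simp_all add: C_def algebra_simps)
  have b: "\<bar>ea C - 1\<bar> \<le> 2 * (K * \<epsilon>)" "\<bar>ed C - 1\<bar> \<le> 2 * (K * \<epsilon>)" "\<bar>eb C\<bar> \<le> 2 * (K * \<epsilon>)" "\<bar>ec C\<bar> \<le> 2 * (K * \<epsilon>)"
    unfolding Ca Cd Cb Cc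
    using d4 by (auto intro!: tri eA)
  have Ke: "K * \<epsilon> \<le> 1/8" "K * \<epsilon> \<le> sqrt (2 * cosh r - 2) / 16"
  proof -
    have "K * \<epsilon> \<le> K * (1 / (8 * K))" using K by (intro mult_left_mono) (auto simp: \<epsilon>_def)
    then show "K * \<epsilon> \<le> 1/8" using K by simp
    have "K * \<epsilon> \<le> K * (sqrt (2 * cosh r - 2) / (16 * K))" using K by (intro mult_left_mono) (auto simp: \<epsilon>_def)
    then show "K * \<epsilon> \<le> sqrt (2 * cosh r - 2) / 16" using K by simp
  qed
  have "hyp_dist \<i> (mob C \<i>) < r"
  proof -
    define s where "s = sqrt (2 * cosh r - 2)"
    have s: "s > 0" "s\<^sup>2 = 2 * cosh r - 2" using cr by (auto simp: s_def)
    have "\<bar>ea C - ed C\<bar> \<le> s / 4" "\<bar>eb C + ec C\<bar> \<le> s / 4" using b Ke(2) unfolding s_def by linarith+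
    then have "(ea C - ed C)\<^sup>2 \<le> (s/4)\<^sup>2" "(eb C + ec C)\<^sup>2 \<le> (s/4)\<^sup>2" by (simp_all add: abs_le_square_iff[symmetric])
    then have "2 * cosh (hyp_dist \<i> (mob C \<i>)) - 2 \<le> 2 * (s/4)\<^sup>2" using cosh_disp_ii'[of C] by linarith
    also have "\<dots> < s\<^sup>2" using s(1) by (simp add: power_divide)
    finally have "cosh (hyp_dist \<i> (mob C \<i>)) < cosh r" using s(2) by simp
    then show ?thesis using hyp_dist_nonneg[of \<i> "mob C \<i>"] r(1) by (simp add: cosh_real_nonneg_less_iff)
  qed
  then have "triv C" using r(2) CG by blast
  moreover have "ea C > 0" using b(1) Ke(1) by linarith
  ultimately have "C = 1" unfolding triv_def by auto
  then have "A = B" using minv_right_assoc[of A B] by (simp add: C_def)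
  then show False using xy AB by simp
qed

end

definition thick :: "sl2 set \<Rightarrow> real \<Rightarrow> complex \<Rightarrow> bool" where
  "thick G c z \<longleftrightarrow> (\<forall>A\<in>G. \<not> triv A \<longrightarrow> c \<le> hyp_dist z (mob A z))"

section \<open>Distances on the surface compared with distances in the half plane\<close>

definition chain_sum :: "('a \<Rightarrow> 'a \<Rightarrow> real) \<Rightarrow> (real \<Rightarrow> 'a) \<Rightarrow> real list \<Rightarrow> real" where
  "chain_sum d c ts = (\<Sum>i<length ts - 1. d (c (ts ! i)) (c (ts ! Suc i)))"

lemma chain_sum_Cons: "ts \<noteq> [] \<Longrightarrow> chain_sum d c (t # ts) = d (c t) (c (hd ts)) + chain_sum d c ts"
proof -
  assume "ts \<noteq> []"
  then obtain m where m: "length ts = Suc m" by (cases ts) auto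
  show ?thesis unfolding chain_sum_def using m \<open>ts \<noteq> []\<close>
    by (simp add: sum.lessThan_Suc_shift hd_conv_nth del: sum.lessThan_Suc)
qed

lemma chain_sum_append:
  assumes "us \<noteq> []"
  shows "ts \<noteq> [] \<Longrightarrow> chain_sum d c (ts @ us) = chain_sum d c ts + d (c (last ts)) (c (hd us)) + chain_sum d c us"
proof (induction ts)
  case (Cons t ts)
  show ?case
  proof (cases "ts = []")
    case True
    then show ?thesis using assms chain_sum_Cons[of us d c t] by (simp add: chain_sum_def)
  next
    case False
    then show ?thesis using Cons.IH chain_sum_Cons[of ts d c t] chain_sum_Cons[of "ts @ us" d c t] by simp
  qed
qed simp

context dsurf
begin

text \<open>The distance from \<open>z\<close> to the fibre over \<open>q\<close>. Arbitrary curves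
  are not lifted; instead this distance is followed along the curve, where it grows no faster than
  length.\<close>

definition fibdist :: "complex \<Rightarrow> 'a \<Rightarrow> real" where
  "fibdist z q = Inf {hyp_dist z w | w. Im w > 0 \<and> P w = q}"

lemma fibdist_le: "Im z > 0 \<Longrightarrow> Im w > 0 \<Longrightarrow> fibdist z (P w) \<le> hyp_dist z w"
  unfolding fibdist_def by (rule cInf_lower) (auto intro!: bdd_belowI[of _ 0] hyp_dist_nonneg)

lemma fibdist_nonneg: "Im z > 0 \<Longrightarrow> q \<in> M \<Longrightarrow> fibdist z q \<ge> 0"
  unfolding fibdist_def using P_surj[of q] by (intro cInf_greatest) (auto intro: hyp_dist_nonneg)

lemma fibdist_local_lipschitz:
  assumes z: "Im z > 0" and p: "p \<in> M"
  obtains \<delta> where "\<delta> > 0" "\<And>q q'. q \<in> M \<Longrightarrow> q' \<in> M \<Longrightarrow> d q p < \<delta> \<Longrightarrow> d q' p < \<delta> \<Longrightarrow> fibdist z q' \<le> fibdist z q + d q q'"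
proof -
  obtain \<delta> where \<delta>: "\<delta> > 0" "\<And>z q. Im z > 0 \<Longrightarrow> q \<in> M \<Longrightarrow> d (P z) p < \<delta> \<Longrightarrow> d q p < \<delta> \<Longrightarrow>
      \<exists>w. Im w > 0 \<and> P w = q \<and> hyp_dist z w = d (P z) q" using P_section[OF p] by blast
  have "fibdist z q' \<le> fibdist z q + d q q'" if q: "q \<in> M" "q' \<in> M" "d q p < \<delta>" "d q' p < \<delta>" for q q'
  proof -
    have "fibdist z q' - d q q' \<le> fibdist z q"
      unfolding fibdist_def[of z q]
    proof (rule cInf_greatest)
      show "{hyp_dist z w |w. 0 < Im w \<and> P w = q} \<noteq> {}" using P_surj[OF q(1)] by blast
      fix x assume "x \<in> {hyp_dist z w |w. 0 < Im w \<and> P w = q}"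
      then obtain w where w: "x = hyp_dist z w" "Im w > 0" "P w = q" by blast
      obtain w' where w': "Im w' > 0" "P w' = q'" "hyp_dist w w' = d q q'" using \<delta>(2)[OF w(2) q(2)] q w(3) by blast
      have "fibdist z q' \<le> hyp_dist z w'" using fibdist_le[OF z w'(1)] w'(2) by simp
      also have "\<dots> \<le> hyp_dist z w + hyp_dist w w'" by (rule hyp_dist_triangle[OF z w(2) w'(1)])
      finally show "fibdist z q' - d q q' \<le> x" using w w' by simp
    qed
    then show ?thesis by simp
  qed
  then show ?thesis using that \<delta>(1) by blast
qed

text \<open>Bisection with the partition carried along as a witness: near each parameter the two
  point partition is enough by the local Lipschitz property, and partitions of adjacent intervals
  are concatenated.\<close>

lemma fibdist_le_curve_length:
  assumes z: "Im z > 0" and c: "continuous_map (top_of_set {0..1}) mtopology c"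
  shows "ereal (fibdist z (c 1) - fibdist z (c 0)) \<le> curve_length d c 0 1"
proof -
  have cM: "c t \<in> M" if "0 \<le> t" "t \<le> 1" for t
    using continuous_map_image_subset_topspace[OF c] that by auto
  define Q where "Q a b \<longleftrightarrow> (0 \<le> a \<longrightarrow> a \<le> b \<longrightarrow> b \<le> 1 \<longrightarrow> (\<exists>ts. ts \<noteq> [] \<and> sorted ts \<and> set ts \<subseteq> {a..b} \<and> hd ts = a \<and> last ts = b \<and>
     fibdist z (c b) - fibdist z (c a) \<le> chain_sum d c ts))" for a b :: real
  have "Q 0 1"
  proof (rule Bolzano)
    fix a b e assume Q: "Q a b" "Q b e" and ab: "a \<le> b" "b \<le> e"
    show "Q a e"
      unfolding Q_def
    proof (intro impI)
      assume ae: "0 \<le> a" "a \<le> e" "e \<le> 1"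
      obtain ts where ts: "ts \<noteq> []" "sorted ts" "set ts \<subseteq> {a..b}" "hd ts = a" "last ts = b"
        "fibdist z (c b) - fibdist z (c a) \<le> chain_sum d c ts" using Q(1) ab ae unfolding Q_def by auto
      obtain us where us: "us \<noteq> []" "sorted us" "set us \<subseteq> {b..e}" "hd us = b" "last us = e"
        "fibdist z (c e) - fibdist z (c b) \<le> chain_sum d c us" using Q(2) ab ae unfolding Q_def by auto
      \<comment> \<open>The common endpoint \<open>b\<close> occurs twice in \<open>ts @ us\<close>;
        the step between its two copies has length 0.\<close>
      have "chain_sum d c (ts @ us) = chain_sum d c ts + chain_sum d c us"
        using chain_sum_append[OF us(1) ts(1), of d c] ts(5) us(4) cM[of b] ab ae by simp
      moreover have "sorted (ts @ us)" using ts(2,3) us(2,3) by (fastforce simp: sorted_append)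
      moreover have "set (ts @ us) \<subseteq> {a..e}" using ts(3) us(3) ab by fastforce
      ultimately show "\<exists>ts. ts \<noteq> [] \<and> sorted ts \<and> set ts \<subseteq> {a..e} \<and> hd ts = a \<and> last ts = e \<and>
          fibdist z (c e) - fibdist z (c a) \<le> chain_sum d c ts"
        using ts us by (intro exI[of _ "ts @ us"]) simp
    qed
  next
    fix x :: real assume x: "0 \<le> x" "x \<le> 1"
    obtain \<delta> where \<delta>: "\<delta> > 0" "\<And>q q'. q \<in> M \<Longrightarrow> q' \<in> M \<Longrightarrow> d q (c x) < \<delta> \<Longrightarrow> d q' (c x) < \<delta> \<Longrightarrow> fibdist z q' \<le> fibdist z q + d q q'"
      using fibdist_local_lipschitz[OF z cM[OF x]] by blast
    have "openin (top_of_set {0..1}) {t \<in> topspace (top_of_set {0..1}). c t \<in> mball (c x) \<delta>}"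
      by (rule openin_continuous_map_preimage[OF c openin_mball])
    then obtain T where T: "open T" "{t \<in> {0..1}. c t \<in> mball (c x) \<delta>} = {0..1} \<inter> T" by (auto simp: openin_open)
    have "x \<in> {t \<in> {0..1}. c t \<in> mball (c x) \<delta>}" using x cM[OF x] \<delta>(1) by simp
    then have "x \<in> T" using T(2) by blast
    then obtain e where e: "e > 0" "ball x e \<subseteq> T" using T(1) open_contains_ball by blast
    have near: "c t \<in> M \<and> d (c t) (c x) < \<delta>" if "0 \<le> t" "t \<le> 1" "\<bar>t - x\<bar> < e" for t
    proof -
      have "t \<in> T" using e(2) that by (auto simp: dist_real_def)
      then have "t \<in> {t \<in> {0..1}. c t \<in> mball (c x) \<delta>}" unfolding T(2) using that by simp
      then have "c t \<in> mball (c x) \<delta>" by blast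
      then show ?thesis by (simp add: commute)
    qed
    have "Q a b" if ab: "a \<le> x" "x \<le> b" "b - a < e" for a b
      unfolding Q_def
    proof (intro impI exI conjI)
      assume "0 \<le> a" "a \<le> b" "b \<le> 1"
      then have "fibdist z (c b) \<le> fibdist z (c a) + d (c a) (c b)"
        using near[of a] near[of b] ab by (intro \<delta>(2)) auto
      then show "fibdist z (c b) - fibdist z (c a) \<le> chain_sum d c [a, b]" by (simp add: chain_sum_def)
    qed auto
    then show "\<exists>e>0. \<forall>a b. a \<le> x \<and> x \<le> b \<and> b - a < e \<longrightarrow> Q a b" using e(1) by blast
  qed simp
  then obtain ts where ts: "sorted ts" "set ts \<subseteq> {0..1}" "fibdist z (c 1) - fibdist z (c 0) \<le> chain_sum d c ts"
    unfolding Q_def by auto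
  have "ereal (chain_sum d c ts) \<le> curve_length d c 0 1"
    unfolding curve_length_def chain_sum_def by (rule SUP_upper) (use ts in simp)
  then show ?thesis using ts(3) ereal_less_eq(3) order_trans by blast
qed

text \<open>Here \<open>length_metric\<close> is used: the bound holds for the length of every curve
  from \<open>P z\<close> to \<open>q\<close>, hence for the infimum of these lengths, which is the
  distance.\<close>

lemma fibdist_le_dist:
  assumes z: "Im z > 0" and q: "q \<in> M"
  shows "fibdist z q \<le> d (P z) q"
proof -
  have "fibdist z (P z) = 0" using fibdist_le[OF z z] fibdist_nonneg[OF z P_in_M[OF z]] by simp
  then have "ereal (fibdist z q) \<le> curve_length d c 0 1"
    if "continuous_map (top_of_set {0..1}) mtopology c" "c 0 = P z" "c 1 = q" for c
    using fibdist_le_curve_length[OF z that(1)] that(2,3) by simp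
  then have "ereal (fibdist z q) \<le> ereal (d (P z) q)"
    using lengthm P_in_M[OF z] q unfolding length_metric_def by (auto intro!: INF_greatest)
  then show ?thesis by simp
qed

lemma dist_lift:
  assumes z: "Im z > 0" and q: "q \<in> M" and e: "e > 0"
  shows "\<exists>w. Im w > 0 \<and> P w = q \<and> hyp_dist z w < d (P z) q + e"
proof -
  have "Inf {hyp_dist z w | w. Im w > 0 \<and> P w = q} < d (P z) q + e"
    using fibdist_le_dist[OF z q] e unfolding fibdist_def by linarith
  then show ?thesis using cInf_lessD[of "{hyp_dist z w | w. Im w > 0 \<and> P w = q}"] P_surj[OF q] by fastforce
qed

text \<open>Another lift of \<open>P v\<close> is the image of \<open>v\<close> under an element
  that moves \<open>z\<close> by at least \<open>4 * k\<close>; by the triangle inequality it is at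
  least \<open>2 * k\<close> away from \<open>u\<close>, whereas \<open>v\<close> is closer than
  that. Thus the nearest lift is \<open>v\<close> itself.\<close>

lemma P_isometric_thick:
  assumes z: "Im z > 0" and thick: "thick Gam (4 * k) z"
    and u: "u \<in> hball z k" and v: "v \<in> hball z k"
  shows "d (P u) (P v) = hyp_dist u v"
proof -
  have up: "Im u > 0" and vp: "Im v > 0" using u v hball_pos by blast+
  have "hyp_dist u v \<le> d (P u) (P v) + e" if e: "e > 0" for e
  proof -
    obtain w where w: "Im w > 0" "P w = P v" "hyp_dist u w < d (P u) (P v) + e"
      using dist_lift[OF up P_in_M[OF vp] e] by blast
    obtain A where A: "A \<in> Gam" "mob A v = w" using deck[OF vp w(1)] w(2) by auto
    have "hyp_dist u v \<le> hyp_dist u w"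
    proof (cases "triv A")
      case True then show ?thesis using A(2) triv_mob by simp
    next
      case False
      have "4 * k \<le> hyp_dist z (mob A z)" using thick A(1) False by (simp add: thick_def)
      also have "\<dots> \<le> hyp_dist z u + hyp_dist u (mob A z)" by (rule hyp_dist_triangle) (use z up in auto)
      also have "hyp_dist u (mob A z) \<le> hyp_dist u w + hyp_dist w (mob A z)" by (rule hyp_dist_triangle) (use z w up in auto)
      also have "hyp_dist w (mob A z) = hyp_dist v z" using A(2) vp z by auto
      finally have "2 * k \<le> hyp_dist u w" using u v by (simp add: hball_def hyp_dist_commute)
      moreover have "hyp_dist u v \<le> hyp_dist u z + hyp_dist z v" by (rule hyp_dist_triangle) (use z up vp in auto)
      ultimately show ?thesis using u v by (simp add: hball_def hyp_dist_commute)
    qed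
    then show ?thesis using w(3) by simp
  qed
  then have "hyp_dist u v \<le> d (P u) (P v)" by (rule field_le_epsilon)
  then show ?thesis using P_lipschitz[OF up vp] by simp
qed

lemma P_chart_thick:
  assumes z: "Im z > 0" and thick: "thick Gam (4 * k) z"
  shows "isometric_chart M d (P ` hball z k) (inv_into (hball z k) P)"
    and "inv_into (hball z k) P ` (P ` hball z k) = hball z k"
proof -
  let ?B = "hball z k"
  have inj: "inj_on P ?B"
  proof (rule inj_onI)
    fix u v assume uv: "u \<in> ?B" "v \<in> ?B" "P u = P v"
    then have "hyp_dist u v = 0" using P_isometric_thick[OF z thick, of u v] P_in_M[of v] hball_pos[of v] by simp
    then show "u = v" using hyp_dist_eq_0 uv hball_pos by blast
  qed
  then have inv: "inv_into ?B P (P u) = u" if "u \<in> ?B" for u using that by simp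
  show im: "inv_into ?B P ` (P ` ?B) = ?B" using inv by (auto simp: image_image)
  have op: "openin mtopology (P ` ?B)"
    unfolding openin_mtopology
  proof (intro conjI allI impI)
    show "P ` ?B \<subseteq> M" using P_in_M hball_pos by blast
    fix p assume "p \<in> P ` ?B"
    then obtain u where u: "u \<in> ?B" "p = P u" by blast
    have up: "Im u > 0" using u hball_pos by blast
    have pM: "p \<in> M" using P_in_M[OF up] u by simp
    obtain s where s: "s > 0" "hball u s \<subseteq> ?B" using hball_in_open[OF up open_hball[OF z] u(1)] by blast
    obtain \<delta> where \<delta>: "\<delta> > 0" "\<And>z q. Im z > 0 \<Longrightarrow> q \<in> M \<Longrightarrow> d (P z) p < \<delta> \<Longrightarrow> d q p < \<delta> \<Longrightarrow>
      \<exists>w. Im w > 0 \<and> P w = q \<and> hyp_dist z w = d (P z) q" using P_section[OF pM] by blast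
    have "mball p (min \<delta> s) \<subseteq> P ` ?B"
    proof
      fix q assume q: "q \<in> mball p (min \<delta> s)"
      then obtain w where w: "Im w > 0" "P w = q" "hyp_dist u w = d (P u) q"
        using \<delta>(2)[OF up, of q] u(2) pM \<delta>(1) by (auto simp: commute)
      have "w \<in> hball u s" using w q u(2) by (simp add: hball_def)
      then show "q \<in> P ` ?B" using w(2) s(2) by blast
    qed
    then show "\<exists>r>0. mball p r \<subseteq> P ` ?B" using \<delta>(1) s(1) by (intro exI[of _ "min \<delta> s"]) auto
  qed
  show "isometric_chart M d (P ` ?B) (inv_into ?B P)"
    unfolding isometric_chart_def im
  proof (intro conjI ballI)
    show "?B \<subseteq> upper_half_plane" using hball_pos by (auto simp: upper_half_plane_def)
    fix x y assume "x \<in> P ` ?B" "y \<in> P ` ?B"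
    then obtain u v where "x = P u" "y = P v" "u \<in> ?B" "v \<in> ?B" by blast
    then show "hyp_dist (inv_into ?B P x) (inv_into ?B P y) = d x y"
      using inv P_isometric_thick[OF z thick, of u v] by simp
  qed (use op z in auto)
qed

end

text \<open>A Euclidean square about \<open>z\<close> of side \<open>2 * \<rho> * Im z\<close> lies
  within distance \<open>3 * \<rho> < k\<close>, and on it the density is at least
  \<open>1 / (4 * (Im z)\<^sup>2)\<close>. What matters is that the bound does not depend on
  \<open>z\<close>.\<close>

lemma hyp_area_hball_ge:
  assumes z: "Im z > 0" and k: "k > 0"
  defines "\<rho> \<equiv> min (1/2) (k/4)"
  shows "hyp_area (hball z k) \<ge> ennreal (\<rho>\<^sup>2)"
proof -
  define y where "y = Im z"
  have y: "y > 0" using z by (simp add: y_def)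
  have \<rho>: "0 < \<rho>" "\<rho> \<le> 1/2" "\<rho> \<le> k/4" using k by (auto simp: \<rho>_def)
  let ?a = "Complex (Re z - \<rho> * y) (y - \<rho> * y)" and ?b = "Complex (Re z + \<rho> * y) (y + \<rho> * y)"
  have ry: "\<rho> * y \<le> y / 2" "\<rho> * y > 0" using \<rho> y by auto
  have box: "w \<in> hball z k \<and> 1 / (Im w)\<^sup>2 \<ge> 1 / (4 * y\<^sup>2)" if "w \<in> cbox ?a ?b" for w
  proof -
    have w: "\<bar>Re z - Re w\<bar> \<le> \<rho> * y" "\<bar>y - Im w\<bar> \<le> \<rho> * y"
      using that by (auto simp: in_cbox_complex_iff)
    then have wi: "Im w \<ge> y / 2" "Im w \<le> 2 * y" using ry y by linarith+
    then have wp: "Im w > 0" using y by linarith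
    have "cmod (z - w) \<le> \<bar>Re (z - w)\<bar> + \<bar>Im (z - w)\<bar>" by (rule cmod_le)
    also have "\<dots> \<le> 2 * (\<rho> * y)" using w by (simp add: y_def)
    finally have cm: "cmod (z - w) \<le> 2 * (\<rho> * y)" .
    have "Im z * Im w \<ge> (y * y) / 2" using wi y by (simp add: y_def)
    moreover have "(2/3 * y)\<^sup>2 = 4/9 * (y * y)" by (simp add: power2_eq_square)
    ultimately have "(2/3 * y)\<^sup>2 \<le> Im z * Im w" using zero_le_square[of y] by linarith
    then have sq: "2/3 * y \<le> sqrt (Im z * Im w)" by (intro real_le_rsqrt)
    have "hyp_dist z w \<le> cmod (z - w) / sqrt (Im z * Im w)" by (rule hyp_dist_le_euclid[OF z wp])
    also have "\<dots> \<le> 2 * (\<rho> * y) / (2/3 * y)" using cm sq y \<rho> by (intro frac_le) auto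
    also have "\<dots> = 3 * \<rho>" using y by simp
    also have "\<dots> < k" using \<rho> k by simp
    finally have "w \<in> hball z k" using wp by (simp add: hball_def)
    moreover have "(Im w)\<^sup>2 \<le> 4 * y\<^sup>2" using wi wp power_mono[of "Im w" "2 * y" 2] by (simp add: power_mult_distrib)
    then have "1 / (4 * y\<^sup>2) \<le> 1 / (Im w)\<^sup>2" using wp y by (intro divide_left_mono) auto
    ultimately show ?thesis by blast
  qed
  have "ennreal (\<rho>\<^sup>2) = ennreal (1 / (4 * y\<^sup>2)) * emeasure lborel (cbox ?a ?b)"
  proof -
    have "emeasure lborel (cbox ?a ?b) = ennreal ((2 * (\<rho> * y)) * (2 * (\<rho> * y)))"
      using ry by (subst emeasure_lborel_cbox) (auto simp: Basis_complex_def complex_eq_iff inner_complex_def)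
    moreover have "ennreal (1 / (4 * y\<^sup>2)) * ennreal ((2 * (\<rho> * y)) * (2 * (\<rho> * y))) = ennreal (1 / (4 * y\<^sup>2) * ((2 * (\<rho> * y)) * (2 * (\<rho> * y))))"
      using y \<rho>(1) by (intro ennreal_mult[symmetric]) auto
    moreover have "1 / (4 * y\<^sup>2) * ((2 * (\<rho> * y)) * (2 * (\<rho> * y))) = \<rho>\<^sup>2" using y by (simp add: power2_eq_square field_simps)
    ultimately show ?thesis by simp
  qed
  also have "\<dots> = (\<integral>\<^sup>+w. ennreal (1 / (4 * y\<^sup>2)) * indicator (cbox ?a ?b) w \<partial>lborel)"
    by (simp add: nn_integral_cmult_indicator)
  also have "\<dots> \<le> (\<integral>\<^sup>+w\<in>hball z k. ennreal (1 / (Im w)\<^sup>2) \<partial>lborel)"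
    by (intro nn_integral_mono) (use box in \<open>auto simp: indicator_def intro!: ennreal_leI\<close>)
  finally show ?thesis by (simp add: hyp_area_def)
qed

context dsurf
begin

text \<open>A packing argument. If thick points reached arbitrarily far from the orbit of
  \<open>\<i>\<close>, they could be chosen one after another far from all earlier orbits; the balls
  of radius \<open>c / 4\<close> around them embed disjointly in the surface, and their areas are
  bounded below.\<close>

lemma thick_cobounded:
  assumes area: "surface_area M d < \<infinity>" and c: "c > 0"
  shows "\<exists>D. \<forall>z. Im z > 0 \<longrightarrow> thick Gam c z \<longrightarrow> (\<exists>A\<in>Gam. hyp_dist \<i> (mob A z) \<le> D)"
proof (rule ccontr)
  assume neg: "\<not> ?thesis"
  define k where "k = c / 4"
  have k: "k > 0" "4 * k = c" using c by (auto simp: k_def)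
  define sep where "sep Z \<longleftrightarrow> finite Z \<and> (\<forall>z\<in>Z. Im z > 0 \<and> thick Gam c z) \<and>
      (\<forall>z\<in>Z. \<forall>w\<in>Z. z \<noteq> w \<longrightarrow> (\<forall>A\<in>Gam. 2 * k \<le> hyp_dist z (mob A w)))" for Z
  have ex: "\<exists>Z. sep Z \<and> card Z = n" for n
  proof (induction n)
    case 0 show ?case by (intro exI[of _ "{}"]) (simp add: sep_def)
  next
    case (Suc n)
    then obtain Z where Z: "sep Z" "card Z = n" by blast
    \<comment> \<open>The margin \<open>2 * k\<close> beyond all earlier points keeps the whole
      orbit of the new point at distance at least \<open>2 * k\<close> from them.\<close>
    define D where "D = Max (insert 0 ((\<lambda>z. hyp_dist \<i> z) ` Z)) + 2 * k"
    have fin: "finite Z" using Z by (simp add: sep_def)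
    have D: "hyp_dist \<i> z + 2 * k \<le> D" if "z \<in> Z" for z
      using that fin unfolding D_def by (intro add_right_mono Max_ge) auto
    obtain w where w: "Im w > 0" "thick Gam c w" "\<And>A. A \<in> Gam \<Longrightarrow> D < hyp_dist \<i> (mob A w)"
      using neg by (meson not_le)
    have far: "2 * k \<le> hyp_dist z (mob A w)" if z: "z \<in> Z" and A: "A \<in> Gam" for z A
    proof -
      have "hyp_dist \<i> (mob A w) \<le> hyp_dist \<i> z + hyp_dist z (mob A w)"
        by (rule hyp_dist_triangle) (use w z Z in \<open>auto simp: sep_def\<close>)
      then show ?thesis using w(3)[OF A] D[OF z] by linarith
    qed
    have far': "2 * k \<le> hyp_dist w (mob A z)" if z: "z \<in> Z" and A: "A \<in> Gam" for z A
    proof -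
      have zp: "Im z > 0" using z Z by (auto simp: sep_def)
      have "hyp_dist w (mob A z) = hyp_dist (mob (minv A) w) (mob (minv A) (mob A z))"
        by (rule hyp_dist_mob[symmetric]) (use w zp in auto)
      also have "mob (minv A) (mob A z) = z" using zp by simp
      finally show ?thesis using far[OF z Gam_inv[OF A]] by (simp add: hyp_dist_commute)
    qed
    have "w \<notin> Z" using far[of w 1] Gam_one k by auto
    moreover have "sep (insert w Z)" using Z(1) w(1,2) far far' unfolding sep_def by auto
    ultimately show ?case using Z(2) fin by (intro exI[of _ "insert w Z"]) simp
  qed
  define a where "a = (min (1/2) (k/4))\<^sup>2"
  have a: "a > 0" using k by (simp add: a_def)
  have big: "ennreal (real n * a) \<le> surface_area M d" for n
  proof -
    obtain Z where Z: "sep Z" "card Z = n" using ex by blast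
    define T where "T z = (P ` hball z k, P ` hball z k, inv_into (hball z k) P)" for z
    have fin: "finite Z" using Z by (simp add: sep_def)
    have zp: "Im z > 0" and th: "thick Gam (4 * k) z" if "z \<in> Z" for z
      using that Z unfolding sep_def k(2) by auto
    have disj: "P ` hball z k \<inter> P ` hball w k = {}" if zw: "z \<in> Z" "w \<in> Z" "z \<noteq> w" for z w
    proof (rule ccontr)
      assume "P ` hball z k \<inter> P ` hball w k \<noteq> {}"
      then obtain u v where uv: "u \<in> hball z k" "v \<in> hball w k" "P v = P u" by fastforce
      have p: "Im u > 0" "Im v > 0" using uv hball_pos by blast+
      obtain A where A: "A \<in> Gam" "mob A v = u" using deck[OF p(2,1) uv(3)] by blast
      have "hyp_dist z (mob A w) \<le> hyp_dist z u + hyp_dist u (mob A w)"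
        by (rule hyp_dist_triangle) (use zp zw p in auto)
      also have "hyp_dist u (mob A w) = hyp_dist v w" using A(2) p zp[OF zw(2)] by auto
      finally have "hyp_dist z (mob A w) < 2 * k" using uv by (simp add: hball_def hyp_dist_commute)
      then show False using Z(1) zw A(1) unfolding sep_def by force
    qed
    have ne: "P z \<in> P ` hball z k" if "z \<in> Z" for z using zp[OF that] k by (intro imageI) simp
    have inj: "inj_on T Z"
    proof (rule inj_onI)
      fix z w assume zw: "z \<in> Z" "w \<in> Z" "T z = T w"
      show "z = w"
      proof (rule ccontr)
        assume "z \<noteq> w"
        then show False using disj[OF zw(1,2)] ne[OF zw(1)] zw(3) by (auto simp: T_def)
      qed
    qed
    have "(\<Sum>(E, U, \<phi>)\<in>T ` Z. hyp_area (\<phi> ` E)) = (\<Sum>z\<in>Z. hyp_area (hball z k))"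
      unfolding sum.reindex[OF inj] using P_chart_thick(2)[OF zp th] by (intro sum.cong) (auto simp: T_def)
    moreover have "(\<Sum>z\<in>Z. hyp_area (hball z k)) \<ge> (\<Sum>z\<in>Z. ennreal a)"
      using hyp_area_hball_ge[OF zp k(1)] unfolding a_def by (intro sum_mono) auto
    moreover have "(\<Sum>z\<in>Z. ennreal a) = ennreal (real n * a)"
      using a Z(2) by (simp add: ennreal_mult ennreal_of_nat_eq_real_of_nat)
    moreover have "(\<Sum>(E, U, \<phi>)\<in>T ` Z. hyp_area (\<phi> ` E)) \<le> surface_area M d"
      unfolding surface_area_def
    proof (rule SUP_upper, intro CollectI conjI ballI impI)
      show "finite (T ` Z)" using fin by simp
      fix p assume "p \<in> T ` Z"
      then obtain z where z: "z \<in> Z" "p = T z" by blast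
      have "open (hball z k)" using zp[OF z(1)] by simp
      then show "case p of (E, U, \<phi>) \<Rightarrow> isometric_chart M d U \<phi> \<and> E \<subseteq> U \<and> \<phi> ` E \<in> sets borel"
        using P_chart_thick[OF zp[OF z(1)] th[OF z(1)]] z(2) by (simp add: T_def)
    next
      fix p q assume pq: "p \<in> T ` Z" "q \<in> T ` Z" "p \<noteq> q"
      then obtain z w where zw: "z \<in> Z" "w \<in> Z" "p = T z" "q = T w" by blast
      then have "z \<noteq> w" using pq(3) by blast
      from disj[OF zw(1,2) this] show "fst p \<inter> fst q = {}" using zw(3,4) by (simp add: T_def)
    qed
    ultimately show ?thesis by (metis order_trans)
  qed
  obtain s where s: "surface_area M d = ennreal s" "s \<ge> 0" using area by (cases "surface_area M d") auto
  obtain n where n: "real n * a > s" using a reals_Archimedean3 by blast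
  then show False using big[of n] s by (simp add: ennreal_le_iff)
qed

end

section \<open>Torsion-free Fuchsian groups\<close>

text \<open>All that the remaining argument takes from the surface: a free discrete action, and
  finite area in the form of a cobounded thick part at every scale \<open>c\<close>.\<close>

locale fuchs =
  fixes G :: "sl2 set"
  assumes G_one: "1 \<in> G"
    and G_mult: "A \<in> G \<Longrightarrow> B \<in> G \<Longrightarrow> A * B \<in> G"
    and G_inv: "A \<in> G \<Longrightarrow> minv A \<in> G"
    and G_neg: "A \<in> G \<Longrightarrow> mneg A \<in> G"
    and G_free: "A \<in> G \<Longrightarrow> Im z > 0 \<Longrightarrow> mob A z = z \<Longrightarrow> triv A"
    and G_discrete: "finite {A \<in> G. hyp_dist \<i> (mob A \<i>) \<le> R}"
    and G_cobounded: "c > 0 \<Longrightarrow> \<exists>D. \<forall>z. Im z > 0 \<longrightarrow> thick G c z \<longrightarrow> (\<exists>A\<in>G. hyp_dist \<i> (mob A z) \<le> D)"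

section \<open>Traces, displacements and commutators near the identity\<close>

abbreviation disp :: "complex \<Rightarrow> sl2 \<Rightarrow> real" where
  "disp z A \<equiv> hyp_dist z (mob A z)"

definition tr :: "sl2 \<Rightarrow> real" where "tr A = ea A + ed A"

lemma tr_conj: "tr (B * A * minv B) = tr A"
proof -
  have "tr (B * A * minv B) = (ea B * ed B - eb B * ec B) * (ea A + ed A)"
    by (simp add: tr_def algebra_simps)
  then show ?thesis by (simp add: sl2_det tr_def)
qed

lemma tr_mneg [simp]: "tr (mneg A) = - tr A"
  by (simp add: tr_def)

lemma triv_mneg [simp]: "triv (mneg A) \<longleftrightarrow> triv A"
  by (simp add: triv_iff)

lemma triv_conj [simp]: "triv (B * A * minv B) \<longleftrightarrow> triv A"
proof -
  have 1: "triv (B * A * minv B)" if "triv A" for A B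
    using that by (auto simp: triv_def mneg_mult_left mneg_mult_right)
  have "minv B * (B * A * minv B) * minv (minv B) = A" by (simp add: mult.assoc)
  then show ?thesis using 1[of A B] 1[of "B * A * minv B" "minv B"] by metis
qed

text \<open>The fixed point equation is quadratic with discriminant
  \<open>(tr A)\<^sup>2 - 4\<close>; when this is negative, one of the two conjugate roots lies in
  the half plane.\<close>

lemma elliptic_fixes_point:
  assumes "\<bar>tr A\<bar> < 2" shows "\<exists>z. Im z > 0 \<and> mob A z = z"
proof -
  have t: "(tr A)\<^sup>2 < 4" using assms abs_square_less_1[of "tr A / 2"] by (simp add: power_divide)
  have c: "ec A \<noteq> 0"
  proof
    assume "ec A = 0"
    then have "ea A * ed A = 1" using sl2_det[of A] by simp
    then have "(tr A)\<^sup>2 = (ea A - ed A)\<^sup>2 + 4" by (simp add: tr_def power2_eq_square algebra_simps)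
    then show False using t zero_le_power2[of "ea A - ed A"] by linarith
  qed
  define z where "z = Complex ((ea A - ed A) / (2 * ec A)) (sqrt (4 - (tr A)\<^sup>2) / (2 * \<bar>ec A\<bar>))"
  have "Im z > 0" using t c by (simp add: z_def)
  moreover have "ed A - ea A = - 2 * ec A * Re z" using c by (simp add: z_def)
  moreover have "eb A = - ec A * (cmod z)\<^sup>2"
  proof -
    have "(cmod z)\<^sup>2 = ((ea A - ed A)\<^sup>2 + (4 - (tr A)\<^sup>2)) / (4 * (ec A)\<^sup>2)"
      using t by (simp add: cmod_power2 z_def power_divide power_mult_distrib add_divide_distrib)
    also have "(ea A - ed A)\<^sup>2 + (4 - (tr A)\<^sup>2) = - 4 * (eb A * ec A)"
      using sl2_det[of A] by (simp add: tr_def power2_eq_square algebra_simps)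
    finally show ?thesis using c by (simp add: power2_eq_square)
  qed
  ultimately show ?thesis using mob_fixed_iff by blast
qed

text \<open>Equals four times the square of \<open>sinh\<close> of half the displacement of
  \<open>\<i>\<close>, written as a polynomial in the entries.\<close>

definition near_sq :: "sl2 \<Rightarrow> real" where
  "near_sq A = (ea A - ed A)\<^sup>2 + (eb A + ec A)\<^sup>2"

lemma near_sq_disp: "near_sq A = 2 * cosh (disp \<i> A) - 2"
  using cosh_disp_ii'[of A] by (simp add: near_sq_def)

lemma near_sq_nonneg: "near_sq A \<ge> 0" by (simp add: near_sq_def)

lemma near_sq_tr: "(tr A)\<^sup>2 + (eb A - ec A)\<^sup>2 = 4 + near_sq A"
  using sl2_det[of A] by (simp add: near_sq_def tr_def power2_eq_square algebra_simps)

text \<open>In a frame at \<open>z\<close> the two sides differ by the square of the antisymmetric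
  part. The trace thus bounds the displacement of every point from below at once.\<close>

lemma disp_tr_bound:
  assumes z: "Im z > 0" shows "(tr A)\<^sup>2 \<le> 2 * cosh (disp z A) + 2"
proof -
  define B where "B = minv (frame z)"
  have "disp (mob B z) (B * A * minv B) = disp z A" by (rule disp_conj[OF z])
  moreover have "mob B z = \<i>" using mob_minv_frame[OF z] by (simp add: B_def)
  ultimately have "near_sq (B * A * minv B) = 2 * cosh (disp z A) - 2" using near_sq_disp by simp
  then have "(tr A)\<^sup>2 + (eb (B * A * minv B) - ec (B * A * minv B))\<^sup>2 = 2 * cosh (disp z A) + 2"
    using near_sq_tr[of "B * A * minv B"] tr_conj[of B A] by simp
  then show ?thesis using zero_le_power2[of "eb (B * A * minv B) - ec (B * A * minv B)"] by linarith
qed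

text \<open>Small \<open>near_sq\<close> alone does not bring a matrix near \<open>1\<close>, since
  rotations about \<open>\<i>\<close> have \<open>near_sq\<close> equal to 0. A trace of at least 2
  excludes them: by \<open>near_sq_tr\<close> it makes the antisymmetric part small as well.\<close>

lemma near_identity:
  assumes t: "tr A \<ge> 2" and e: "e \<ge> 0" "near_sq A \<le> e\<^sup>2"
  shows "\<bar>ea A - 1\<bar> \<le> e" "\<bar>ed A - 1\<bar> \<le> e" "\<bar>eb A\<bar> \<le> e" "\<bar>ec A\<bar> \<le> e"
proof -
  have t2: "(tr A)\<^sup>2 \<ge> 2\<^sup>2" using t by (intro power_mono) auto
  have ab: "\<bar>x\<bar> \<le> e" if "x\<^sup>2 \<le> e\<^sup>2" for x using that e(1) by (simp add: abs_le_square_iff[symmetric])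
  have bc: "\<bar>eb A - ec A\<bar> \<le> e" using near_sq_tr[of A] t2 e(2) by (intro ab) simp
  have bc': "\<bar>eb A + ec A\<bar> \<le> e" using e(2) zero_le_power2[of "ea A - ed A"] unfolding near_sq_def by (intro ab) linarith
  have ad: "\<bar>ea A - ed A\<bar> \<le> e" using e(2) zero_le_power2[of "eb A + ec A"] unfolding near_sq_def by (intro ab) linarith
  have "(tr A)\<^sup>2 \<le> 4 + e\<^sup>2" using near_sq_tr[of A] e(2) zero_le_power2[of "eb A - ec A"] by linarith
  also have "\<dots> \<le> (2 + e)\<^sup>2" using e(1) by (simp add: power2_eq_square algebra_simps)
  finally have "tr A \<le> 2 + e" by (rule power2_le_imp_le) (use e(1) in simp)
  then show "\<bar>ea A - 1\<bar> \<le> e" "\<bar>ed A - 1\<bar> \<le> e" "\<bar>eb A\<bar> \<le> e" "\<bar>ec A\<bar> \<le> e"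
    using t ad bc bc' unfolding tr_def abs_le_iff by linarith+
qed

lemma triv_if_near_sq_0:
  assumes "\<bar>tr A\<bar> \<ge> 2" "near_sq A \<le> 0" shows "triv A"
proof -
  have n: "near_sq A = 0" using assms near_sq_nonneg[of A] by simp
  then have 1: "ea A = ed A" "eb A + ec A = 0" by (auto simp: near_sq_def sum_power2_eq_zero_iff)
  have "(tr A)\<^sup>2 \<ge> 4" using power_mono[OF assms(1), of 2] by simp
  then have "(eb A - ec A)\<^sup>2 \<le> 0" using near_sq_tr[of A] n by linarith
  then have "eb A = ec A" by simp
  then show ?thesis using 1 by (simp add: triv_iff)
qed

definition comm :: "sl2 \<Rightarrow> sl2 \<Rightarrow> sl2" where "comm S T = S * T * minv S * minv T"

lemma comm_1: "comm S T = 1 \<Longrightarrow> S * T = T * S"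
proof -
  assume "comm S T = 1"
  then have "comm S T * T * S = T * S" by simp
  then show ?thesis by (simp add: comm_def mult.assoc)
qed

lemma comm_mneg [simp]: "comm (mneg S) T = comm S T" "comm S (mneg T) = comm S T"
proof -
  have "minv (mneg S) = mneg (minv S)" for S by (auto intro: sl2_eqI)
  then show "comm (mneg S) T = comm S T" "comm S (mneg T) = comm S T"
    by (simp_all add: comm_def mneg_mult_left mneg_mult_right)
qed

text \<open>With \<open>V = minv S * minv T\<close> one has
  \<open>comm S T - 1 = (S * T - T * S) * V\<close> as matrices, and \<open>S * T - T * S\<close> is
  bilinear in \<open>S - 1\<close> and \<open>T - 1\<close>; its entries are \<open>Wa\<close>,
  \<open>Wb\<close>, \<open>Wc\<close> and \<open>- Wa\<close>. These are at most
  \<open>4 * (e * e')\<close>, the entries of \<open>V\<close> at most 8, which gives the factor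
  \<open>64 = 2 * 4 * 8\<close>.\<close>

lemma comm_near_identity_aux:
  assumes e: "0 \<le> e" "e \<le> 1" "0 \<le> e'" "e' \<le> 1"
    and S: "\<bar>ea S - 1\<bar> \<le> e" "\<bar>ed S - 1\<bar> \<le> e" "\<bar>eb S\<bar> \<le> e" "\<bar>ec S\<bar> \<le> e"
    and T: "\<bar>ea T - 1\<bar> \<le> e'" "\<bar>ed T - 1\<bar> \<le> e'" "\<bar>eb T\<bar> \<le> e'" "\<bar>ec T\<bar> \<le> e'"
  shows "\<bar>ea (comm S T) - 1\<bar> \<le> 64 * (e * e')" "\<bar>ed (comm S T) - 1\<bar> \<le> 64 * (e * e')"
    "\<bar>eb (comm S T)\<bar> \<le> 64 * (e * e')" "\<bar>ec (comm S T)\<bar> \<le> 64 * (e * e')"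
proof -
  have pr: "\<bar>p * q\<bar> \<le> E * F" if "\<bar>p\<bar> \<le> E" "\<bar>q\<bar> \<le> F" for p q E F :: real
    using that by (simp add: abs_mult mult_mono)
  have add2: "\<bar>p + q\<bar> \<le> 2 * E" "\<bar>p - q\<bar> \<le> 2 * E" if "\<bar>p\<bar> \<le> E" "\<bar>q\<bar> \<le> E" for p q E :: real
    using that by linarith+
  define xa xb xc xd where "xa = ea S - 1" "xb = eb S" "xc = ec S" "xd = ed S - 1"
  define ya yb yc yd where "ya = ea T - 1" "yb = eb T" "yc = ec T" "yd = ed T - 1"
  note xy = xa_xb_xc_xd_def ya_yb_yc_yd_def
  have X: "\<bar>xa\<bar> \<le> e" "\<bar>xb\<bar> \<le> e" "\<bar>xc\<bar> \<le> e" "\<bar>xd\<bar> \<le> e" using S by (auto simp: xy)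
  have Y: "\<bar>ya\<bar> \<le> e'" "\<bar>yb\<bar> \<le> e'" "\<bar>yc\<bar> \<le> e'" "\<bar>yd\<bar> \<le> e'" using T by (auto simp: xy)
  define Wa Wb Wc where "Wa = xb * yc - yb * xc" "Wb = (xa - xd) * yb - (ya - yd) * xb" "Wc = xc * (ya - yd) - yc * (xa - xd)"
  note W_def = Wa_Wb_Wc_def
  have xad: "\<bar>xa - xd\<bar> \<le> 2 * e" "\<bar>ya - yd\<bar> \<le> 2 * e'" using add2(2) X Y by auto
  have Wa: "\<bar>Wa\<bar> \<le> 4 * (e * e')"
    using add2(2)[OF pr[OF X(2) Y(3)], of "yb * xc"] pr[OF Y(2) X(3)] e by (simp add: W_def mult.commute)
  have Wb: "\<bar>Wb\<bar> \<le> 4 * (e * e')"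
    using add2(2)[OF pr[OF xad(1) Y(2)], of "(ya - yd) * xb"] pr[OF xad(2) X(2)] e by (simp add: W_def mult.commute mult.left_commute)
  have Wc: "\<bar>Wc\<bar> \<le> 4 * (e * e')"
    using add2(2)[OF pr[OF X(3) xad(2)], of "yc * (xa - xd)"] pr[OF Y(3) xad(1)] e by (simp add: W_def mult.commute mult.left_commute)
  define V where "V = minv S * minv T"
  have S2: "\<bar>ea S\<bar> \<le> 2" "\<bar>ed S\<bar> \<le> 2" "\<bar>eb S\<bar> \<le> 2" "\<bar>ec S\<bar> \<le> 2" using S e by linarith+
  have T2: "\<bar>ea T\<bar> \<le> 2" "\<bar>ed T\<bar> \<le> 2" "\<bar>eb T\<bar> \<le> 2" "\<bar>ec T\<bar> \<le> 2" using T e by linarith+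
  have V: "\<bar>ea V\<bar> \<le> 8" "\<bar>eb V\<bar> \<le> 8" "\<bar>ec V\<bar> \<le> 8" "\<bar>ed V\<bar> \<le> 8"
    using add2(1)[OF pr[OF S2(2) T2(2)] pr[OF S2(3) T2(4)]] add2(1)[OF pr[OF S2(2) T2(3)] pr[OF S2(3) T2(1)]]
      add2(1)[OF pr[OF S2(4) T2(2)] pr[OF S2(1) T2(4)]] add2(1)[OF pr[OF S2(4) T2(3)] pr[OF S2(1) T2(1)]]
    by (simp_all add: V_def abs_minus_commute)
  have TSV: "T * S * V = 1" by (simp add: V_def mult.assoc)
  have K: "comm S T = S * T * V" by (simp add: comm_def V_def mult.assoc)
  have c: "ea (comm S T) - 1 = Wa * ea V + Wb * ec V" "eb (comm S T) = Wa * eb V + Wb * ed V"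
    "ec (comm S T) = Wc * ea V - Wa * ec V" "ed (comm S T) - 1 = Wc * eb V - Wa * ed V"
  proof -
    have "ea (T * S * V) = 1" "eb (T * S * V) = 0" "ec (T * S * V) = 0" "ed (T * S * V) = 1" using TSV by simp_all
    then show "ea (comm S T) - 1 = Wa * ea V + Wb * ec V" "eb (comm S T) = Wa * eb V + Wb * ed V"
    "ec (comm S T) = Wc * ea V - Wa * ec V" "ed (comm S T) - 1 = Wc * eb V - Wa * ed V"
      unfolding K W_def xy by (simp_all add: algebra_simps)
  qed
  have big: "\<bar>p * q + r * s\<bar> \<le> 64 * (e * e')" "\<bar>p * q - r * s\<bar> \<le> 64 * (e * e')"
    if "\<bar>p\<bar> \<le> 4 * (e * e')" "\<bar>r\<bar> \<le> 4 * (e * e')" "\<bar>q\<bar> \<le> 8" "\<bar>s\<bar> \<le> 8" for p q r s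
    using add2[OF pr[OF that(1,3)] pr[OF that(2,4)]] by simp_all
  show "\<bar>ea (comm S T) - 1\<bar> \<le> 64 * (e * e')" "\<bar>ed (comm S T) - 1\<bar> \<le> 64 * (e * e')"
    "\<bar>eb (comm S T)\<bar> \<le> 64 * (e * e')" "\<bar>ec (comm S T)\<bar> \<le> 64 * (e * e')"
    unfolding c by (intro big Wa Wb Wc V)+
qed

text \<open>The constant \<open>1/200\<close> is small enough for \<open>64/200 = 8/25\<close>: both
  squares in \<open>near_sq\<close> are then at most \<open>(16/25 * e)\<^sup>2\<close>, and
  \<open>2 * (16/25)\<^sup>2 < 1\<close>. Replacing \<open>S\<close> or \<open>T\<close> by its
  negative leaves the commutator unchanged, and the commutator is so close to \<open>1\<close> that
  trivial means equal to \<open>1\<close>.\<close>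

lemma comm_near_identity:
  assumes S: "\<bar>tr S\<bar> \<ge> 2" "\<not> triv S" "near_sq S \<le> (1/200)\<^sup>2" and T: "\<bar>tr T\<bar> \<ge> 2" "near_sq T \<le> (1/200)\<^sup>2"
  shows "near_sq (comm S T) < near_sq S \<and> (triv (comm S T) \<longrightarrow> S * T = T * S)"
proof -
  define S' where "S' = (if tr S \<ge> 2 then S else mneg S)"
  define T' where "T' = (if tr T \<ge> 2 then T else mneg T)"
  have nm: "near_sq (mneg A) = near_sq A" for A by (simp add: near_sq_def power2_eq_square algebra_simps)
  have K: "comm S' T' = comm S T" by (simp add: S'_def T'_def)
  have S': "tr S' \<ge> 2" "near_sq S' = near_sq S" using S(1) by (auto simp: S'_def nm)
  have T': "tr T' \<ge> 2" "near_sq T' \<le> (1/200)\<^sup>2" using T by (auto simp: T'_def nm)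
  define e where "e = sqrt (near_sq S)"
  have ns: "near_sq S > 0" using triv_if_near_sq_0[of S] S by force
  have e: "e > 0" "e\<^sup>2 = near_sq S" using ns by (auto simp: e_def)
  have e1: "e \<le> 1/200" using e S(3) by (intro power2_le_imp_le[of e "1/200"]) auto
  have e01: "0 \<le> e" "e \<le> 1" and q: "(0::real) \<le> 1/200" "(1/200::real) \<le> 1" using e(1) e1 by auto
  have "near_sq S' \<le> e\<^sup>2" using S'(2) e(2) by simp
  note SS = near_identity[OF S'(1) e01(1) this]
  note TT = near_identity[OF T'(1) q(1) T'(2)]
  have b: "\<bar>ea (comm S T) - 1\<bar> \<le> 64 * (e * (1/200))" "\<bar>ed (comm S T) - 1\<bar> \<le> 64 * (e * (1/200))"
    "\<bar>eb (comm S T)\<bar> \<le> 64 * (e * (1/200))" "\<bar>ec (comm S T)\<bar> \<le> 64 * (e * (1/200))"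
    by (rule comm_near_identity_aux[OF e01 q SS TT, unfolded K])+
  have "\<bar>ea (comm S T) - ed (comm S T)\<bar> \<le> 16/25 * e" "\<bar>eb (comm S T) + ec (comm S T)\<bar> \<le> 16/25 * e"
    using b by linarith+
  then have "(ea (comm S T) - ed (comm S T))\<^sup>2 \<le> (16/25 * e)\<^sup>2" "(eb (comm S T) + ec (comm S T))\<^sup>2 \<le> (16/25 * e)\<^sup>2"
    using e by (simp_all add: abs_le_square_iff[symmetric] abs_mult)
  then have "near_sq (comm S T) \<le> 2 * (16/25)\<^sup>2 * e\<^sup>2" unfolding near_sq_def power_mult_distrib[of "16/25" e] by linarith
  also have "\<dots> < e\<^sup>2" using e(1) by (simp add: power2_eq_square)
  finally have 1: "near_sq (comm S T) < near_sq S" using e by simp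
  have "ea (comm S T) > 0" using b(1) e1 e by linarith
  then have "S * T = T * S" if "triv (comm S T)"
    using that comm_1[of S T] by (auto simp: triv_def)
  then show ?thesis using 1 by blast
qed

text \<open>The equations say that the traceless parts, with coordinates \<open>ea - ed\<close>,
  \<open>eb\<close> and \<open>ec\<close>, are parallel. Commuting is therefore transitive through
  any element with nonzero traceless part, which is \<open>commute_trans\<close>.\<close>

lemma commute_iff:
  "A * B = B * A \<longleftrightarrow> eb A * ec B = eb B * ec A \<and> (ea A - ed A) * eb B = (ea B - ed B) * eb A \<and>
     (ea A - ed A) * ec B = (ea B - ed B) * ec A"
proof
  assume "A * B = B * A"
  then have "ea (A * B) = ea (B * A)" "eb (A * B) = eb (B * A)" "ec (A * B) = ec (B * A)" by simp_all
  then show "eb A * ec B = eb B * ec A \<and> (ea A - ed A) * eb B = (ea B - ed B) * eb A \<and>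
     (ea A - ed A) * ec B = (ea B - ed B) * ec A" by (simp add: algebra_simps)
next
  assume "eb A * ec B = eb B * ec A \<and> (ea A - ed A) * eb B = (ea B - ed B) * eb A \<and>
     (ea A - ed A) * ec B = (ea B - ed B) * ec A"
  then show "A * B = B * A" by (intro sl2_eqI) (auto simp: algebra_simps)
qed

lemma parallel_trans:
  fixes x1 x2 x3 y1 y2 y3 z1 z2 z3 :: real
  assumes "x1 \<noteq> 0 \<or> x2 \<noteq> 0 \<or> x3 \<noteq> 0"
    and "x1 * y2 = y1 * x2" "x1 * y3 = y1 * x3" "x2 * y3 = y2 * x3"
    and "x1 * z2 = z1 * x2" "x1 * z3 = z1 * x3" "x2 * z3 = z2 * x3"
  shows "y1 * z2 = z1 * y2" "y1 * z3 = z1 * y3" "y2 * z3 = z2 * y3"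
proof -
  have 1: "x1 * (y1 * z2) = x1 * (z1 * y2)" "x1 * (y1 * z3) = x1 * (z1 * y3)" "x1 * (y2 * z3) = x1 * (z2 * y3)"
    and 2: "x2 * (y1 * z2) = x2 * (z1 * y2)" "x2 * (y1 * z3) = x2 * (z1 * y3)" "x2 * (y2 * z3) = x2 * (z2 * y3)"
    and 3: "x3 * (y1 * z2) = x3 * (z1 * y2)" "x3 * (y1 * z3) = x3 * (z1 * y3)" "x3 * (y2 * z3) = x3 * (z2 * y3)"
    using assms(2-7) by algebra+
  show "y1 * z2 = z1 * y2" "y1 * z3 = z1 * y3" "y2 * z3 = z2 * y3"
    using assms(1) 1 2 3 by auto
qed

lemma commute_trans:
  assumes "\<not> triv S" "S * T = T * S" "S * T' = T' * S"
  shows "T * T' = T' * T"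
proof -
  have "ea S - ed S \<noteq> 0 \<or> eb S \<noteq> 0 \<or> ec S \<noteq> 0" using assms(1) by (auto simp: triv_iff)
  from parallel_trans[OF this, of "eb T" "ea T - ed T" "ec T" "eb T'" "ea T' - ed T'" "ec T'"]
  show ?thesis using assms(2,3) unfolding commute_iff by blast
qed

section \<open>Parabolic elements and cusps\<close>

definition nn :: "real \<Rightarrow> sl2" where "nn t = mk 1 t 0 1"

lemma nn_entries [simp]: "ea (nn t) = 1" "eb (nn t) = t" "ec (nn t) = 0" "ed (nn t) = 1"
  by (simp_all add: nn_def mk_entries)

lemma nn_add: "nn s * nn t = nn (s + t)" by (auto intro: sl2_eqI)
lemma minv_nn: "minv (nn t) = nn (- t)" by (auto intro: sl2_eqI)
lemma mob_nn: "mob (nn t) z = z + of_real t" by (simp add: mob_def)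
lemma nn_inj: "nn s = nn t \<longleftrightarrow> s = t" by (metis nn_entries(2))

lemma disp_nn_le: "disp \<i> (nn y) \<le> \<bar>y\<bar>"
  using hyp_dist_le_euclid[of \<i> "mob (nn y) \<i>"] by (simp add: mob_nn)

definition dg :: "real \<Rightarrow> sl2" where "dg x = mk x 0 0 (1 / x)"

lemma dg_entries: "x \<noteq> 0 \<Longrightarrow> ea (dg x) = x" "x \<noteq> 0 \<Longrightarrow> eb (dg x) = 0" "x \<noteq> 0 \<Longrightarrow> ec (dg x) = 0" "x \<noteq> 0 \<Longrightarrow> ed (dg x) = 1 / x"
  by (simp_all add: dg_def mk_entries)

lemma mob_dg: "x \<noteq> 0 \<Longrightarrow> mob (dg x) z = of_real (x\<^sup>2) * z"
  by (simp add: mob_def dg_entries power2_eq_square)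

lemma dg_nn: "x \<noteq> 0 \<Longrightarrow> dg x * nn t * minv (dg x) = nn (x\<^sup>2 * t)"
  by (intro sl2_eqI) (simp_all add: dg_entries power2_eq_square)

lemma parabolic_normal_form:
  assumes t: "tr A = 2" and nt: "\<not> triv A"
  shows "\<exists>m s. s \<noteq> 0 \<and> A = m * nn s * minv m"
proof (cases "ec A = 0")
  case True
  then have "ea A * ed A = 1" using sl2_det[of A] by simp
  moreover have "ed A = 2 - ea A" using t by (simp add: tr_def)
  ultimately have "(ea A - 1)\<^sup>2 = 0" by (simp add: power2_eq_square algebra_simps)
  then have a: "ea A = 1" "ed A = 1" using t by (auto simp: tr_def)
  then have "A = nn (eb A)" using True by (intro sl2_eqI) simp_all
  moreover have "eb A \<noteq> 0" using nt True a by (auto simp: triv_iff)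
  ultimately show ?thesis by (intro exI[of _ 1] exI[of _ "eb A"]) simp
next
  case False
  define p where "p = ea A - 1"
  have a: "ea A = 1 + p" "ed A = 1 - p" using t by (auto simp: p_def tr_def)
  have bc: "eb A * ec A = - p\<^sup>2" using sl2_det[of A] a by (simp add: power2_eq_square algebra_simps)
  then have b: "eb A = - p\<^sup>2 / ec A" using False by (simp add: field_simps)
  \<comment> \<open>\<open>m\<close> sends infinity to \<open>p / ec A\<close>, the only boundary
    point fixed by \<open>A\<close>.\<close>
  define m where "m = mk (p / ec A) (- 1) 1 0"
  have m: "ea m = p / ec A" "eb m = - 1" "ec m = 1" "ed m = 0" by (simp_all add: m_def mk_entries)
  have "m * nn (- ec A) * minv m = A"
    using False by (intro sl2_eqI) (simp_all add: m a b field_simps power2_eq_square)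
  then show ?thesis using False by (intro exI[of _ m] exI[of _ "- ec A"]) simp
qed

text \<open>\<open>m\<close> carries infinity to a cusp, scaled so that its primitive translation
  has width 1. The half plane above height 1 then covers a cusp region of area 1.\<close>

definition cusp_frame :: "sl2 set \<Rightarrow> sl2 \<Rightarrow> bool" where
  "cusp_frame G m \<longleftrightarrow> (\<forall>t. m * nn t * minv m \<in> G \<longleftrightarrow> t \<in> \<int>)"

lemma discrete_subgroup_cyclic:
  assumes add: "\<And>x y. x \<in> H \<Longrightarrow> y \<in> H \<Longrightarrow> x + y \<in> H" and neg: "\<And>x. x \<in> H \<Longrightarrow> - x \<in> H"
    and fin: "\<And>R. finite {x \<in> H. \<bar>x\<bar> \<le> R}" and t: "t \<in> H" "t \<noteq> (0::real)"
  shows "\<exists>s>0. \<forall>x. s * x \<in> H \<longleftrightarrow> x \<in> \<int>"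
proof -
  have tp: "\<bar>t\<bar> \<in> H" "\<bar>t\<bar> > 0" using t neg by (auto simp: abs_if)
  define K where "K = {x \<in> H. 0 < x \<and> x \<le> \<bar>t\<bar>}"
  have K: "finite K" "\<bar>t\<bar> \<in> K"
    using tp by (auto simp: K_def intro: finite_subset[OF _ fin[of "\<bar>t\<bar>"]])
  define s where "s = Min K"
  have s: "s \<in> K" using Min_in[OF K(1)] K(2) unfolding s_def by blast
  have sH: "s \<in> H" "s > 0" using s by (auto simp: K_def)
  have smin: "s \<le> x" if "x \<in> H" "0 < x" for x
  proof (cases "x \<le> \<bar>t\<bar>")
    case True then show ?thesis using that K(1) unfolding s_def by (intro Min_le) (auto simp: K_def)
  next
    case False then show ?thesis using s by (auto simp: K_def)
  qed
  have zero: "0 \<in> H" using add[OF t(1) neg[OF t(1)]] by simp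
  have nat: "s * real n \<in> H" for n
    by (induction n) (use zero sH add in \<open>auto simp: distrib_left\<close>)
  have int: "s * of_int k \<in> H" for k
  proof (cases "k \<ge> 0")
    case True then show ?thesis using nat[of "nat k"] by simp
  next
    case False then show ?thesis using neg[OF nat[of "nat (- k)"]] by simp
  qed
  have "x \<in> \<int>" if x: "s * x \<in> H" for x
  proof -
    have "s * x + - (s * of_int \<lfloor>x\<rfloor>) \<in> H" by (intro add x neg int)
    then have f: "s * frac x \<in> H" by (simp add: frac_def algebra_simps)
    have "frac x = 0"
    proof (rule ccontr)
      assume "frac x \<noteq> 0"
      then have "0 < s * frac x" using sH frac_ge_0[of x] by simp
      then have "s \<le> s * frac x" using smin f by blast
      then show False using frac_lt_1[of x] sH by simp
    qed
    then show ?thesis by (simp add: frac_eq_0_iff)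
  qed
  then show ?thesis using int sH by (intro exI[of _ s]) (auto elim!: Ints_cases)
qed

text \<open>Chosen so that \<open>2 * cosh margulis - 2 = (1/200)\<^sup>2\<close>, the bound on
  \<open>near_sq\<close> in \<open>comm_near_identity\<close>.\<close>

definition margulis :: real where "margulis = arcosh (1 + 1 / 80000)"

lemma margulis_pos: "margulis > 0" by (simp add: margulis_def)

section \<open>Thin points and the thick-thin decomposition\<close>

context fuchs
begin

lemma G_conj: "A \<in> G \<Longrightarrow> B \<in> G \<Longrightarrow> B * A * minv B \<in> G"
  using G_mult G_inv by blast

lemma tr_ge_2: "A \<in> G \<Longrightarrow> \<not> triv A \<Longrightarrow> \<bar>tr A\<bar> \<ge> 2"
  using elliptic_fixes_point[of A] G_free by fastforce

lemma finite_disp: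
  assumes "Im z > 0" shows "finite {A \<in> G. disp z A \<le> R}"
proof (rule finite_subset[OF _ G_discrete])
  have "disp \<i> A \<le> 2 * hyp_dist z \<i> + R" if "disp z A \<le> R" for A
    using disp_le[OF assms, of \<i> A] that by simp
  then show "{A \<in> G. disp z A \<le> R} \<subseteq> {A \<in> G. disp \<i> A \<le> 2 * hyp_dist z \<i> + R}" by blast
qed

lemma minimal_disp:
  assumes z: "Im z > 0" and A: "A \<in> G" "\<not> triv A"
  obtains S where "S \<in> G" "\<not> triv S" "disp z S \<le> disp z A" "thick G (disp z S) z"
proof -
  define K where "K = {B \<in> G. \<not> triv B \<and> disp z B \<le> disp z A}"
  have "K \<subseteq> {B \<in> G. disp z B \<le> disp z A}" by (auto simp: K_def)
  then have fin: "finite (disp z ` K)" using finite_disp[OF z] by (auto intro: finite_subset)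
  have ne: "disp z A \<in> disp z ` K" using A by (auto simp: K_def)
  have "Min (disp z ` K) \<in> disp z ` K" using Min_in[OF fin] ne by blast
  then obtain S where S: "S \<in> K" "Min (disp z ` K) = disp z S" by blast
  have le: "disp z S \<le> disp z B" if "B \<in> K" for B using Min_le[OF fin, of "disp z B"] S(2) that by auto
  have "thick G (disp z S) z"
    unfolding thick_def
  proof (intro ballI impI)
    fix B assume B: "B \<in> G" "\<not> triv B"
    show "disp z S \<le> disp z B"
    proof (cases "disp z B \<le> disp z A")
      case True then show ?thesis using le B by (auto simp: K_def)
    next
      case False then show ?thesis using S by (auto simp: K_def)
    qed
  qed
  then show ?thesis using that[of S] S(1) by (auto simp: K_def)
qed

lemma disp_pos: "Im z > 0 \<Longrightarrow> A \<in> G \<Longrightarrow> \<not> triv A \<Longrightarrow> disp z A > 0"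
  using G_free[of A z] hyp_dist_nonneg[of z "mob A z"] hyp_dist_eq_0[of z "mob A z"] by fastforce

lemma ex_thick:
  assumes z: "Im z > 0" shows "\<exists>r>0. thick G r z"
proof (cases "\<exists>A\<in>G. \<not> triv A")
  case True
  then obtain A where "A \<in> G" "\<not> triv A" by blast
  then obtain S where "S \<in> G" "\<not> triv S" "thick G (disp z S) z" using minimal_disp[OF z] by metis
  then show ?thesis using disp_pos[OF z] by blast
next
  case False then show ?thesis by (intro exI[of _ 1]) (auto simp: thick_def)
qed

text \<open>A one-step Margulis lemma: the commutator with an element of minimal displacement is displaced
  even less.\<close>

lemma small_commutes_minimal:
  assumes z: "Im z > 0" and S: "S \<in> G" "\<not> triv S" "thick G (disp z S) z" "disp z S < margulis"
    and T: "T \<in> G" "\<not> triv T" "disp z T < margulis"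
  shows "S * T = T * S"
proof -
  define B where "B = minv (frame z)"
  have Bz: "mob B z = \<i>" using mob_minv_frame[OF z] by (simp add: B_def)
  have db: "disp \<i> (B * A * minv B) = disp z A" for A using disp_conj[OF z, of B A] Bz by simp
  have ns: "near_sq (B * A * minv B) \<le> (1/200)\<^sup>2" if "disp z A < margulis" for A
  proof -
    have "cosh (disp z A) \<le> cosh margulis"
      using that hyp_dist_nonneg[of z "mob A z"] z by (subst cosh_mono_iff) auto
    then show ?thesis unfolding near_sq_disp db by (simp add: margulis_def power2_eq_square)
  qed
  have K: "comm (B * S * minv B) (B * T * minv B) = B * comm S T * minv B"
    by (simp add: comm_def minv_mult mult.assoc)
  have tr: "\<bar>tr (B * S * minv B)\<bar> \<ge> 2" "\<bar>tr (B * T * minv B)\<bar> \<ge> 2"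
    using tr_ge_2 S T by (simp_all add: tr_conj)
  have c: "near_sq (B * comm S T * minv B) < near_sq (B * S * minv B)"
    and c2: "triv (comm S T) \<longrightarrow> (B * S * minv B) * (B * T * minv B) = (B * T * minv B) * (B * S * minv B)"
    using comm_near_identity[OF tr(1) _ ns[OF S(4)] tr(2) ns[OF T(3)]] S(2) unfolding K by simp_all
  have "cosh (disp z (comm S T)) < cosh (disp z S)" using c unfolding near_sq_disp db by simp
  then have "disp z (comm S T) < disp z S"
    using hyp_dist_nonneg[of z "mob S z"] hyp_dist_nonneg[of z "mob (comm S T) z"] z by (simp add: cosh_real_nonneg_less_iff)
  moreover have "comm S T \<in> G" unfolding comm_def using S(1) T(1) by (intro G_mult G_inv)
  ultimately have "triv (comm S T)" using S(3) by (force simp: thick_def)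
  then have "B * (S * T) * minv B = B * (T * S) * minv B" using c2 by (simp add: mult.assoc)
  then have "minv B * (B * (S * T) * minv B) * B = minv B * (B * (T * S) * minv B) * B" by simp
  then show ?thesis by (simp add: mult.assoc)
qed

text \<open>Both elements commute with one of minimal displacement, and commuting passes through
  it.\<close>

lemma small_commute:
  assumes z: "Im z > 0" and S: "S \<in> G" "\<not> triv S" "disp z S < margulis"
    and T: "T \<in> G" "\<not> triv T" "disp z T < margulis"
  shows "S * T = T * S"
proof -
  obtain R where R: "R \<in> G" "\<not> triv R" "disp z R \<le> disp z S" "thick G (disp z R) z"
    using minimal_disp[OF z S(1,2)] by blast
  have "disp z R < margulis" using R(3) S(3) by simp
  then show ?thesis
    using commute_trans[OF R(2)] small_commutes_minimal[OF z R(1,2,4)] S T by metis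
qed

text \<open>Moving from a thin point towards a thick one, the small elements stay in one abelian subgroup
  until the first thick point is met.\<close>

lemma thin_path:
  assumes z: "Im z > 0" and S: "S \<in> G" "\<not> triv S" "disp z S < c" and c: "c \<le> margulis" and w: "Im w > 0" "thick G c w"
  shows "\<exists>q A. Im q > 0 \<and> thick G c q \<and> A \<in> G \<and> \<not> triv A \<and> A * S = S * A \<and> disp q A \<le> c + 2"
proof -
  define p where "p t = z + of_real t * (w - z)" for t :: real
  have Imp: "Im (p t) > 0" if "0 \<le> t" "t \<le> 1" for t
  proof -
    have "Im (p t) = (1 - t) * Im z + t * Im w" by (simp add: p_def algebra_simps)
    moreover have "(1 - t) * Im z + t * Im w > 0"
      using that z w(1) by (cases "t = 0") (auto intro: add_nonneg_pos)
    ultimately show ?thesis by simp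
  qed
  have contp: "isCont p t" for t unfolding p_def by (intro continuous_intros)
  have near: "\<exists>e>0. \<forall>s. \<bar>s - t\<bar> < e \<longrightarrow> p s \<in> hball (p t) r" if "Im (p t) > 0" "r > 0" for t r
  proof -
    have "\<forall>\<^sub>F s in nhds t. p s \<in> hball (p t) r"
      by (rule topological_tendstoD[of p "p t"]) (use contp that in \<open>auto simp: isCont_def tendsto_at_iff_tendsto_nhds\<close>)
    then show ?thesis unfolding eventually_nhds_metric dist_real_def by blast
  qed
  \<comment> \<open>Parameters with a small element that does (\<open>b = True\<close>) or does not
    (\<open>b = False\<close>) commute with \<open>S\<close>. Both sets are open, and they are
    disjoint by \<open>small_commute\<close>; at a limit point of \<open>U True\<close> outside it
    there is no small element of either kind.\<close>
  define U where "U b = {t. Im (p t) > 0 \<and> (\<exists>A\<in>G. \<not> triv A \<and> disp (p t) A < c \<and> (A * S = S * A) = b)}" for b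
  have opU: "open (U b)" for b
  proof (rule openI)
    fix t assume "t \<in> U b"
    then obtain A where A: "Im (p t) > 0" "A \<in> G" "\<not> triv A" "disp (p t) A < c" "(A * S = S * A) = b" by (auto simp: U_def)
    define r where "r = (c - disp (p t) A) / 2"
    have r: "r > 0" using A by (simp add: r_def)
    obtain e where e: "e > 0" "\<And>s. \<bar>s - t\<bar> < e \<Longrightarrow> p s \<in> hball (p t) r" using near[OF A(1) r] by blast
    have "ball t e \<subseteq> U b"
    proof
      fix s assume "s \<in> ball t e"
      then have s: "p s \<in> hball (p t) r" using e(2) by (simp add: dist_real_def abs_minus_commute)
      then have "disp (p s) A \<le> 2 * hyp_dist (p t) (p s) + disp (p t) A" using disp_le[OF A(1)] hball_pos by blast
      also have "\<dots> < c" using s by (simp add: hball_def r_def)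
      finally show "s \<in> U b" using A s hball_pos by (auto simp: U_def)
    qed
    then show "\<exists>e>0. ball t e \<subseteq> U b" using e(1) by blast
  qed
  have disjU: "U True \<inter> U False = {}"
  proof (rule ccontr)
    assume "U True \<inter> U False \<noteq> {}"
    then obtain t A B where t: "Im (p t) > 0" and A: "A \<in> G" "\<not> triv A" "disp (p t) A < c" "A * S = S * A"
      and B: "B \<in> G" "\<not> triv B" "disp (p t) B < c" "B * S \<noteq> S * B" by (auto simp: U_def)
    have "A * B = B * A" using small_commute[OF t A(1,2) _ B(1,2)] A(3) B(3) c by simp
    then have "B * S = S * B" using commute_trans[OF A(2), of B S] A(4) by simp
    then show False using B(4) by blast
  qed
  have 0: "0 \<in> U True" using S z by (auto simp: U_def p_def)
  have 1: "1 \<notin> U True"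
  proof
    assume "1 \<in> U True"
    then obtain A where "A \<in> G" "\<not> triv A" "disp w A < c" by (auto simp: U_def p_def)
    then show False using w(2) unfolding thick_def by force
  qed
  have "\<exists>t\<in>{0..1}. t \<in> closure (U True) \<and> t \<notin> U True"
  proof (rule ccontr)
    assume neg: "\<not> ?thesis"
    have "U True \<inter> {0..1} = {} \<or> (- closure (U True)) \<inter> {0..1} = {}"
      by (rule connectedD[OF connected_Icc opU[of True]]) (use neg closure_subset[of "U True"] in auto)
    then show False using 0 1 neg by fastforce
  qed
  then obtain t where t: "0 \<le> t" "t \<le> 1" "t \<in> closure (U True)" "t \<notin> U True" by auto
  have tF: "t \<notin> U False"
  proof
    assume "t \<in> U False"
    then have "U False \<inter> U True \<noteq> {}" using t(3) opU[of False] open_Int_closure_eq_empty[of "U False" "U True"] by blast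
    then show False using disjU by blast
  qed
  have pt: "Im (p t) > 0" using Imp t by blast
  have thick: "thick G c (p t)"
    unfolding thick_def
  proof (intro ballI impI)
    fix A assume A: "A \<in> G" "\<not> triv A"
    show "c \<le> disp (p t) A"
    proof (rule ccontr)
      assume "\<not> c \<le> disp (p t) A"
      then have "t \<in> U (A * S = S * A)" using A pt by (auto simp: U_def)
      then show False using t(4) tF by (cases "A * S = S * A") simp_all
    qed
  qed
  \<comment> \<open>Close to the thick point there still is a thin one. Passing from it to the thick
    point over a distance below 1 raises the displacement by at most 2, whence
    \<open>c + 2\<close>.\<close>
  obtain e where e: "e > 0" "\<And>s. \<bar>s - t\<bar> < e \<Longrightarrow> p s \<in> hball (p t) 1" using near[OF pt, of 1] by auto
  obtain s where s: "s \<in> U True" "dist s t < e" using t(3) e(1) unfolding closure_approachable by blast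
  obtain A where A: "Im (p s) > 0" "A \<in> G" "\<not> triv A" "disp (p s) A < c" "A * S = S * A" using s(1) by (auto simp: U_def)
  have "disp (p t) A \<le> 2 * hyp_dist (p s) (p t) + disp (p s) A" by (rule disp_le[OF A(1) pt])
  moreover have "hyp_dist (p s) (p t) < 1" using e(2)[of s] s(2) by (simp add: hball_def dist_real_def hyp_dist_commute)
  ultimately have "disp (p t) A \<le> c + 2" using A(4) by simp
  then show ?thesis using pt thick A by blast
qed

text \<open>Parallel traceless parts give \<open>A\<close> and \<open>S\<close> the same ratio of
  \<open>tr\<^sup>2 - 4\<close> to \<open>near_sq\<close>. Discreteness at \<open>\<i>\<close>
  bounds \<open>near_sq A\<close> from below, hence also the trace, and the trace bounds the
  displacement everywhere.\<close>

lemma hyperbolic_centralizer: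
  assumes S: "S \<in> G" "\<bar>tr S\<bar> > 2"
  shows "\<exists>l>0. \<forall>A\<in>G. \<not> triv A \<longrightarrow> A * S = S * A \<longrightarrow> (\<forall>z. Im z > 0 \<longrightarrow> l \<le> disp z A)"
proof -
  obtain r where r: "r > 0" "thick G r \<i>" using ex_thick[of \<i>] by auto
  define q where "q = (tr S)\<^sup>2 - 4"
  have q: "q > 0" using S(2) power_strict_mono[of 2 "\<bar>tr S\<bar>" 2] by (simp add: q_def)
  define n0 where "n0 = near_sq S"
  have "n0 = q + (eb S - ec S)\<^sup>2" using near_sq_tr[of S] unfolding n0_def q_def by linarith
  then have n0: "n0 > 0" using q by (simp add: add_pos_nonneg)
  define \<rho> where "\<rho> = 2 * cosh r - 2"
  have \<rho>: "\<rho> > 0" using r(1) cosh_real_one_iff[of r] cosh_real_ge_1[of r] unfolding \<rho>_def by linarith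
  define K where "K = 1 + \<rho> * q / (2 * n0)"
  have K: "K > 1" using \<rho> q n0 by (simp add: K_def)
  have main: "arcosh K \<le> disp z A" if A: "A \<in> G" "\<not> triv A" "A * S = S * A" and z: "Im z > 0" for A z
  proof -
    have "r \<le> disp \<i> A" using r(2) A by (simp add: thick_def)
    then have "cosh r \<le> cosh (disp \<i> A)" using r(1) by (subst cosh_mono_iff) auto
    then have nA: "near_sq A \<ge> \<rho>" by (simp add: near_sq_disp \<rho>_def)
    have par: "eb A * ec S = eb S * ec A" "(ea A - ed A) * eb S = (ea S - ed S) * eb A" "(ea A - ed A) * ec S = (ea S - ed S) * ec A"
      using A(3) unfolding commute_iff by auto
    have t4: "(tr B)\<^sup>2 - 4 = (ea B - ed B)\<^sup>2 + 4 * eb B * ec B" for B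
      using sl2_det[of B] by (simp add: tr_def power2_eq_square algebra_simps)
    define x1 x2 x3 y1 y2 y3 where "x1 = ea S - ed S" "x2 = eb S" "x3 = ec S" "y1 = ea A - ed A" "y2 = eb A" "y3 = ec A"
    note xy = x1_x2_x3_y1_y2_y3_def
    have p: "y2 * x3 = x2 * y3" "y1 * x2 = x1 * y2" "y1 * x3 = x1 * y3" using par by (simp_all add: xy)
    have "(y1\<^sup>2 + 4 * y2 * y3) * (x1\<^sup>2 + (x2 + x3)\<^sup>2) = (x1\<^sup>2 + 4 * x2 * x3) * (y1\<^sup>2 + (y2 + y3)\<^sup>2)"
      using p by algebra
    then have e: "((tr A)\<^sup>2 - 4) * n0 = q * near_sq A"
      unfolding q_def t4 n0_def near_sq_def xy by simp
    have "q * \<rho> \<le> q * near_sq A" using nA q by simp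
    then have "q * \<rho> / n0 \<le> (tr A)\<^sup>2 - 4" using e n0 by (simp add: divide_le_eq)
    then have "K \<le> cosh (disp z A)" using disp_tr_bound[OF z, of A] by (simp add: K_def algebra_simps)
    then have "cosh (arcosh K) \<le> cosh (disp z A)" using K by simp
    then show ?thesis using cosh_mono_iff[of "arcosh K" "disp z A"] hyp_dist_nonneg[of z "mob A z"] z K by simp
  qed
  then show ?thesis using K by (intro exI[of _ "arcosh K"]) auto
qed

text \<open>In the frame \<open>m\<close> the centralising elements are integer translations up to
  sign. At height at most 1 such a translation has displacement at least that of a unit translation
  at height 1, whose \<open>cosh\<close> is \<open>1 + 1/2\<close>.\<close>

lemma parabolic_centralizer:
  assumes S: "S \<in> G" "\<bar>tr S\<bar> = 2" "\<not> triv S"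
  shows "\<exists>m. cusp_frame G m \<and> (\<forall>A\<in>G. \<not> triv A \<longrightarrow> A * S = S * A \<longrightarrow>
     (\<forall>z. Im z > 0 \<longrightarrow> Im (mob (minv m) z) > 1 \<or> arcosh (3/2) \<le> disp z A))"
proof -
  define S' where "S' = (if tr S = 2 then S else mneg S)"
  have S': "S' \<in> G" "tr S' = 2" "\<not> triv S'" using S G_neg by (auto simp: S'_def)
  have com': "A * S' = S' * A" if "A * S = S * A" for A
    using that by (simp add: S'_def mneg_mult_left mneg_mult_right)
  obtain m0 s where m0: "s \<noteq> 0" "S' = m0 * nn s * minv m0" using parabolic_normal_form[OF S'(2,3)] by blast
  define H where "H = {t. m0 * nn t * minv m0 \<in> G}"
  have prod: "(m0 * nn x * minv m0) * (m0 * nn y * minv m0) = m0 * nn (x + y) * minv m0" for x y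
    by (simp add: mult.assoc nn_add[symmetric])
  have inv: "minv (m0 * nn x * minv m0) = m0 * nn (- x) * minv m0" for x
    by (simp add: minv_mult minv_nn mult.assoc)
  have "\<exists>t>0. \<forall>x. t * x \<in> H \<longleftrightarrow> x \<in> \<int>"
  proof (rule discrete_subgroup_cyclic)
    show "x + y \<in> H" if "x \<in> H" "y \<in> H" for x y
      using that G_mult prod[of x y] unfolding H_def by (metis mem_Collect_eq)
    show "- x \<in> H" if "x \<in> H" for x using that G_inv inv[of x] unfolding H_def by (metis mem_Collect_eq)
    show "finite {x \<in> H. \<bar>x\<bar> \<le> R}" for R
    proof (rule inj_on_finite)
      show "inj_on (\<lambda>x. m0 * nn x * minv m0) {x \<in> H. \<bar>x\<bar> \<le> R}"
      proof (rule inj_onI)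
        fix x y assume "m0 * nn x * minv m0 = m0 * nn y * minv m0"
        then have "minv m0 * (m0 * nn x * minv m0) * m0 = minv m0 * (m0 * nn y * minv m0) * m0" by simp
        then show "x = y" by (simp add: mult.assoc nn_inj)
      qed
      have "disp (mob m0 \<i>) (m0 * nn x * minv m0) \<le> \<bar>x\<bar>" for x
      proof -
        have "disp (mob m0 \<i>) (m0 * nn x * minv m0) = hyp_dist \<i> (\<i> + of_real x)"
          using disp_conj[of \<i> m0 "nn x"] by (simp add: mob_nn)
        also have "\<dots> \<le> \<bar>x\<bar>" using hyp_dist_le_euclid[of \<i> "\<i> + of_real x"] by simp
        finally show ?thesis .
      qed
      from order_trans[OF this]
      show "(\<lambda>x. m0 * nn x * minv m0) ` {x \<in> H. \<bar>x\<bar> \<le> R} \<subseteq> {A \<in> G. disp (mob m0 \<i>) A \<le> R}"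
        by (auto simp: H_def)
      show "finite {A \<in> G. disp (mob m0 \<i>) A \<le> R}" by (rule finite_disp) simp
    qed
    show "s \<in> H" using S'(1) m0 by (simp add: H_def)
  qed (rule m0(1))
  then obtain t where t: "t > 0" "\<And>x. t * x \<in> H \<longleftrightarrow> x \<in> \<int>" by blast
  define m where "m = m0 * dg (sqrt t)"
  have mm: "m * nn x * minv m = m0 * nn (t * x) * minv m0" for x
  proof -
    have "m * nn x * minv m = m0 * (dg (sqrt t) * nn x * minv (dg (sqrt t))) * minv m0"
      by (simp add: m_def minv_mult mult.assoc)
    then show ?thesis using t(1) by (simp add: dg_nn)
  qed
  have cf: "cusp_frame G m" unfolding cusp_frame_def mm using t(2) by (simp add: H_def)
  have "Im (mob (minv m) z) > 1 \<or> arcosh (3/2) \<le> disp z A"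
    if A: "A \<in> G" "\<not> triv A" "A * S = S * A" and z: "Im z > 0" for A z
  proof -
    define B where "B = minv m * A * m"
    define u where "u = s / t"
    have S'm: "S' = m * nn u * minv m" using m0(2) t(1) by (simp add: mm u_def)
    have u: "u \<noteq> 0" using m0(1) t(1) by (simp add: u_def)
    have "A * (m * nn u * minv m) = (m * nn u * minv m) * A" using com'[OF A(3)] S'm by simp
    then have "minv m * (A * (m * nn u * minv m)) * m = minv m * ((m * nn u * minv m) * A) * m" by simp
    then have "B * nn u = nn u * B" by (simp add: B_def mult.assoc)
    then have B: "ec B = 0" "ea B = ed B" using u unfolding commute_iff by auto
    have "triv B \<longleftrightarrow> triv A" using triv_conj[of "minv m" A] by (simp add: B_def)
    then have eb: "eb B \<noteq> 0" using A(2) B by (simp add: triv_iff)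
    have a1: "ea B = 1 \<or> ea B = -1" using sl2_det[of B] B by (simp add: square_eq_1_iff)
    define B' where "B' = (if ea B = 1 then B else mneg B)"
    have B': "B' = nn (eb B')" "eb B' \<noteq> 0" using B a1 eb by (auto simp: B'_def intro!: sl2_eqI)
    have AB: "A = m * B * minv m" by (simp add: B_def mult.assoc)
    have "m * B' * minv m \<in> G" using A(1) G_neg[OF A(1)] AB by (auto simp: B'_def mneg_mult_left mneg_mult_right)
    then have "eb B' \<in> \<int>" using cf B'(1) unfolding cusp_frame_def by metis
    then have b1: "(eb B')\<^sup>2 \<ge> 1" using B'(2) by (metis Ints_nonzero_abs_ge1 abs_ge_zero one_le_power power2_abs)
    define w where "w = mob (minv m) z"
    have w: "Im w > 0" using z by (simp add: w_def)
    have zw: "z = mob m w" using z by (simp add: w_def)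
    have mobB: "mob B x = mob B' x" for x by (simp add: B'_def)
    have "disp z A = disp w B" using disp_conj[OF w, of m B] AB zw by simp
    also have "\<dots> = hyp_dist w (w + of_real (eb B'))" unfolding mobB by (subst B'(1)) (simp add: mob_nn)
    finally have dz: "cosh (disp z A) = 1 + (eb B')\<^sup>2 / (2 * Im w * Im w)"
      using cosh_hyp_dist[of w "w + of_real (eb B')"] w by simp
    show ?thesis
    proof (cases "Im w > 1")
      case True then show ?thesis by (simp add: w_def)
    next
      case False
      then have "2 * Im w * Im w \<le> 2" using w mult_le_one[of "Im w" "Im w"] by simp
      then have "1 / 2 \<le> (eb B')\<^sup>2 / (2 * Im w * Im w)" using b1 w by (intro frac_le) auto
      then have "cosh (arcosh (3/2)) \<le> cosh (disp z A)" using dz by simp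
      then show ?thesis using cosh_mono_iff[of "arcosh (3/2)" "disp z A"] hyp_dist_nonneg[of z "mob A z"] z by simp
    qed
  qed
  then show ?thesis using cf by blast
qed

text \<open>Finiteness of the number of cusps up to the group is the point. From a thin point
  \<open>thin_path\<close> leads to a thick point with a commuting element of bounded displacement;
  moved near \<open>\<i>\<close>, that element belongs to a finite set \<open>F\<close>. The
  centraliser lemmas for \<open>F\<close> yield finitely many frames and one scale \<open>L\<close>,
  and a point outside the horoballs is \<open>L\<close>-thick, to which coboundedness applies
  again.\<close>

lemma thick_thin:
  "\<exists>D CF. finite CF \<and> (\<forall>m\<in>CF. cusp_frame G m) \<and> (\<forall>z. Im z > 0 \<longrightarrow>
     (\<exists>A\<in>G. hyp_dist \<i> (mob A z) \<le> D) \<or> (\<exists>A\<in>G. \<exists>m\<in>CF. Im (mob (minv m) (mob A z)) > 1))"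
proof -
  obtain r where r: "r > 0" "thick G r \<i>" using ex_thick[of \<i>] by auto
  define c where "c = min margulis r"
  have c: "c > 0" "c \<le> margulis" "thick G c \<i>" using r margulis_pos by (auto simp: c_def thick_def)
  obtain D1 where D1: "\<And>z. Im z > 0 \<Longrightarrow> thick G c z \<Longrightarrow> \<exists>A\<in>G. hyp_dist \<i> (mob A z) \<le> D1"
    using G_cobounded[OF c(1)] by blast
  \<comment> \<open>\<open>c + 2\<close> is the displacement from \<open>thin_path\<close>;
    \<open>2 * D1\<close> pays for changing the base point to \<open>\<i>\<close>.\<close>
  define F where "F = {A \<in> G. \<not> triv A \<and> disp \<i> A \<le> 2 * D1 + (c + 2)}"
  have finF: "finite F" by (rule finite_subset[OF _ G_discrete[of "2 * D1 + (c + 2)"]]) (auto simp: F_def)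
  define good where "good S l N \<longleftrightarrow> l > 0 \<and> finite N \<and> (\<forall>m\<in>N. cusp_frame G m) \<and>
     (\<forall>A\<in>G. \<not> triv A \<longrightarrow> A * S = S * A \<longrightarrow> (\<forall>z. Im z > 0 \<longrightarrow> (\<exists>m\<in>N. Im (mob (minv m) z) > 1) \<or> l \<le> disp z A))"
    for S and l :: real and N
  have good_ex: "\<exists>l N. good S l N" if S: "S \<in> F" for S
  proof (cases "\<bar>tr S\<bar> > 2")
    case True
    then obtain l where "l > 0" "\<forall>A\<in>G. \<not> triv A \<longrightarrow> A * S = S * A \<longrightarrow> (\<forall>z. Im z > 0 \<longrightarrow> l \<le> disp z A)"
      using hyperbolic_centralizer[of S] S by (auto simp: F_def)
    then have "good S l {}" by (simp add: good_def)
    then show ?thesis by blast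
  next
    case False
    then have "\<bar>tr S\<bar> = 2" using tr_ge_2[of S] S by (auto simp: F_def)
    then obtain m where m: "cusp_frame G m" "\<forall>A\<in>G. \<not> triv A \<longrightarrow> A * S = S * A \<longrightarrow>
     (\<forall>z. Im z > 0 \<longrightarrow> Im (mob (minv m) z) > 1 \<or> arcosh (3/2) \<le> disp z A)"
      using parabolic_centralizer[of S] S by (auto simp: F_def)
    then have "good S (arcosh (3/2)) {m}" by (simp add: good_def)
    then show ?thesis by blast
  qed
  define l where "l S = (SOME l. \<exists>N. good S l N)" for S
  define N where "N S = (SOME N. good S (l S) N)" for S
  have lN: "good S (l S) (N S)" if "S \<in> F" for S
    unfolding N_def l_def by (rule someI_ex, rule someI_ex, rule good_ex[OF that])
  define L where "L = Min (insert c (l ` F))"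
  have L: "L > 0" "\<And>S. S \<in> F \<Longrightarrow> L \<le> l S"
    using finF c(1) lN unfolding L_def by (auto simp: good_def)
  define CF where "CF = (\<Union>S\<in>F. N S)"
  have CF: "finite CF" "\<forall>m\<in>CF. cusp_frame G m" using finF lN by (auto simp: CF_def good_def)
  obtain D2 where D2: "\<And>z. Im z > 0 \<Longrightarrow> thick G L z \<Longrightarrow> \<exists>A\<in>G. hyp_dist \<i> (mob A z) \<le> D2"
    using G_cobounded[OF L(1)] by blast
  define D where "D = max D1 D2"
  have main: "(\<exists>A\<in>G. hyp_dist \<i> (mob A z) \<le> D) \<or> (\<exists>A\<in>G. \<exists>m\<in>CF. Im (mob (minv m) (mob A z)) > 1)"
    if z: "Im z > 0" for z
  proof (cases "thick G c z")
    case True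
    then show ?thesis using D1[OF z] by (fastforce simp: D_def)
  next
    case False
    then obtain S0 where S0: "S0 \<in> G" "\<not> triv S0" "disp z S0 < c" by (auto simp: thick_def)
    obtain S where S: "S \<in> G" "\<not> triv S" "disp z S \<le> disp z S0" "thick G (disp z S) z"
      using minimal_disp[OF z S0(1,2)] by blast
    have Sc: "disp z S < c" using S S0 by simp
    obtain q A where q: "Im q > 0" "thick G c q" "A \<in> G" "\<not> triv A" "A * S = S * A" "disp q A \<le> c + 2"
      using thin_path[OF z S(1,2) Sc c(2) _ c(3)] by auto
    obtain g where g: "g \<in> G" "hyp_dist \<i> (mob g q) \<le> D1" using D1[OF q(1,2)] by blast
    define T where "T = g * A * minv g"
    define S1 where "S1 = g * S * minv g"
    have T: "T \<in> G" "\<not> triv T" using G_conj[OF q(3) g(1)] q(4) by (auto simp: T_def)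
    have S1: "S1 \<in> G" "\<not> triv S1" using G_conj[OF S(1) g(1)] S(2) by (auto simp: S1_def)
    have "g * (S * A) * minv g = g * (A * S) * minv g" using q(5) by simp
    then have com: "S1 * T = T * S1" by (simp add: S1_def T_def mult.assoc)
    have "disp \<i> T \<le> 2 * hyp_dist (mob g q) \<i> + disp (mob g q) T" by (rule disp_le) (use q in auto)
    also have "disp (mob g q) T = disp q A" unfolding T_def by (rule disp_conj[OF q(1)])
    finally have "T \<in> F" using T q(6) g(2) by (simp add: F_def hyp_dist_commute)
    then have gd: "good T (l T) (N T)" "L \<le> l T" "N T \<subseteq> CF" using lN L(2) by (auto simp: CF_def)
    have "(\<exists>m\<in>N T. Im (mob (minv m) (mob g z)) > 1) \<or> l T \<le> disp (mob g z) S1"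
      using gd(1) S1 com z unfolding good_def by auto
    then show ?thesis
    proof
      assume "\<exists>m\<in>N T. Im (mob (minv m) (mob g z)) > 1"
      then show ?thesis using gd(3) g(1) by blast
    next
      assume "l T \<le> disp (mob g z) S1"
      also have "disp (mob g z) S1 = disp z S" unfolding S1_def by (rule disp_conj[OF z])
      finally have "thick G L z" using S(4) gd(2) unfolding thick_def by force
      then show ?thesis using D2[OF z] by (fastforce simp: D_def)
    qed
  qed
  show ?thesis using CF main by (intro exI[of _ D] exI[of _ CF]) blast
qed

text \<open>Shimizu's lemma; without torsion the constant 4 comes from a trace shift by multiples of the
  lower left entry.\<close>

lemma shimizu:
  assumes m: "cusp_frame G m" and C: "C \<in> G" and nz: "ec (minv m * C * m) \<noteq> 0"
  shows "\<bar>ec (minv m * C * m)\<bar> \<ge> 4"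
proof (rule ccontr)
  define E where "E = minv m * C * m"
  assume "\<not> 4 \<le> \<bar>ec (minv m * C * m)\<bar>"
  then have lt: "\<bar>ec E\<bar> < 4" by (simp add: E_def)
  have c: "ec E \<noteq> 0" using nz by (simp add: E_def)
  define k where "k = - round (tr E / ec E)"
  have k: "\<bar>tr E + of_int k * ec E\<bar> \<le> \<bar>ec E\<bar> / 2"
  proof -
    have "\<bar>tr E / ec E - of_int (round (tr E / ec E))\<bar> \<le> 1/2" using of_int_round_abs_le[of "tr E / ec E"] by linarith
    then have "\<bar>ec E\<bar> * \<bar>tr E / ec E - of_int (round (tr E / ec E))\<bar> \<le> \<bar>ec E\<bar> * (1/2)" by (intro mult_left_mono) auto
    also have "\<bar>ec E\<bar> * \<bar>tr E / ec E - of_int (round (tr E / ec E))\<bar> = \<bar>tr E + of_int k * ec E\<bar>"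
      using c by (simp add: abs_mult[symmetric] k_def algebra_simps)
    finally show ?thesis by simp
  qed
  define X where "X = m * nn (of_int k) * minv m * C"
  have "m * nn (of_int k) * minv m \<in> G" using m by (simp add: cusp_frame_def)
  then have XG: "X \<in> G" unfolding X_def by (rule G_mult[OF _ C])
  have X': "m * (nn (of_int k) * E) * minv m = X" by (simp add: X_def E_def mult.assoc)
  have "tr X = tr (nn (of_int k) * E)" unfolding X'[symmetric] by (rule tr_conj)
  also have "\<dots> = tr E + of_int k * ec E" by (simp add: tr_def)
  finally have "\<bar>tr X\<bar> < 2" using k lt by simp
  then have "triv X" using tr_ge_2[OF XG] by force
  then have "triv (nn (of_int k) * E)" using triv_conj[of m "nn (of_int k) * E"] X' by simp
  then show False using c by (simp add: triv_iff)
qed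

text \<open>If \<open>B\<close> fixes infinity, conjugation by it and by its inverse maps integer
  translations to integer translations, so \<open>(ea B)\<^sup>2\<close> and its reciprocal are both
  integers. Otherwise the unit translation conjugated by \<open>B\<close> has lower left entry
  \<open>- (ec B)\<^sup>2\<close>, to which \<open>shimizu\<close> applies.\<close>

lemma cusp_pair:
  assumes m: "cusp_frame G m" and m': "cusp_frame G m'" and A: "A \<in> G"
  defines "B \<equiv> minv m' * A * m"
  shows "(ec B = 0 \<and> \<bar>ea B\<bar> = 1) \<or> \<bar>ec B\<bar> \<ge> 2"
proof (cases "ec B = 0")
  case True
  have ad: "ea B * ed B = 1" using sl2_det[of B] True by simp
  have n1: "B * nn 1 * minv B = nn ((ea B)\<^sup>2)" "minv B * nn 1 * B = nn ((ed B)\<^sup>2)"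
    using True ad by (auto intro!: sl2_eqI simp: power2_eq_square algebra_simps)
  have "A * (m * nn 1 * minv m) * minv A \<in> G"
    using m A by (intro G_conj[of "m * nn 1 * minv m" A]) (simp_all add: cusp_frame_def)
  moreover have "A * (m * nn 1 * minv m) * minv A = m' * nn ((ea B)\<^sup>2) * minv m'"
    unfolding n1(1)[symmetric] by (simp add: B_def minv_mult mult.assoc)
  ultimately have i1: "(ea B)\<^sup>2 \<in> \<int>" using m' by (simp add: cusp_frame_def)
  have "minv A * (m' * nn 1 * minv m') * minv (minv A) \<in> G"
    using m' A G_inv by (intro G_conj[of "m' * nn 1 * minv m'" "minv A"]) (simp_all add: cusp_frame_def)
  moreover have "minv A * (m' * nn 1 * minv m') * minv (minv A) = m * nn ((ed B)\<^sup>2) * minv m"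
    unfolding n1(2)[symmetric] by (simp add: B_def minv_mult mult.assoc)
  ultimately have i2: "(ed B)\<^sup>2 \<in> \<int>" using m by (simp add: cusp_frame_def)
  have nz: "ea B \<noteq> 0" "ed B \<noteq> 0" using ad by auto
  have 1: "(ea B)\<^sup>2 \<ge> 1" using Ints_nonzero_abs_ge1[OF i1] nz by simp
  have 2: "(ed B)\<^sup>2 \<ge> 1" using Ints_nonzero_abs_ge1[OF i2] nz by simp
  have "(ea B)\<^sup>2 * (ed B)\<^sup>2 = 1" using ad by (simp add: power_mult_distrib[symmetric])
  then have "(ea B)\<^sup>2 \<le> 1" using 1 2 mult_left_mono[OF 2, of "(ea B)\<^sup>2"] by simp
  then have "(ea B)\<^sup>2 = 1" using 1 by simp
  then show ?thesis using True by (auto simp: power2_eq_1_iff)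
next
  case False
  define C where "C = A * (m * nn 1 * minv m) * minv A"
  have CG: "C \<in> G" unfolding C_def using m A by (intro G_conj[of "m * nn 1 * minv m" A]) (simp_all add: cusp_frame_def)
  have e: "minv m' * C * m' = B * nn 1 * minv B" by (simp add: C_def B_def minv_mult mult.assoc)
  have "ec (minv m' * C * m') = - (ec B)\<^sup>2" unfolding e by (simp add: power2_eq_square algebra_simps)
  then have "(ec B)\<^sup>2 \<ge> 4" using shimizu[OF m' CG] False by simp
  then have "2\<^sup>2 \<le> \<bar>ec B\<bar>\<^sup>2" by simp
  then have "2 \<le> \<bar>ec B\<bar>" by (rule power2_le_imp_le) simp
  then show ?thesis by blast
qed

text \<open>A lower left entry of size at least 2 pushes every point of height at least 1 down to
  height at most 1/4. The remaining case in \<open>cusp_pair\<close> preserves heights, so two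
  horoballs that meet coincide.\<close>

lemma horoballs_disjoint_or_equal:
  assumes m: "cusp_frame G m" and m': "cusp_frame G m'" and A: "A \<in> G"
    and w: "Im w \<ge> 1" "Im (mob (minv m' * A * m) w) \<ge> 1"
  shows "ec (minv m' * A * m) = 0 \<and> \<bar>ea (minv m' * A * m)\<bar> = 1"
proof (rule ccontr)
  define B where "B = minv m' * A * m"
  assume "\<not> ?thesis"
  then have c: "\<bar>ec B\<bar> \<ge> 2" using cusp_pair[OF m m' A] by (auto simp: B_def)
  have wp: "Im w > 0" using w by simp
  have "2 * 1 \<le> \<bar>ec B\<bar> * Im w" using c w by (intro mult_mono) auto
  then have "2\<^sup>2 \<le> (\<bar>ec B\<bar> * Im w)\<^sup>2" by (intro power_mono) auto
  then have 4: "4 \<le> (ec B * Im w)\<^sup>2" by (simp add: power_mult_distrib)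
  have big: "4 * Im w \<le> (cmod (cden B w))\<^sup>2"
  proof -
    have "\<bar>ec B\<bar> * \<bar>ec B\<bar> * (Im w * Im w) \<ge> (2 * 2) * (Im w * 1)" using c w by (intro mult_mono) auto
    then have "4 * Im w \<le> (ec B * Im w)\<^sup>2" by (simp add: power2_eq_square abs_mult_self_eq algebra_simps)
    then show ?thesis using zero_le_power2[of "ec B * Re w + ed B"] unfolding cmod_cden by linarith
  qed
  have "Im (mob B w) = Im w / (cmod (cden B w))\<^sup>2" by (rule Im_mob[OF wp])
  also have "\<dots> \<le> Im w / (4 * Im w)" using big wp cden_nz[OF wp, of B] by (intro divide_left_mono) auto
  also have "\<dots> < 1" using wp by simp
  finally show False using w(2) by (simp add: B_def)
qed

end

section \<open>Estimates for moduli and heights, and orbit points of large modulus\<close>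

lemma exp_bound_of_cosh:
  assumes p: "p > 0" "q > (0::real)" "\<delta> \<ge> 0" and c: "cosh \<delta> \<ge> 1 + (p - q)\<^sup>2 / (2 * p * q)"
  shows "p \<le> exp \<delta> * q"
proof -
  have "1 + (p - q)\<^sup>2 / (2 * p * q) = (p / q + inverse (p / q)) / 2"
    using p by (simp add: field_simps power2_eq_square)
  also have "\<dots> = cosh (ln (p / q))" using p by (subst cosh_ln_real) auto
  finally have "cosh \<bar>ln (p / q)\<bar> \<le> cosh \<delta>" using c by simp
  then have "\<bar>ln (p / q)\<bar> \<le> \<delta>" using p(3) by (subst (asm) cosh_mono_iff) auto
  then have "exp (ln (p / q)) \<le> exp \<delta>" by simp
  then show ?thesis using p by (simp add: field_simps)
qed

text \<open>A change of modulus is cheapest along a ray from 0: \<open>cmod (z - w)\<close> is at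
  least the difference of the moduli and \<open>Im z * Im w\<close> at most their product, so the
  actual \<open>cosh\<close> dominates the one for the ray.\<close>

lemma cmod_le_exp_hyp_dist:
  assumes "Im z > 0" "Im w > 0" shows "cmod z \<le> exp (hyp_dist z w) * cmod w"
proof (rule exp_bound_of_cosh)
  have nz: "cmod z > 0" "cmod w > 0" using assms by auto
  show "cmod z > 0" "cmod w > 0" by (rule nz)+
  show "0 \<le> hyp_dist z w" by (rule hyp_dist_nonneg[OF assms])
  have "(cmod z - cmod w)\<^sup>2 \<le> (cmod (z - w))\<^sup>2"
    using norm_triangle_ineq3[of z w] by (simp add: abs_le_square_iff[symmetric])
  moreover have "Im z * Im w \<le> cmod z * cmod w"
    using assms abs_Im_le_cmod[of z] abs_Im_le_cmod[of w] by (intro mult_mono) auto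
  ultimately have "(cmod z - cmod w)\<^sup>2 / (2 * cmod z * cmod w) \<le> (cmod (z - w))\<^sup>2 / (2 * Im z * Im w)"
    using assms by (intro frac_le) auto
  then show "1 + (cmod z - cmod w)\<^sup>2 / (2 * cmod z * cmod w) \<le> cosh (hyp_dist z w)"
    unfolding cosh_hyp_dist[OF assms] by simp
qed

lemma Im_le_exp_hyp_dist:
  assumes "Im z > 0" "Im w > 0" shows "Im z \<le> exp (hyp_dist z w) * Im w"
proof (rule exp_bound_of_cosh)
  show "0 \<le> hyp_dist z w" by (rule hyp_dist_nonneg[OF assms])
  have "(Im z - Im w)\<^sup>2 \<le> (cmod (z - w))\<^sup>2"
    unfolding cmod_power2 by simp
  then have "(Im z - Im w)\<^sup>2 / (2 * Im z * Im w) \<le> (cmod (z - w))\<^sup>2 / (2 * Im z * Im w)"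
    using assms by (intro divide_right_mono) auto
  then show "1 + (Im z - Im w)\<^sup>2 / (2 * Im z * Im w) \<le> cosh (hyp_dist z w)"
    unfolding cosh_hyp_dist[OF assms] by simp
qed (use assms in auto)

text \<open>The displacement cost \<open>2 * ln R\<close> has its origin here: a point of modulus at
  most \<open>R\<close> may lie at bounded height, as at the ends of a long arc.\<close>

lemma hyp_dist_ii_le:
  assumes z: "Im z > 0" "Im z \<ge> exp (- s)" and R: "cmod z \<le> R" "R \<ge> 1"
  shows "hyp_dist \<i> z \<le> ln 2 + 2 * ln R + s"
proof -
  have "exp (hyp_dist \<i> z) / 2 \<le> cosh (hyp_dist \<i> z)" by (simp add: cosh_field_def)
  also have "\<dots> = ((cmod z)\<^sup>2 + 1) / (2 * Im z)"
  proof -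
    have "(cmod (\<i> - z))\<^sup>2 = (cmod z)\<^sup>2 + 1 - 2 * Im z" unfolding cmod_power2 by (simp add: power2_eq_square algebra_simps)
    then show ?thesis using cosh_hyp_dist[of \<i> z] z by (simp add: diff_divide_distrib)
  qed
  also have "\<dots> \<le> (2 * R\<^sup>2) / (2 * exp (- s))"
  proof (rule frac_le)
    have "(cmod z)\<^sup>2 \<le> R\<^sup>2" "1 \<le> R\<^sup>2" using R by (auto intro: power_mono one_le_power)
    then show "(cmod z)\<^sup>2 + 1 \<le> 2 * R\<^sup>2" by simp
  qed (use z in auto)
  finally have "exp (hyp_dist \<i> z) \<le> 2 * R\<^sup>2 * exp s" by (simp add: exp_minus field_simps)
  also have "\<dots> = exp (ln 2 + 2 * ln R + s)"
    using R(2) by (simp add: exp_add exp_double power2_eq_square)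
  finally show ?thesis by simp
qed

lemma Im_mob_parabolic:
  assumes "ec B = 0" "\<bar>ea B\<bar> = 1" "Im z > 0" shows "Im (mob B z) = Im z"
proof -
  have "ea B * ed B = 1" using sl2_det[of B] assms(1) by simp
  then have "\<bar>ea B\<bar> * \<bar>ed B\<bar> = 1" by (simp add: abs_mult[symmetric])
  then have "\<bar>ed B\<bar> = 1" using assms(2) by simp
  then have "(ed B)\<^sup>2 = 1" by (simp add: power2_eq_1_iff abs_if split: if_splits)
  then show ?thesis using Im_mob[OF assms(3), of B] unfolding cmod_cden assms(1) by simp
qed

definition horo :: "sl2 \<Rightarrow> complex set" where
  "horo E = {z. Im z > 0 \<and> Im (mob E z) > 1}"

lemma horo_iff: "Im z > 0 \<Longrightarrow> z \<in> horo E \<longleftrightarrow> (ec E * Re z + ed E)\<^sup>2 + (ec E * Im z)\<^sup>2 < Im z"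
proof -
  assume z: "Im z > 0"
  have "(cmod (cden E z))\<^sup>2 > 0" using cden_nz[OF z, of E] by simp
  then show ?thesis using z by (simp add: horo_def Im_mob cmod_cden[symmetric] less_divide_eq)
qed

lemma open_horo: "open (horo E)"
proof -
  have "horo E = {z. Im z > 0} \<inter> {z. (ec E * Re z + ed E)\<^sup>2 + (ec E * Im z)\<^sup>2 < Im z}"
    using horo_iff[of _ E] by (auto simp: horo_def)
  moreover have "open {z. (ec E * Re z + ed E)\<^sup>2 + (ec E * Im z)\<^sup>2 < Im z}"
    by (intro open_Collect_less continuous_intros)
  ultimately show ?thesis by (simp add: open_Int open_halfspace_Im_gt)
qed

text \<open>At fixed height, membership is a convex quadratic inequality in the real part.\<close>

lemma horo_horizontally_convex:
  assumes v: "v > 0" and X: "Complex X v \<in> horo E" "Complex (- X) v \<in> horo E" and r: "\<bar>r\<bar> \<le> X"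
  shows "Complex r v \<in> horo E"
proof -
  define c d where "c = ec E" and "d = ed E"
  have 1: "(c * X + d)\<^sup>2 + (c * v)\<^sup>2 < v" "(c * (- X) + d)\<^sup>2 + (c * v)\<^sup>2 < v"
    using X v horo_iff[of "Complex X v" E] horo_iff[of "Complex (- X) v" E] by (auto simp: c_def d_def)
  have X0: "X \<ge> 0" using r by linarith
  have e: "(c * x + d)\<^sup>2 = (c * x)\<^sup>2 + 2 * (c * d * x) + d\<^sup>2" for x by (simp add: power2_eq_square algebra_simps)
  have "(c * r)\<^sup>2 \<le> (c * X)\<^sup>2" using r X0 by (simp add: power_mult_distrib abs_le_square_iff[symmetric] mult_left_mono)
  moreover have "c * d * r \<le> \<bar>c * d\<bar> * X"
    using r abs_ge_self[of "c * d * r"] mult_left_mono[OF r, of "\<bar>c * d\<bar>"] by (simp add: abs_mult)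
  moreover have "\<bar>c * d\<bar> * X = c * d * X \<or> \<bar>c * d\<bar> * X = c * d * (- X)" by (auto simp: abs_if)
  moreover have "(c * (- X))\<^sup>2 = (c * X)\<^sup>2" by simp
  ultimately have "(c * r + d)\<^sup>2 + (c * v)\<^sup>2 < v" using 1 unfolding e by linarith
  then show ?thesis using horo_iff[of "Complex r v" E] v by (simp add: c_def d_def)
qed

context fuchs
begin

text \<open>The constant depends on the frame only through the bound \<open>S\<close> on its
  displacement; this uniformity is what later allows an unbounded number of frames.\<close>

lemma escape:
  shows "\<exists>C. \<forall>m R. disp \<i> m \<le> S \<longrightarrow> R \<ge> 1 \<longrightarrow> (\<exists>a\<in>G. R \<le> cmod (mob (m * a) \<i>) \<and> disp \<i> a \<le> C + 2 * ln R)"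
proof -
  obtain D CF where CF: "\<And>m. m \<in> CF \<Longrightarrow> cusp_frame G m" and tt: "\<And>z. Im z > 0 \<Longrightarrow>
     (\<exists>A\<in>G. hyp_dist \<i> (mob A z) \<le> D) \<or> (\<exists>A\<in>G. \<exists>m\<in>CF. Im (mob (minv m) (mob A z)) > 1)"
    using thick_thin by blast
  \<comment> \<open>A point in no horoball. When there are cusps, a boundary point of one horoball
    serves: a point of height exactly 1 in its own frame lies in no open horoball, because horoballs
    are disjoint or equal.\<close>
  have "\<exists>b. Im b > 0 \<and> (\<forall>A\<in>G. \<forall>m\<in>CF. Im (mob (minv m) (mob A b)) \<le> 1)"
  proof (cases "CF = {}")
    case True then show ?thesis by (intro exI[of _ \<i>]) simp
  next
    case False
    then obtain m1 where m1: "m1 \<in> CF" by blast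
    have "Im (mob (minv m) (mob A (mob m1 \<i>))) \<le> 1" if A: "A \<in> G" "m \<in> CF" for A m
    proof (rule ccontr)
      assume neg: "\<not> ?thesis"
      have e: "mob (minv m) (mob A (mob m1 \<i>)) = mob (minv m * A * m1) \<i>" by (simp add: mob_mult)
      have "ec (minv m * A * m1) = 0 \<and> \<bar>ea (minv m * A * m1)\<bar> = 1"
        by (rule horoballs_disjoint_or_equal[OF CF[OF m1] CF[OF A(2)] A(1), of \<i>]) (use neg in \<open>simp_all add: e\<close>)
      then show False using Im_mob_parabolic[of "minv m * A * m1" \<i>] neg unfolding e by simp
    qed
    then show ?thesis by (intro exI[of _ "mob m1 \<i>"]) simp
  qed
  then obtain b where b: "Im b > 0" "\<And>A m. A \<in> G \<Longrightarrow> m \<in> CF \<Longrightarrow> Im (mob (minv m) (mob A b)) \<le> 1" by blast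
  define T where "T = S + hyp_dist \<i> b"
  define C where "C = S + ln 2 + 3 * \<bar>D\<bar> + 3 * T"
  have "\<exists>a\<in>G. R \<le> cmod (mob (m * a) \<i>) \<and> disp \<i> a \<le> C + 2 * ln R" if m: "disp \<i> m \<le> S" and R: "R \<ge> 1" for m R
  proof -
    define b' where "b' = mob m b"
    have b': "Im b' > 0" using b(1) by (simp add: b'_def)
    have "hyp_dist \<i> b' \<le> disp \<i> m + hyp_dist (mob m \<i>) b'" by (rule hyp_dist_triangle) (use b' in auto)
    then have T: "hyp_dist \<i> b' \<le> T" using m b(1) by (simp add: b'_def T_def)
    have T0: "T \<ge> 0" using T hyp_dist_nonneg[of \<i> b'] b' by simp
    define v where "v = Im b'"
    have v: "v > 0" "v \<ge> exp (- T)"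
    proof -
      have "1 \<le> exp (hyp_dist \<i> b') * v" using Im_le_exp_hyp_dist[of \<i> b'] b' by (simp add: v_def)
      also have "\<dots> \<le> exp T * v" using T b' by (simp add: v_def)
      finally show "v \<ge> exp (- T)" by (simp add: exp_minus field_simps)
    qed (use b' v_def in simp)
    have bT: "cmod b' \<le> exp T"
    proof -
      have "cmod b' \<le> exp (hyp_dist \<i> b')" using cmod_le_exp_hyp_dist[of b' \<i>] b' by (simp add: hyp_dist_commute)
      then show ?thesis using T by (meson exp_le_cancel_iff order_trans)
    qed
    \<comment> \<open>\<open>exp T\<close> makes the disc of radius \<open>R'\<close> contain
      \<open>b'\<close>; \<open>exp \<bar>D\<bar>\<close> pays for the step from a point of the arc
      to an orbit point within \<open>D\<close>.\<close>
    define R' where "R' = exp (\<bar>D\<bar> + T) * R"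
    have R'1: "R' \<ge> 1" using R T0 mult_mono[of 1 "exp (\<bar>D\<bar> + T)" 1 R] by (simp add: R'_def)
    have bR: "cmod b' \<le> R'"
    proof -
      have "exp T * 1 \<le> exp (\<bar>D\<bar> + T) * R" using R by (intro mult_mono) auto
      then show ?thesis using bT by (simp add: R'_def)
    qed
    define X where "X = sqrt (R'\<^sup>2 - v\<^sup>2)"
    have sq: "(Re b')\<^sup>2 + v\<^sup>2 \<le> R'\<^sup>2" using power_mono[OF bR, of 2] by (simp add: cmod_power2 v_def)
    have "R'\<^sup>2 - v\<^sup>2 \<ge> 0" using sq zero_le_power2[of "Re b'"] by linarith
    then have X: "X \<ge> 0" "X\<^sup>2 = R'\<^sup>2 - v\<^sup>2" by (simp_all add: X_def)
    have ReX: "\<bar>Re b'\<bar> \<le> X" unfolding X_def using sq by (intro real_le_rsqrt) simp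
    define p where "p x = Complex x (sqrt (R'\<^sup>2 - x\<^sup>2))" for x
    have px: "Im (p x) \<ge> v" "cmod (p x) = R'" if "\<bar>x\<bar> \<le> X" for x
    proof -
      have "x\<^sup>2 \<le> X\<^sup>2" using power_mono[OF that, of 2] by simp
      then have x2: "x\<^sup>2 \<le> R'\<^sup>2 - v\<^sup>2" using X(2) by simp
      then show "Im (p x) \<ge> v" by (simp add: p_def real_le_rsqrt)
      have "R'\<^sup>2 - x\<^sup>2 \<ge> 0" using x2 zero_le_power2[of v] by linarith
      then have "(cmod (p x))\<^sup>2 = R'\<^sup>2" by (simp add: cmod_power2 p_def)
      then show "cmod (p x) = R'" using R'1 by (simp add: power2_eq_iff_nonneg)
    qed
    have pX: "p X = Complex X v" "p (- X) = Complex (- X) v" using X v(1) by (simp_all add: p_def)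
    define \<E> where "\<E> = {minv m' * A * minv m | m' A. m' \<in> CF \<and> A \<in> G}"
    have eqh: "horo E1 = horo E2" if E: "E1 \<in> \<E>" "E2 \<in> \<E>" and z: "z \<in> horo E1" "z \<in> horo E2" for E1 E2 z
    proof -
      obtain m1 A1 where 1: "m1 \<in> CF" "A1 \<in> G" "E1 = minv m1 * A1 * minv m" using E(1) by (auto simp: \<E>_def)
      obtain m2 A2 where 2: "m2 \<in> CF" "A2 \<in> G" "E2 = minv m2 * A2 * minv m" using E(2) by (auto simp: \<E>_def)
      define B where "B = minv m2 * (A2 * minv A1) * m1"
      have zp: "Im z > 0" using z by (simp add: horo_def)
      have "B * E1 = E2" by (simp add: B_def 1 2 mult.assoc)
      then have BE: "mob E2 u = mob B (mob E1 u)" if "Im u > 0" for u using mob_mult[OF that, of B E1] by simp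
      have AG: "A2 * minv A1 \<in> G" using 1 2 G_mult G_inv by blast
      have "ec B = 0 \<and> \<bar>ea B\<bar> = 1"
        unfolding B_def by (rule horoballs_disjoint_or_equal[OF CF[OF 1(1)] CF[OF 2(1)] AG, of "mob E1 z"])
          (use z BE[OF zp] in \<open>auto simp: horo_def B_def\<close>)
      then have "Im (mob E2 u) = Im (mob E1 u)" if "Im u > 0" for u
        using BE[OF that] Im_mob_parabolic[of B "mob E1 u"] that by simp
      then show ?thesis by (auto simp: horo_def)
    qed
    have "\<exists>x. \<bar>x\<bar> \<le> X \<and> (\<forall>E\<in>\<E>. p x \<notin> horo E)"
    proof (rule ccontr)
      assume neg: "\<not> ?thesis"
      have "\<bar>- X\<bar> \<le> X" using X(1) by simp
      then obtain E0 where E0: "E0 \<in> \<E>" "p (- X) \<in> horo E0" using neg by blast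
      define K where "K = p ` {-X..X}"
      have "continuous_on {-X..X} p" unfolding p_def Complex_eq by (intro continuous_intros)
      then have conK: "connected K" unfolding K_def by (intro connected_continuous_image) auto
      \<comment> \<open>Different \<open>E\<close> may describe the same horoball, so horoballs are
        separated as sets. Both \<open>horo E0\<close> and \<open>W\<close> are open and disjoint,
        hence the connected arc lies in one of them.\<close>
      define W where "W = (\<Union>E\<in>{E\<in>\<E>. horo E \<noteq> horo E0}. horo E)"
      have opW: "open W" unfolding W_def using open_horo by blast
      have dis: "horo E0 \<inter> W \<inter> K = {}" unfolding W_def using eqh E0(1) by blast
      have cov: "K \<subseteq> horo E0 \<union> W"
      proof
        fix z assume "z \<in> K"
        then obtain x where x: "z = p x" "\<bar>x\<bar> \<le> X" by (auto simp: K_def abs_le_iff)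
        then obtain E where "E \<in> \<E>" "z \<in> horo E" using neg by blast
        then show "z \<in> horo E0 \<union> W" unfolding W_def by (cases "horo E = horo E0") auto
      qed
      have "horo E0 \<inter> K = {} \<or> W \<inter> K = {}" by (rule connectedD[OF conK open_horo opW dis cov])
      moreover have pK: "p (- X) \<in> K" "p X \<in> K" using X(1) by (auto simp: K_def)
      ultimately have "W \<inter> K = {}" using E0(2) by blast
      then have "p X \<in> horo E0" using pK(2) cov by blast
      then have "Complex (Re b') v \<in> horo E0"
        using horo_horizontally_convex[OF v(1), of X E0 "Re b'"] E0(2) pX ReX by simp
      then have in0: "b' \<in> horo E0" by (simp add: v_def)
      obtain m' A where mA: "m' \<in> CF" "A \<in> G" "E0 = minv m' * A * minv m" using E0(1) by (auto simp: \<E>_def)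
      have "mob E0 b' = mob (minv m') (mob A b)" using b(1) by (simp add: mA(3) mob_mult b'_def)
      then show False using b(2)[OF mA(2,1)] in0 by (simp add: horo_def)
    qed
    then obtain x where x: "\<bar>x\<bar> \<le> X" "\<And>E. E \<in> \<E> \<Longrightarrow> p x \<notin> horo E" by blast
    define z where "z = p x"
    have z: "Im z \<ge> v" "cmod z = R'" using px[OF x(1)] by (auto simp: z_def)
    have zp: "Im z > 0" using z v by simp
    define w where "w = mob (minv m) z"
    have wp: "Im w > 0" using zp by (simp add: w_def)
    have "\<not> (\<exists>A\<in>G. \<exists>m'\<in>CF. Im (mob (minv m') (mob A w)) > 1)"
    proof
      assume "\<exists>A\<in>G. \<exists>m'\<in>CF. Im (mob (minv m') (mob A w)) > 1"
      then obtain A m' where A: "A \<in> G" "m' \<in> CF" "Im (mob (minv m') (mob A w)) > 1" by blast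
      then have "z \<in> horo (minv m' * A * minv m)" using zp by (simp add: horo_def mob_mult w_def)
      then show False using x(2) A(1,2) by (auto simp: \<E>_def z_def)
    qed
    then obtain A where A: "A \<in> G" "hyp_dist \<i> (mob A w) \<le> D" using tt[OF wp] by blast
    define y where "y = mob (m * minv A) \<i>"
    have yp: "Im y > 0" by (simp add: y_def)
    have dyz: "hyp_dist y z \<le> D"
    proof -
      have zm: "z = mob (m * minv A) (mob A w)" using wp zp by (simp add: mob_mult w_def)
      have "hyp_dist y z = hyp_dist \<i> (mob A w)" unfolding y_def by (subst zm) (rule hyp_dist_mob, use wp in auto)
      then show ?thesis using A(2) by simp
    qed
    have "R \<le> cmod y"
    proof -
      have "R' \<le> exp (hyp_dist z y) * cmod y" using cmod_le_exp_hyp_dist[OF zp yp] z(2) by simp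
      also have "\<dots> \<le> exp \<bar>D\<bar> * cmod y" using dyz by (intro mult_right_mono) (auto simp: hyp_dist_commute)
      finally have "exp T * R \<le> cmod y" by (simp add: R'_def exp_add mult.assoc)
      moreover have "1 * R \<le> exp T * R" using T0 R by (intro mult_right_mono) auto
      ultimately show ?thesis by simp
    qed
    moreover have "disp \<i> (minv A) \<le> C + 2 * ln R"
    proof -
      have "disp \<i> (minv A) = hyp_dist (mob m \<i>) y" by (simp add: y_def mob_mult)
      also have "\<dots> \<le> hyp_dist (mob m \<i>) \<i> + hyp_dist \<i> y" by (rule hyp_dist_triangle) (use yp in auto)
      also have "hyp_dist \<i> y \<le> hyp_dist \<i> z + hyp_dist z y" by (rule hyp_dist_triangle) (use yp zp in auto)
      also have "hyp_dist \<i> z \<le> ln 2 + 2 * ln R' + T"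
        by (rule hyp_dist_ii_le[OF zp]) (use z v R'1 in auto)
      also have "ln R' = \<bar>D\<bar> + T + ln R" using R by (simp add: R'_def ln_mult)
      finally show ?thesis using m dyz by (simp add: C_def hyp_dist_commute)
    qed
    ultimately show ?thesis using G_inv[OF A(1)] by (intro bexI[of _ "minv A"]) (auto simp: y_def)
  qed
  then show ?thesis by blast
qed

end

section \<open>Axes through prescribed frames\<close>

text \<open>The linear action on \<open>\<real>\<^sup>2\<close>, identified with the complex numbers.\<close>

definition act :: "sl2 \<Rightarrow> complex \<Rightarrow> complex" where
  "act A v = Complex (ea A * Re v + eb A * Im v) (ec A * Re v + ed A * Im v)"

text \<open>The determinant of the pair: for unit vectors its absolute value is the sine of the
  angle between the lines that they span.\<close>

definition dt :: "complex \<Rightarrow> complex \<Rightarrow> real" where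
  "dt v w = Re v * Im w - Im v * Re w"

lemma act_simps [simp]: "Re (act A v) = ea A * Re v + eb A * Im v" "Im (act A v) = ec A * Re v + ed A * Im v"
  by (simp_all add: act_def)

lemma act_one [simp]: "act 1 v = v" by (simp add: complex_eq_iff)

lemma act_mult: "act (A * B) v = act A (act B v)"
  by (simp add: complex_eq_iff algebra_simps)

lemma act_minv [simp]: "act (minv A) (act A v) = v" "act A (act (minv A) v) = v"
  by (simp_all add: act_mult[symmetric])

lemma act_diff: "act A (v - w) = act A v - act A w"
  and act_scale: "act A (of_real s * v) = of_real s * act A v"
  by (simp_all add: complex_eq_iff algebra_simps)

lemma act_eq_0_iff [simp]: "act A v = 0 \<longleftrightarrow> v = 0"
proof
  assume "act A v = 0"
  then have "act (minv A) (act A v) = act (minv A) 0" by simp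
  moreover have "act (minv A) 0 = 0" by (simp add: complex_eq_iff)
  ultimately show "v = 0" by simp
qed (simp add: complex_eq_iff)

lemma dt_act: "dt (act A v) (act A w) = dt v w"
proof -
  have "dt (act A v) (act A w) = (ea A * ed A - eb A * ec A) * dt v w"
    by (simp add: dt_def algebra_simps)
  then show ?thesis by (simp add: sl2_det)
qed

lemma dt_diff_left: "dt (v - w) u = dt v u - dt w u"
  and dt_scale_left: "dt (of_real s * v) u = s * dt v u"
  and dt_scale_right: "dt u (of_real s * v) = s * dt u v"
  by (simp_all add: dt_def algebra_simps)

lemma dt_le: "\<bar>dt v w\<bar> \<le> cmod v * cmod w"
proof -
  have "dt v w = Im (cnj v * w)" by (simp add: dt_def algebra_simps)
  then show ?thesis using abs_Im_le_cmod[of "cnj v * w"] by (simp add: norm_mult)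
qed

lemma act_bound:
  "\<exists>K\<ge>1. \<forall>v. cmod (act A v) \<le> K * cmod v"
proof -
  define K where "K = 1 + (\<bar>ea A\<bar> + \<bar>eb A\<bar> + \<bar>ec A\<bar> + \<bar>ed A\<bar>)"
  have "cmod (act A v) \<le> K * cmod v" for v
  proof -
    have r: "\<bar>x * Re v + y * Im v\<bar> \<le> (\<bar>x\<bar> + \<bar>y\<bar>) * cmod v" for x y
    proof -
      have "\<bar>x * Re v + y * Im v\<bar> \<le> \<bar>x\<bar> * \<bar>Re v\<bar> + \<bar>y\<bar> * \<bar>Im v\<bar>" using abs_triangle_ineq[of "x * Re v" "y * Im v"] by (simp add: abs_mult)
      also have "\<dots> \<le> \<bar>x\<bar> * cmod v + \<bar>y\<bar> * cmod v"
        by (intro add_mono mult_left_mono abs_Re_le_cmod abs_Im_le_cmod) auto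
      finally show ?thesis by (simp add: algebra_simps)
    qed
    have "cmod (act A v) \<le> \<bar>Re (act A v)\<bar> + \<bar>Im (act A v)\<bar>" by (rule cmod_le)
    also have "\<dots> \<le> (\<bar>ea A\<bar> + \<bar>eb A\<bar>) * cmod v + (\<bar>ec A\<bar> + \<bar>ed A\<bar>) * cmod v"
      unfolding act_simps by (intro add_mono r)
    also have "\<dots> \<le> K * cmod v" by (simp add: K_def algebra_simps)
    finally show ?thesis .
  qed
  moreover have "K \<ge> 1" by (simp add: K_def)
  ultimately show ?thesis by blast
qed

text \<open>\<open>x\<close> is the cosine of the angle and \<open>dt u w\<close> its sine up to
  sign; the claim rests on \<open>1 - \<bar>cos\<bar> \<le> sin\<^sup>2\<close>. The sign
  \<open>s\<close> picks the nearer of the two unit vectors on the line.\<close>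

lemma near_line_unit:
  assumes u: "cmod u = 1" and w: "cmod w = 1" and \<eta>: "\<bar>dt u w\<bar> \<le> \<eta>"
  shows "\<exists>s. \<bar>s\<bar> = (1::real) \<and> cmod (u - of_real s * w) \<le> 2 * \<eta>"
proof -
  define x where "x = Re u * Re w + Im u * Im w"
  have "x\<^sup>2 + (dt u w)\<^sup>2 = (cmod u)\<^sup>2 * (cmod w)\<^sup>2"
    unfolding cmod_power2 by (simp add: x_def dt_def power2_eq_square algebra_simps)
  then have xy: "x\<^sup>2 + (dt u w)\<^sup>2 = 1" using u w by simp
  define s where "s = (if x \<ge> 0 then 1 else - 1 :: real)"
  have s: "\<bar>s\<bar> = 1" "s * x = \<bar>x\<bar>" "s\<^sup>2 = 1" by (auto simp: s_def)
  have "(cmod (u - of_real s * w))\<^sup>2 = (cmod u)\<^sup>2 + s\<^sup>2 * (cmod w)\<^sup>2 - 2 * (s * x)"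
    unfolding cmod_power2 by (simp add: x_def power2_eq_square algebra_simps)
  then have e: "(cmod (u - of_real s * w))\<^sup>2 = 2 - 2 * \<bar>x\<bar>" using u w s by simp
  have "x\<^sup>2 \<le> 1" using xy zero_le_power2[of "dt u w"] by linarith
  then have x1: "\<bar>x\<bar> \<le> 1" using abs_square_le_1[of x] by simp
  then have "\<bar>x\<bar>\<^sup>2 \<le> \<bar>x\<bar>" using mult_left_mono[OF x1, of "\<bar>x\<bar>"] by (simp add: power2_eq_square)
  then have "1 - \<bar>x\<bar> \<le> (dt u w)\<^sup>2" using xy by simp
  also have "\<dots> \<le> \<eta>\<^sup>2" using \<eta> power_mono[OF \<eta>, of 2] by simp
  finally have "(cmod (u - of_real s * w))\<^sup>2 \<le> 2 * \<eta>\<^sup>2" using e by simp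
  also have "\<dots> \<le> (2 * \<eta>)\<^sup>2" by (simp add: power_mult_distrib)
  finally have "cmod (u - of_real s * w) \<le> 2 * \<eta>" by (rule power2_le_imp_le) (use \<eta> in simp)
  then show ?thesis using s(1) by blast
qed

lemma upper_triangular_conj_nn: "ec B = 0 \<Longrightarrow> B * nn t * minv B = nn ((ea B)\<^sup>2 * t)"
  using sl2_det[of B] by (auto intro!: sl2_eqI simp: power2_eq_square algebra_simps)

context fuchs
begin

text \<open>If a line were fixed, the group would be upper triangular in a suitable frame. Escape
  provides two contractions with different finite fixed points; their commutator is a nonzero
  translation, and conjugating it by powers of one contraction produces arbitrarily short nonzero
  translations, against discreteness.\<close>

lemma no_fixed_line:
  assumes \<omega>: "\<omega> \<noteq> 0" shows "\<exists>f\<in>G. dt (act f \<omega>) \<omega> \<noteq> 0"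
proof (rule ccontr)
  assume neg: "\<not> ?thesis"
  define r where "r = cmod \<omega>"
  have r: "r > 0" using \<omega> by (simp add: r_def)
  have r2: "Re \<omega> * Re \<omega> + Im \<omega> * Im \<omega> = r * r" unfolding r_def using cmod_power2[of \<omega>] by (simp add: power2_eq_square)
  have det: "Re \<omega> / r * (Re \<omega> / r) - Im \<omega> / r * (- Im \<omega> / r) = 1"
  proof -
    have "Re \<omega> / r * (Re \<omega> / r) - Im \<omega> / r * (- Im \<omega> / r) = (Re \<omega> * Re \<omega> + Im \<omega> * Im \<omega>) / (r * r)" by (simp add: add_divide_distrib)
    then show ?thesis using r2 r by simp
  qed
  define m where "m = mk (Re \<omega> / r) (Im \<omega> / r) (- Im \<omega> / r) (Re \<omega> / r)"
  note me = mk_entries[OF det, folded m_def]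
  have m\<omega>: "act m \<omega> = of_real r"
  proof -
    have "Re \<omega> / r * Re \<omega> + Im \<omega> / r * Im \<omega> = (r * r) / r" unfolding r2[symmetric] by (simp add: add_divide_distrib)
    then show ?thesis using r by (simp add: complex_eq_iff me)
  qed
  have mi: "mob m \<i> = \<i>" using mob_fixed_iff[of \<i> m] by (simp add: me)
  define cj where "cj f = m * f * minv m" for f
  have cjinv: "minv m * cj f * m = f" for f by (simp add: cj_def mult.assoc)
  have c0: "ec (cj f) = 0" if f: "f \<in> G" for f
  proof -
    have "act (cj f) (of_real r) = act m (act f \<omega>)" by (simp add: cj_def act_mult m\<omega>[symmetric])
    then have "dt (act (cj f) (of_real r)) (of_real r) = dt (act f \<omega>) \<omega>" by (simp add: dt_act m\<omega>[symmetric])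
    then have "dt (act (cj f) (of_real r)) (of_real r) = 0" using neg f by simp
    then show ?thesis using r by (simp add: dt_def)
  qed
  define aff where "aff f = of_real ((ea f)\<^sup>2) * \<i> + complex_of_real (ea f * eb f)" for f
  have mobcj: "mob (m * f) \<i> = aff (cj f)" if f: "f \<in> G" for f
  proof -
    have "mob (cj f) \<i> = mob (cj f) (mob m \<i>)" by (simp add: mi)
    also have "\<dots> = mob (cj f * m) \<i>" by (simp add: mob_mult)
    also have "cj f * m = m * f" by (simp add: cj_def mult.assoc)
    finally have e: "mob (m * f) \<i> = mob (cj f) \<i>" ..
    have ad: "ea (cj f) * ed (cj f) = 1" using sl2_det[of "cj f"] c0[OF f] by simp
    then have nz: "ea (cj f) \<noteq> 0" by auto
    then have d: "ed (cj f) = 1 / ea (cj f)" using ad by (simp add: field_simps)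
    show ?thesis unfolding e unfolding mob_def aff_def c0[OF f] d using nz by (simp add: power2_eq_square field_simps)
  qed
  have esc: "\<exists>f\<in>G. (ea (cj f))\<^sup>2 \<le> 1/4 \<and> \<bar>ea (cj f) * eb (cj f) - x\<bar> \<le> 1/4" for x
  proof -
    \<comment> \<open>The half turn after the shift by \<open>- x\<close> turns "modulus at least 4"
      into "within 1/4 of \<open>x\<close>", so an orbit point low above \<open>x\<close> is
      found.\<close>
    define B where "B = rot (pi/2) * nn (- x) * m"
    obtain C where "\<forall>R\<ge>1. \<exists>a\<in>G. R \<le> cmod (mob (B * a) \<i>) \<and> disp \<i> a \<le> C + 2 * ln R"
      using escape[of "disp \<i> B"] by blast
    then obtain f where f: "f \<in> G" "4 \<le> cmod (mob (B * f) \<i>)" by (meson one_le_numeral)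
    have "mob (B * f) \<i> = - 1 / (aff (cj f) - of_real x)"
      by (simp add: B_def mob_mult mob_rot_half_pi mob_nn mobcj[OF f(1), symmetric])
    then have "4 \<le> 1 / cmod (aff (cj f) - of_real x)" using f(2) by (simp add: norm_divide)
    then have n: "cmod (aff (cj f) - of_real x) \<le> 1/4" by (cases "aff (cj f) - of_real x = 0") (auto simp: field_simps)
    have "\<bar>Im (aff (cj f) - of_real x)\<bar> \<le> 1/4" "\<bar>Re (aff (cj f) - of_real x)\<bar> \<le> 1/4"
      using n abs_Im_le_cmod abs_Re_le_cmod order_trans by blast+
    then show ?thesis using f(1) by (auto simp: aff_def)
  qed
  obtain f1 where f1: "f1 \<in> G" "(ea (cj f1))\<^sup>2 \<le> 1/4" "\<bar>ea (cj f1) * eb (cj f1) - 0\<bar> \<le> 1/4" using esc[of 0] by blast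
  obtain f2 where f2: "f2 \<in> G" "(ea (cj f2))\<^sup>2 \<le> 1/4" "\<bar>ea (cj f2) * eb (cj f2) - 1\<bar> \<le> 1/4" using esc[of 1] by blast
  define l1 t1 l2 t2 where "l1 = (ea (cj f1))\<^sup>2" and "t1 = ea (cj f1) * eb (cj f1)"
    and "l2 = (ea (cj f2))\<^sup>2" and "t2 = ea (cj f2) * eb (cj f2)"
  \<comment> \<open>The translation part of the commutator; it vanishes exactly when the fixed
    points \<open>t1 / (1 - l1)\<close> and \<open>t2 / (1 - l2)\<close> coincide.\<close>
  define b where "b = t1 * (1 - l2) - t2 * (1 - l1)"
  have ad: "ea (cj f1) * ed (cj f1) = 1" "ea (cj f2) * ed (cj f2) = 1"
    using sl2_det[of "cj f1"] sl2_det[of "cj f2"] c0 f1(1) f2(1) by simp_all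
  have com: "cj f1 * cj f2 = nn b * (cj f2 * cj f1)"
  proof -
    define p q s u v w where "p = ea (cj f1)" "q = eb (cj f1)" "s = ed (cj f1)" "u = ea (cj f2)" "v = eb (cj f2)" "w = ed (cj f2)"
    note D = p_q_s_u_v_w_def
    have psuw: "p * s = 1" "u * w = 1" using ad by (simp_all add: D)
    have "p * v + q * w = u * q + v * s + (p * q * (1 - u\<^sup>2) - u * v * (1 - p\<^sup>2)) * (w * s)"
      using psuw by algebra
    then show ?thesis
      by (intro sl2_eqI) (simp_all add: c0 f1(1) f2(1) b_def t1_def t2_def l1_def l2_def D[symmetric] mult.commute)
  qed
  have b0: "b \<noteq> 0"
  proof -
    have "\<bar>t1 * (1 - l2)\<bar> \<le> 1/4 * 1" unfolding abs_mult
      using f1(3) f2(2) by (intro mult_mono) (auto simp: t1_def l2_def)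
    moreover have "3/4 * (3/4) \<le> t2 * (1 - l1)"
    proof (rule mult_mono)
      have "\<bar>t2 - 1\<bar> \<le> 1/4" using f2(3) by (simp add: t2_def)
      then show "3/4 \<le> t2" "0 \<le> t2" by linarith+
    qed (use f1(2) in \<open>auto simp: l1_def\<close>)
    ultimately show ?thesis unfolding b_def by linarith
  qed
  have nnb: "minv m * nn (l1 ^ k * b) * m \<in> G" for k
  proof (induction k)
    case 0
    have "minv m * nn b * m = f1 * f2 * minv f1 * minv f2"
    proof -
      have "nn b = cj f1 * cj f2 * minv (cj f2 * cj f1)" using com by (simp add: mult.assoc)
      also have "\<dots> = cj f1 * cj f2 * minv (cj f1) * minv (cj f2)" by (simp add: minv_mult mult.assoc)
      also have "\<dots> = m * (f1 * f2 * minv f1 * minv f2) * minv m" by (simp add: cj_def minv_mult mult.assoc)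
      finally show ?thesis by (simp add: mult.assoc)
    qed
    then show ?case using G_mult G_inv f1(1) f2(1) by simp
  next
    case (Suc k)
    define x where "x = l1 ^ k * b"
    have e: "nn (l1 * x) = cj f1 * nn x * minv (cj f1)"
      unfolding l1_def by (rule upper_triangular_conj_nn[OF c0[OF f1(1)], symmetric])
    have "l1 ^ Suc k * b = l1 * x" by (simp add: x_def)
    then have "minv m * nn (l1 ^ Suc k * b) * m = minv m * (cj f1 * nn x * minv (cj f1)) * m"
      by (simp only: e)
    also have "\<dots> = f1 * (minv m * nn x * m) * minv f1" by (simp add: cj_def minv_mult mult.assoc)
    finally have "minv m * nn (l1 ^ Suc k * b) * m = f1 * (minv m * nn (l1 ^ k * b) * m) * minv f1"
      by (simp only: x_def)
    then show ?case using G_conj[OF Suc f1(1)] by simp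
  qed
  obtain e where e: "e > 0" "thick G e \<i>" using ex_thick[of \<i>] by auto
  have l1: "0 \<le> l1" "l1 < 1" using f1(2) by (simp_all add: l1_def)
  have "(\<lambda>k. l1 ^ k * \<bar>b\<bar>) \<longlonglongrightarrow> 0 * \<bar>b\<bar>" by (intro tendsto_intros LIMSEQ_realpow_zero l1)
  then have "\<forall>\<^sub>F k in sequentially. l1 ^ k * \<bar>b\<bar> < e" using e(1) by (intro order_tendstoD(2)) auto
  then obtain k where k: "l1 ^ k * \<bar>b\<bar> < e" using eventually_happens'[OF sequentially_bot] by blast
  have lz: "l1 \<noteq> 0" using ad by (auto simp: l1_def)
  define X where "X = minv m * nn (l1 ^ k * b) * minv (minv m)"
  have XG: "X \<in> G" using nnb[of k] by (simp add: X_def)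
  have "mob (minv m) \<i> = \<i>" using mob_minv(1)[of \<i> m] mi by simp
  then have "disp \<i> X = disp \<i> (nn (l1 ^ k * b))" using disp_conj[of \<i> "minv m" "nn (l1 ^ k * b)"] by (simp add: X_def)
  also have "\<dots> \<le> \<bar>l1 ^ k * b\<bar>" by (rule disp_nn_le)
  also have "\<dots> < e" using k l1 by (simp add: abs_mult)
  finally have "triv X" using e(2) XG by (force simp: thick_def)
  then have "triv (nn (l1 ^ k * b))" unfolding X_def by (simp only: triv_conj)
  then show False using b0 lz by (simp add: triv_iff)
qed

text \<open>Compactness of pairs of directions turns the absence of a fixed line into finitely many
  connecting elements.\<close>

lemma connectors:
  "\<exists>F \<eta>. finite F \<and> F \<subseteq> G \<and> \<eta> > 0 \<and> (\<forall>\<omega> \<omega>'. cmod \<omega> = 1 \<longrightarrow> cmod \<omega>' = 1 \<longrightarrow>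
     (\<exists>f\<in>F. \<forall>v. \<bar>dt v \<omega>'\<bar> \<le> \<eta> * cmod v \<longrightarrow> \<eta> * cmod (act f v) \<le> \<bar>dt (act f v) \<omega>\<bar>))"
proof -
  define K where "K = sphere (0::complex) 1 \<times> sphere (0::complex) 1"
  have cK: "compact K" unfolding K_def by (intro compact_Times compact_sphere)
  define O' where "O' f = {p. dt (act f (snd p)) (fst p) \<noteq> 0}" for f
  have op: "open (O' f)" for f
    unfolding O'_def dt_def act_simps by (intro open_Collect_neq continuous_intros)
  have cov: "K \<subseteq> (\<Union>f\<in>G. O' f)"
  proof
    fix p assume "p \<in> K"
    then have p: "cmod (fst p) = 1" "cmod (snd p) = 1" by (auto simp: K_def)
    show "p \<in> (\<Union>f\<in>G. O' f)"
    proof (cases "dt (snd p) (fst p) = 0")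
      case False then show ?thesis using G_one by (intro UN_I[of 1]) (auto simp: O'_def)
    next
      case True
      obtain s where s: "\<bar>s\<bar> = (1::real)" "cmod (snd p - of_real s * fst p) \<le> 2 * 0"
        using near_line_unit[OF p(2,1), of 0] True by auto
      then have sp: "snd p = of_real s * fst p" by simp
      obtain f where f: "f \<in> G" "dt (act f (fst p)) (fst p) \<noteq> 0" using no_fixed_line[of "fst p"] p by fastforce
      have "dt (act f (snd p)) (fst p) \<noteq> 0" unfolding sp act_scale dt_scale_left using f(2) s(1) by auto
      then show ?thesis using f(1) by (auto simp: O'_def)
    qed
  qed
  obtain F where F: "F \<subseteq> G" "finite F" "K \<subseteq> (\<Union>f\<in>F. O' f)"
    using compactE_image[OF cK, of G O'] op cov by metis
  \<comment> \<open>The sum is continuous and positive on the compact set \<open>K\<close>; its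
    minimum, shared among the finitely many terms, forces one of them to be at least
    \<open>c\<close>.\<close>
  define \<Phi> where "\<Phi> p = (\<Sum>f\<in>F. \<bar>dt (act f (snd p)) (fst p)\<bar>)" for p
  have "continuous_on K \<Phi>"
    unfolding \<Phi>_def dt_def act_simps by (intro continuous_intros)
  moreover have "(1, 1) \<in> K" by (simp add: K_def)
  ultimately obtain p0 where p0: "p0 \<in> K" "\<And>p. p \<in> K \<Longrightarrow> \<Phi> p0 \<le> \<Phi> p"
    using continuous_attains_inf[OF cK, of \<Phi>] by blast
  have pos: "\<Phi> p0 > 0"
  proof -
    obtain f where "f \<in> F" "dt (act f (snd p0)) (fst p0) \<noteq> 0" using F(3) p0(1) by (auto simp: O'_def)
    then show ?thesis unfolding \<Phi>_def using F(2) by (intro sum_pos2[of _ f]) auto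
  qed
  define c where "c = \<Phi> p0 / (real (card F) + 1)"
  have c: "c > 0" using pos by (simp add: c_def)
  have ex: "\<exists>f\<in>F. c \<le> \<bar>dt (act f (snd p)) (fst p)\<bar>" if p: "p \<in> K" for p
  proof (rule ccontr)
    assume "\<not> ?thesis"
    then have "\<Phi> p \<le> (\<Sum>f\<in>F. c)" unfolding \<Phi>_def by (intro sum_mono) auto
    then have "\<Phi> p0 \<le> real (card F) * c" using p0(2)[OF p] by simp
    also have "\<dots> < (real (card F) + 1) * c" using c by simp
    also have "\<dots> = \<Phi> p0" by (simp add: c_def)
    finally show False by simp
  qed
  define Kb where "Kb f = (SOME K. K \<ge> 1 \<and> (\<forall>v. cmod (act f v) \<le> K * cmod v))" for f
  have Kb: "Kb f \<ge> 1 \<and> (\<forall>v. cmod (act f v) \<le> Kb f * cmod v)" for f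
    unfolding Kb_def by (rule someI_ex) (rule act_bound)
  define B where "B = 1 + (\<Sum>f\<in>F. Kb f)"
  have B: "B \<ge> 1" unfolding B_def using Kb by (simp add: sum_nonneg order_trans[OF zero_le_one])
  have Bf: "cmod (act f v) \<le> B * cmod v" if f: "f \<in> F" for f v
  proof -
    have "Kb f \<le> (\<Sum>f\<in>F. Kb f)" using F(2) f Kb by (intro member_le_sum) (auto intro: order_trans[OF zero_le_one])
    then have "Kb f * cmod v \<le> B * cmod v" unfolding B_def by (intro mult_right_mono) auto
    then show ?thesis using Kb[of f] order_trans by blast
  qed
  \<comment> \<open>Chosen with \<open>3 * (B * \<eta>) = c\<close>: replacing
    \<open>\<omega>'\<close> by a vector close to its line costs at most
    \<open>2 * (B * \<eta>)\<close>, so \<open>B * \<eta>\<close> is left.\<close>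
  define \<eta> where "\<eta> = c / (3 * B)"
  have \<eta>: "\<eta> > 0" using c B by (simp add: \<eta>_def)
  have e3: "3 * (B * \<eta>) = c" using B by (simp add: \<eta>_def)
  have main: "\<exists>f\<in>F. \<forall>v. \<bar>dt v \<omega>'\<bar> \<le> \<eta> * cmod v \<longrightarrow> \<eta> * cmod (act f v) \<le> \<bar>dt (act f v) \<omega>\<bar>"
    if w: "cmod \<omega> = 1" "cmod \<omega>' = 1" for \<omega> \<omega>'
  proof -
    obtain f where f: "f \<in> F" "c \<le> \<bar>dt (act f \<omega>') \<omega>\<bar>" using ex[of "(\<omega>, \<omega>')"] w by (auto simp: K_def)
    have "\<eta> * cmod (act f v) \<le> \<bar>dt (act f v) \<omega>\<bar>" if v: "\<bar>dt v \<omega>'\<bar> \<le> \<eta> * cmod v" for v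
    proof (cases "v = 0")
      case True
      then have "act f v = 0" by simp
      then show ?thesis by (simp only: norm_zero mult_zero_right abs_ge_zero)
    next
      case False
      define n where "n = cmod v"
      define u where "u = of_real (1 / n) * v"
      have n: "n > 0" using False by (simp add: n_def)
      have vu: "v = of_real n * u" using n by (simp add: u_def)
      have u1: "cmod u = 1" using n by (simp add: u_def norm_mult norm_divide n_def[symmetric])
      have "n * \<bar>dt u \<omega>'\<bar> \<le> n * \<eta>" using v n u1 unfolding vu dt_scale_left by (simp add: norm_mult abs_mult mult.commute)
      then have "\<bar>dt u \<omega>'\<bar> \<le> \<eta>" using n by simp
      then obtain s where s: "\<bar>s\<bar> = (1::real)" "cmod (u - of_real s * \<omega>') \<le> 2 * \<eta>"
        using near_line_unit[OF u1 w(2)] by blast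
      have "act f u = act f (of_real s * \<omega>') + act f (u - of_real s * \<omega>')" by (simp add: act_diff)
      then have "dt (act f u) \<omega> = s * dt (act f \<omega>') \<omega> + dt (act f (u - of_real s * \<omega>')) \<omega>"
        unfolding act_scale by (simp add: dt_def algebra_simps)
      then have "\<bar>dt (act f u) \<omega>\<bar> \<ge> \<bar>s * dt (act f \<omega>') \<omega>\<bar> - \<bar>dt (act f (u - of_real s * \<omega>')) \<omega>\<bar>" by linarith
      moreover have "\<bar>s * dt (act f \<omega>') \<omega>\<bar> \<ge> c" using s(1) f(2) by (simp add: abs_mult)
      moreover have "\<bar>dt (act f (u - of_real s * \<omega>')) \<omega>\<bar> \<le> 2 * (B * \<eta>)"
      proof -
        have "\<bar>dt (act f (u - of_real s * \<omega>')) \<omega>\<bar> \<le> cmod (act f (u - of_real s * \<omega>'))"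
          using dt_le[of "act f (u - of_real s * \<omega>')" \<omega>] w(1) by simp
        also have "\<dots> \<le> B * cmod (u - of_real s * \<omega>')" by (rule Bf[OF f(1)])
        also have "\<dots> \<le> B * (2 * \<eta>)" using s(2) B by (intro mult_left_mono) auto
        finally show ?thesis by simp
      qed
      ultimately have "B * \<eta> \<le> \<bar>dt (act f u) \<omega>\<bar>" using e3 by linarith
      moreover have "\<eta> * cmod (act f u) \<le> \<eta> * B" using Bf[OF f(1), of u] u1 \<eta> by simp
      ultimately have "\<eta> * cmod (act f u) \<le> \<bar>dt (act f u) \<omega>\<bar>" by (simp add: mult.commute)
      then have "n * (\<eta> * cmod (act f u)) \<le> n * \<bar>dt (act f u) \<omega>\<bar>" using n by simp
      then show ?thesis unfolding vu act_scale dt_scale_left using n by (simp add: norm_mult abs_mult mult.left_commute)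
    qed
    then show ?thesis using f(1) by blast
  qed
  show ?thesis using F(1,2) \<eta> main by (intro exI[of _ F] exI[of _ \<eta>]) blast
qed

end

section \<open>Cones around the ends of the imaginary axis\<close>

definition coneI :: "real \<Rightarrow> complex \<Rightarrow> bool" where "coneI \<rho> v \<longleftrightarrow> \<bar>Im v\<bar> \<le> \<rho> * \<bar>Re v\<bar>"
text \<open>A vector \<open>v\<close> stands for the boundary point \<open>Re v / Im v\<close>. Thus
  \<open>coneI\<close> is a neighbourhood of infinity and \<open>coneJ\<close> one of 0, of the same
  size.\<close>

definition coneJ :: "real \<Rightarrow> complex \<Rightarrow> bool" where "coneJ \<rho> v \<longleftrightarrow> \<bar>Re v\<bar> \<le> \<rho> * \<bar>Im v\<bar>"

lemma cones_disjoint: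
  assumes "coneI \<rho> v" "coneJ \<rho> v" "0 < \<rho>" "\<rho> < 1" shows "v = 0"
proof -
  have 1: "\<bar>Im v\<bar> \<le> \<rho> * \<bar>Re v\<bar>" "\<bar>Re v\<bar> \<le> \<rho> * \<bar>Im v\<bar>" using assms by (auto simp: coneI_def coneJ_def)
  have "\<rho> * \<bar>Re v\<bar> \<le> 1 * \<bar>Re v\<bar>" using assms by (intro mult_right_mono) auto
  then have le: "\<bar>Im v\<bar> \<le> \<bar>Re v\<bar>" using 1 by simp
  have "\<rho> * \<bar>Im v\<bar> \<le> \<rho> * \<bar>Re v\<bar>" using le assms by (intro mult_left_mono) auto
  then have "(1 - \<rho>) * \<bar>Re v\<bar> \<le> 0" using 1 by (simp add: algebra_simps)
  then have "\<bar>Re v\<bar> \<le> 0" using assms(4) by (simp add: mult_le_0_iff)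
  then show ?thesis using le by (simp add: complex_eq_iff)
qed

lemma coneI_scale: "s \<noteq> 0 \<Longrightarrow> coneI \<rho> (of_real s * v) \<longleftrightarrow> coneI \<rho> v"
proof -
  assume s: "s \<noteq> 0"
  have "\<bar>s\<bar> * \<bar>Im v\<bar> \<le> \<rho> * (\<bar>s\<bar> * \<bar>Re v\<bar>) \<longleftrightarrow> \<bar>s\<bar> * \<bar>Im v\<bar> \<le> \<bar>s\<bar> * (\<rho> * \<bar>Re v\<bar>)"
    by (simp add: mult.left_commute)
  also have "\<dots> \<longleftrightarrow> \<bar>Im v\<bar> \<le> \<rho> * \<bar>Re v\<bar>" using s by simp
  finally show ?thesis by (simp add: coneI_def abs_mult)
qed

lemma disp_ii_mult: "disp \<i> (A * B) \<le> disp \<i> A + disp \<i> B"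
proof -
  have "disp \<i> (A * B) \<le> hyp_dist \<i> (mob A \<i>) + hyp_dist (mob A \<i>) (mob (A * B) \<i>)"
    by (rule hyp_dist_triangle) auto
  then show ?thesis by (simp add: mob_mult)
qed

lemma disp_ii_minv: "disp \<i> (minv A) = disp \<i> A"
proof -
  have "disp \<i> (minv A) = hyp_dist (mob A \<i>) (mob A (mob (minv A) \<i>))" by (rule hyp_dist_mob[symmetric]) auto
  then show ?thesis by (simp add: hyp_dist_commute)
qed

text \<open>A quarter turn of the real plane, acting as the half turn about \<open>\<i>\<close>: it
  exchanges the two kinds of cone at no cost in displacement, so aiming upwards also serves for
  aiming downwards.\<close>

definition quarter :: sl2 where "quarter = mk 0 (- 1) 1 0"

lemma quarter_entries: "ea quarter = 0" "eb quarter = - 1" "ec quarter = 1" "ed quarter = 0"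
  by (simp_all add: quarter_def mk_entries)

lemma mob_quarter: "mob quarter \<i> = \<i>"
  using mob_fixed_iff[of \<i> quarter] by (simp add: quarter_entries)

context fuchs
begin

text \<open>A large modulus of \<open>mob (minv m * a) \<i>\<close> means that the first row of
  \<open>minv m * a\<close> is much longer than the second. Such a matrix squeezes every vector into
  a thin cone about the real axis, except those near the kernel of the first row, whose direction is
  \<open>\<omega>\<close>.\<close>

lemma aim:
  assumes \<eta>: "0 < \<eta>" "\<eta> \<le> 1"
  shows "\<exists>C. \<forall>m \<rho>. disp \<i> m \<le> S \<longrightarrow> 0 < \<rho> \<longrightarrow> \<rho> \<le> 1 \<longrightarrow> (\<exists>a\<in>G. \<exists>\<omega>. cmod \<omega> = 1 \<and> disp \<i> a \<le> C + 2 * ln (1 / \<rho>) \<and>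
     (\<forall>v. \<eta> * cmod v \<le> \<bar>dt v \<omega>\<bar> \<longrightarrow> coneI \<rho> (act (minv m) (act a v))))"
proof -
  obtain C where C: "\<And>m R. disp \<i> m \<le> S \<Longrightarrow> R \<ge> 1 \<Longrightarrow> \<exists>a\<in>G. R \<le> cmod (mob (m * a) \<i>) \<and> disp \<i> a \<le> C + 2 * ln R"
    using escape[of S] by blast
  have "\<exists>a\<in>G. \<exists>\<omega>. cmod \<omega> = 1 \<and> disp \<i> a \<le> (C + 2 * ln (1 / \<eta>)) + 2 * ln (1 / \<rho>) \<and>
     (\<forall>v. \<eta> * cmod v \<le> \<bar>dt v \<omega>\<bar> \<longrightarrow> coneI \<rho> (act (minv m) (act a v)))"
    if m: "disp \<i> m \<le> S" and \<rho>: "0 < \<rho>" "\<rho> \<le> 1" for m \<rho>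
  proof -
    define R where "R = 1 / (\<rho> * \<eta>)"
    have R1: "R \<ge> 1" using \<rho> \<eta> by (simp add: R_def mult_le_one)
    obtain a where a: "a \<in> G" "R \<le> cmod (mob (minv m * a) \<i>)" "disp \<i> a \<le> C + 2 * ln R"
      using C[of "minv m" R] m R1 disp_ii_minv[of m] by auto
    define B where "B = minv m * a"
    define r1 r2 where "r1 = Complex (eb B) (ea B)" and "r2 = Complex (ed B) (ec B)"
    have mB: "cmod (mob B \<i>) = cmod r1 / cmod r2"
    proof -
      have "of_real (ea B) * \<i> + of_real (eb B) = r1" "of_real (ec B) * \<i> + of_real (ed B) = r2"
        by (simp_all add: r1_def r2_def complex_eq_iff)
      then show ?thesis unfolding mob_def by (simp add: norm_divide)
    qed
    have r2: "cmod r2 > 0" using sl2_det[of B] by (auto simp: r2_def complex_eq_iff)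
    have r12: "R * cmod r2 \<le> cmod r1" using a(2) r2 unfolding B_def[symmetric] mB by (simp add: le_divide_eq)
    have r1: "cmod r1 > 0" using r12 r2 R1 by (meson mult_pos_pos less_le_trans zero_less_one)
    define \<omega> where "\<omega> = Complex (- eb B / cmod r1) (ea B / cmod r1)"
    have \<omega>1: "cmod \<omega> = 1"
    proof -
      have "(cmod \<omega>)\<^sup>2 = ((eb B)\<^sup>2 + (ea B)\<^sup>2) / (cmod r1)\<^sup>2"
        unfolding cmod_power2 \<omega>_def by (simp add: power_divide add_divide_distrib cmod_power2)
      also have "(eb B)\<^sup>2 + (ea B)\<^sup>2 = (cmod r1)\<^sup>2" by (simp add: cmod_power2 r1_def)
      finally have "(cmod \<omega>)\<^sup>2 = 1" using r1 by simp
      then show ?thesis using norm_ge_zero[of \<omega>] by (auto simp: power2_eq_1_iff)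
    qed
    have cone: "coneI \<rho> (act B v)" if v: "\<eta> * cmod v \<le> \<bar>dt v \<omega>\<bar>" for v
    proof -
      have "Re (act B v) = cmod r1 * dt v \<omega>" using r1 by (simp add: dt_def \<omega>_def field_simps)
      then have re: "\<bar>Re (act B v)\<bar> = cmod r1 * \<bar>dt v \<omega>\<bar>" by (simp add: abs_mult)
      have "Im (act B v) = Re (r2 * cnj (Complex (Im v) (Re v)))" by (simp add: r2_def)
      moreover have "cmod (cnj (Complex (Im v) (Re v))) = cmod v" by (simp add: cmod_def add.commute)
      ultimately have im: "\<bar>Im (act B v)\<bar> \<le> cmod r2 * cmod v"
        using abs_Re_le_cmod[of "r2 * cnj (Complex (Im v) (Re v))"] by (simp add: norm_mult)
      have "cmod r2 \<le> \<rho> * \<eta> * cmod r1" using r12 \<rho> \<eta> by (simp add: R_def field_simps)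
      then have "cmod r2 * cmod v \<le> \<rho> * \<eta> * cmod r1 * cmod v" by (intro mult_right_mono) auto
      also have "\<dots> = \<rho> * cmod r1 * (\<eta> * cmod v)" by simp
      also have "\<dots> \<le> \<rho> * cmod r1 * \<bar>dt v \<omega>\<bar>" using v \<rho> r1 by (intro mult_left_mono) auto
      finally show ?thesis using im re by (simp add: coneI_def mult.assoc)
    qed
    have "ln R = ln (1 / \<eta>) + ln (1 / \<rho>)" using \<rho> \<eta> by (simp add: R_def ln_div ln_mult)
    then show ?thesis using a(1,3) \<omega>1 cone by (intro bexI[of _ a] exI[of _ \<omega>]) (simp_all add: B_def act_mult)
  qed
  then show ?thesis by blast
qed

text \<open>\<open>g = a * f * minv b\<close>. The inverse of \<open>b\<close> gathers everything
  outside the lower cone near a line \<open>\<omega>'\<close>, and \<open>a\<close> drives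
  everything away from a line \<open>\<omega>\<close> into the upper cone. These lines are beyond
  control, so \<open>f\<close> from the finite set of \<open>connectors\<close> is needed to move a
  neighbourhood of the first away from the second. Both \<open>a\<close> and \<open>b\<close> cost
  \<open>2 * ln (1 / \<rho>)\<close>, hence the factor 4.\<close>

lemma connect:
  "\<exists>C\<ge>0. \<forall>m m' \<rho>. disp \<i> m \<le> S \<longrightarrow> disp \<i> m' \<le> S \<longrightarrow> 0 < \<rho> \<longrightarrow> \<rho> \<le> 1 \<longrightarrow> (\<exists>g\<in>G. disp \<i> g \<le> C + 4 * ln (1 / \<rho>) \<and>
     (\<forall>v. \<not> coneJ \<rho> (act (minv m') v) \<longrightarrow> coneI \<rho> (act (minv m) (act g v))))"
proof -
  obtain F \<eta>0 where F: "finite F" "F \<subseteq> G" "\<eta>0 > 0" "\<forall>\<omega> \<omega>'. cmod \<omega> = 1 \<longrightarrow> cmod \<omega>' = 1 \<longrightarrow>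
     (\<exists>f\<in>F. \<forall>v. \<bar>dt v \<omega>'\<bar> \<le> \<eta>0 * cmod v \<longrightarrow> \<eta>0 * cmod (act f v) \<le> \<bar>dt (act f v) \<omega>\<bar>)"
    using connectors by (elim exE conjE) (rule that)
  define \<eta> where "\<eta> = min \<eta>0 1"
  have \<eta>: "0 < \<eta>" "\<eta> \<le> 1" "\<eta> \<le> \<eta>0" using F(3) by (auto simp: \<eta>_def)
  obtain C0 where C0: "\<And>m \<rho>. disp \<i> m \<le> S \<Longrightarrow> 0 < \<rho> \<Longrightarrow> \<rho> \<le> 1 \<Longrightarrow> \<exists>a\<in>G. \<exists>\<omega>. cmod \<omega> = 1 \<and> disp \<i> a \<le> C0 + 2 * ln (1 / \<rho>) \<and>
     (\<forall>v. \<eta> * cmod v \<le> \<bar>dt v \<omega>\<bar> \<longrightarrow> coneI \<rho> (act (minv m) (act a v)))"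
    using aim[OF \<eta>(1,2), of S] by blast
  define Df where "Df = (\<Sum>f\<in>F. disp \<i> f)"
  have Df: "disp \<i> f \<le> Df" if "f \<in> F" for f
    unfolding Df_def using that F(1) by (intro member_le_sum) (auto intro: hyp_dist_nonneg)
  have main: "\<exists>g\<in>G. disp \<i> g \<le> \<bar>2 * C0 + Df\<bar> + 4 * ln (1 / \<rho>) \<and>
     (\<forall>v. \<not> coneJ \<rho> (act (minv m') v) \<longrightarrow> coneI \<rho> (act (minv m) (act g v)))"
    if m: "disp \<i> m \<le> S" "disp \<i> m' \<le> S" and \<rho>: "0 < \<rho>" "\<rho> \<le> 1" for m m' \<rho>
  proof -
    obtain a \<omega> where a: "a \<in> G" "cmod \<omega> = 1" "disp \<i> a \<le> C0 + 2 * ln (1 / \<rho>)"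
      "\<And>v. \<eta> * cmod v \<le> \<bar>dt v \<omega>\<bar> \<Longrightarrow> coneI \<rho> (act (minv m) (act a v))" using C0[OF m(1) \<rho>] by blast
    have "disp \<i> (m' * quarter) \<le> S" using m(2) by (simp add: mob_mult mob_quarter)
    then obtain b \<omega>' where b: "b \<in> G" "cmod \<omega>' = 1" "disp \<i> b \<le> C0 + 2 * ln (1 / \<rho>)"
      "\<And>v. \<eta> * cmod v \<le> \<bar>dt v \<omega>'\<bar> \<Longrightarrow> coneI \<rho> (act (minv (m' * quarter)) (act b v))" using C0[OF _ \<rho>] by blast
    have IJ: "coneI \<rho> (act (minv (m' * quarter)) x) \<longleftrightarrow> coneJ \<rho> (act (minv m') x)" for x
      using abs_minus_commute[of "eb m' * Im x" "ed m' * Re x"]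
      unfolding minv_mult act_mult by (simp add: coneI_def coneJ_def quarter_entries)
    obtain f where f: "f \<in> F" "\<And>v. \<bar>dt v \<omega>'\<bar> \<le> \<eta>0 * cmod v \<Longrightarrow> \<eta>0 * cmod (act f v) \<le> \<bar>dt (act f v) \<omega>\<bar>"
      using F(4) a(2) b(2) by blast
    define g where "g = a * f * minv b"
    have "g \<in> G" unfolding g_def by (intro G_mult G_inv a(1) b(1) subsetD[OF F(2) f(1)])
    moreover have "disp \<i> g \<le> \<bar>2 * C0 + Df\<bar> + 4 * ln (1 / \<rho>)"
    proof -
      have "disp \<i> g \<le> disp \<i> a + disp \<i> f + disp \<i> b"
        using disp_ii_mult[of "a * f" "minv b"] disp_ii_mult[of a f] by (simp add: g_def disp_ii_minv)
      then show ?thesis using a(3) b(3) Df[OF f(1)] abs_ge_self[of "2 * C0 + Df"] by linarith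
    qed
    moreover have "coneI \<rho> (act (minv m) (act g v))" if v: "\<not> coneJ \<rho> (act (minv m') v)" for v
    proof -
      define x where "x = act (minv b) v"
      have "v = act b x" by (simp add: x_def)
      then have "\<not> \<eta> * cmod x \<le> \<bar>dt x \<omega>'\<bar>" using b(4)[of x] v IJ by auto
      moreover have "\<eta> * cmod x \<le> \<eta>0 * cmod x" using \<eta>(3) by (intro mult_right_mono) auto
      ultimately have "\<eta>0 * cmod (act f x) \<le> \<bar>dt (act f x) \<omega>\<bar>" by (intro f(2)) linarith
      moreover have "\<eta> * cmod (act f x) \<le> \<eta>0 * cmod (act f x)" using \<eta>(3) by (intro mult_right_mono) auto
      ultimately have "coneI \<rho> (act (minv m) (act a (act f x)))" by (intro a(4)) linarith
      then show ?thesis by (simp add: g_def act_mult x_def)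
    qed
    ultimately show ?thesis by blast
  qed
  show ?thesis by (rule exI[of _ "\<bar>2 * C0 + Df\<bar>"]) (intro conjI allI impI abs_ge_zero main)
qed

end

text \<open>Carries 0 to \<open>p\<close> and infinity to \<open>1 / \<kappa>\<close>, hence the
  imaginary axis to the geodesic between these points; the root normalises the determinant.\<close>

definition axis_frame :: "real \<Rightarrow> real \<Rightarrow> sl2" where
  "axis_frame p \<kappa> = (let s = sqrt (1 - p * \<kappa>) in mk (1 / s) (p / s) (\<kappa> / s) (1 / s))"

lemma axis_frame_entries:
  assumes "p * \<kappa> < 1"
  shows "ea (axis_frame p \<kappa>) = 1 / sqrt (1 - p * \<kappa>)" "eb (axis_frame p \<kappa>) = p / sqrt (1 - p * \<kappa>)"
    "ec (axis_frame p \<kappa>) = \<kappa> / sqrt (1 - p * \<kappa>)" "ed (axis_frame p \<kappa>) = 1 / sqrt (1 - p * \<kappa>)"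
proof -
  define s where "s = sqrt (1 - p * \<kappa>)"
  have s: "s > 0" "s * s = 1 - p * \<kappa>" using assms by (simp_all add: s_def)
  have "1 / s * (1 / s) - p / s * (\<kappa> / s) = (1 - p * \<kappa>) / (s * s)" by (simp add: diff_divide_distrib)
  also have "\<dots> = 1" unfolding s(2)[symmetric] using s(1) by simp
  finally have "1 / s * (1 / s) - p / s * (\<kappa> / s) = 1" .
  from mk_entries[OF this]
  show "ea (axis_frame p \<kappa>) = 1 / sqrt (1 - p * \<kappa>)" "eb (axis_frame p \<kappa>) = p / sqrt (1 - p * \<kappa>)"
    "ec (axis_frame p \<kappa>) = \<kappa> / sqrt (1 - p * \<kappa>)" "ed (axis_frame p \<kappa>) = 1 / sqrt (1 - p * \<kappa>)"
    by (simp_all add: axis_frame_def Let_def s_def)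
qed

lemma mob_axis_frame:
  assumes "p * \<kappa> < 1"
  shows "mob (axis_frame p \<kappa>) z = (z + of_real p) / (of_real \<kappa> * z + 1)"
proof -
  define s where "s = sqrt (1 - p * \<kappa>)"
  have s: "complex_of_real s \<noteq> 0" using assms by (simp add: s_def)
  have "mob (axis_frame p \<kappa>) z = ((z + of_real p) / of_real s) / ((of_real \<kappa> * z + 1) / of_real s)"
    unfolding mob_def axis_frame_entries[OF assms] s_def[symmetric] by (simp add: add_divide_distrib)
  then show ?thesis using s by simp
qed

text \<open>By the intermediate value theorem, \<open>U\<close> has an eigenvector
  \<open>(1, \<kappa>)\<close> in the upper cone, and another one \<open>(p, 1)\<close> in the lower
  cone, which \<open>minv U\<close> enters from outside the upper one. They diagonalise
  \<open>U\<close>, and the direction of attraction shows that the eigenvalue in the upper cone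
  exceeds 1.\<close>

lemma cone_axis_pos:
  assumes \<rho>: "0 < \<rho>" "\<rho> \<le> 1/4" and U: "\<And>v. \<not> coneJ \<rho> v \<Longrightarrow> coneI \<rho> (act U v)" and a: "ea U > 0"
  shows "\<exists>p \<kappa> l. \<bar>p\<bar> \<le> \<rho> \<and> \<bar>\<kappa>\<bar> \<le> \<rho> \<and> l > 1 \<and> U = axis_frame p \<kappa> * dg l * minv (axis_frame p \<kappa>)"
proof -
  define a b c d where "a = ea U" and "b = eb U" and "c = ec U" and "d = ed U"
  have det: "a * d - b * c = 1" using sl2_det[of U] by (simp add: a_def b_def c_def d_def)
  have a0: "a > 0" using assms(4) by (simp add: a_def)
  have prod_lt: "x * y < 1" if "\<bar>x\<bar> \<le> \<rho>" "\<bar>y\<bar> \<le> \<rho>" for x y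
  proof -
    have "\<bar>x * y\<bar> \<le> 1/4 * (1/4)" unfolding abs_mult using that \<rho> by (intro mult_mono) auto
    then show ?thesis by linarith
  qed
  have nJ: "\<not> coneJ \<rho> (Complex 1 k)" if "\<bar>k\<bar> \<le> \<rho>" for k
    using prod_lt[of \<rho> "\<bar>k\<bar>"] that \<rho> by (simp add: coneJ_def not_le)
  have nI: "\<not> coneI \<rho> (Complex k 1)" if "\<bar>k\<bar> \<le> \<rho>" for k
    using prod_lt[of \<rho> "\<bar>k\<bar>"] that \<rho> by (simp add: coneI_def not_le)
  have UI: "\<bar>c + d * k\<bar> \<le> \<rho> * \<bar>a + b * k\<bar>" "a + b * k \<noteq> 0" if k: "\<bar>k\<bar> \<le> \<rho>" for k
  proof -
    have "coneI \<rho> (act U (Complex 1 k))" by (rule U[OF nJ[OF k]])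
    then show 1: "\<bar>c + d * k\<bar> \<le> \<rho> * \<bar>a + b * k\<bar>" by (simp add: coneI_def a_def b_def c_def d_def)
    show "a + b * k \<noteq> 0"
    proof
      assume h: "a + b * k = 0"
      then have "c + d * k = 0" using 1 by simp
      then have "act U (Complex 1 k) = 0" using h by (simp add: complex_eq_iff a_def b_def c_def d_def)
      then have "Complex 1 k = 0" by (simp only: act_eq_0_iff)
      then show False by (simp add: complex_eq_iff)
    qed
  qed
  have VJ: "\<bar>d * k - b\<bar> \<le> \<rho> * \<bar>a - c * k\<bar>" "a - c * k \<noteq> 0" if k: "\<bar>k\<bar> \<le> \<rho>" for k
  proof -
    have "coneJ \<rho> (act (minv U) (Complex k 1))"
    proof (rule ccontr)
      assume "\<not> ?thesis"
      then have "coneI \<rho> (act U (act (minv U) (Complex k 1)))" by (rule U)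
      then show False using nI[OF k] by simp
    qed
    then show 1: "\<bar>d * k - b\<bar> \<le> \<rho> * \<bar>a - c * k\<bar>" by (simp add: coneJ_def a_def b_def c_def d_def)
    show "a - c * k \<noteq> 0"
    proof
      assume h: "a - c * k = 0"
      then have "d * k - b = 0" using 1 by simp
      then have "act (minv U) (Complex k 1) = 0" using h by (simp add: complex_eq_iff a_def b_def c_def d_def)
      then have "Complex k 1 = 0" by (simp only: act_eq_0_iff)
      then show False by (simp add: complex_eq_iff)
    qed
  qed
  \<comment> \<open>A linear function that is positive at 0 and has no zero on a symmetric interval
    is positive there; a value that is not positive would give a zero at the rescaled argument
    \<open>t * k\<close>.\<close>
  have lin_pos: "a + e * k > 0" if nz: "\<And>k. \<bar>k\<bar> \<le> \<rho> \<Longrightarrow> a + e * k \<noteq> 0" and k: "\<bar>k\<bar> \<le> \<rho>" for e k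
  proof (rule ccontr)
    assume "\<not> ?thesis"
    then have le: "a + e * k \<le> 0" by simp
    define x where "x = - (e * k)"
    have x: "a \<le> x" "x > 0" using le a0 by (auto simp: x_def)
    define t where "t = a / x"
    have t: "0 \<le> t" "t \<le> 1" using x a0 by (auto simp: t_def)
    have "\<bar>t * k\<bar> \<le> 1 * \<rho>" unfolding abs_mult using t k by (intro mult_mono) auto
    moreover have "e * (t * k) = - (t * x)" by (simp add: x_def)
    then have "a + e * (t * k) = 0" using x(2) by (simp add: t_def)
    ultimately show False using nz[of "t * k"] by simp
  qed
  have posU: "a + b * k > 0" if "\<bar>k\<bar> \<le> \<rho>" for k using lin_pos[of b k] UI(2) that by blast
  have posV: "a - c * k > 0" if "\<bar>k\<bar> \<le> \<rho>" for k using lin_pos[of "- c" k] VJ(2) that by simp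
  have "\<exists>k. - \<rho> \<le> k \<and> k \<le> \<rho> \<and> k * (a + b * k) - (c + d * k) = 0"
  proof (rule IVT')
    show "- \<rho> * (a + b * - \<rho>) - (c + d * - \<rho>) \<le> 0"
      using UI(1)[of "- \<rho>"] posU[of "- \<rho>"] \<rho> by (simp add: abs_le_iff)
    show "0 \<le> \<rho> * (a + b * \<rho>) - (c + d * \<rho>)"
      using UI(1)[of \<rho>] posU[of \<rho>] \<rho> by (simp add: abs_le_iff)
    show "continuous_on {- \<rho>..\<rho>} (\<lambda>k. k * (a + b * k) - (c + d * k))" by (intro continuous_intros)
  qed (use \<rho> in simp)
  then obtain \<kappa> where "- \<rho> \<le> \<kappa>" "\<kappa> \<le> \<rho>" "\<kappa> * (a + b * \<kappa>) - (c + d * \<kappa>) = 0" by blast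
  then have \<kappa>: "\<bar>\<kappa>\<bar> \<le> \<rho>" "\<kappa> * (a + b * \<kappa>) = c + d * \<kappa>" by auto
  have "\<exists>k. - \<rho> \<le> k \<and> k \<le> \<rho> \<and> k * (a - c * k) - (d * k - b) = 0"
  proof (rule IVT')
    show "- \<rho> * (a - c * - \<rho>) - (d * - \<rho> - b) \<le> 0"
      using VJ(1)[of "- \<rho>"] posV[of "- \<rho>"] \<rho> by (simp add: abs_le_iff)
    show "0 \<le> \<rho> * (a - c * \<rho>) - (d * \<rho> - b)"
      using VJ(1)[of \<rho>] posV[of \<rho>] \<rho> by (simp add: abs_le_iff)
    show "continuous_on {- \<rho>..\<rho>} (\<lambda>k. k * (a - c * k) - (d * k - b))" by (intro continuous_intros)
  qed (use \<rho> in simp)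
  then obtain p where "- \<rho> \<le> p" "p \<le> \<rho>" "p * (a - c * p) - (d * p - b) = 0" by blast
  then have p: "\<bar>p\<bar> \<le> \<rho>" "p * (a - c * p) = d * p - b" by auto
  have pk: "p * \<kappa> < 1" by (rule prod_lt[OF p(1) \<kappa>(1)])
  \<comment> \<open>The eigenvalue of \<open>U\<close> on \<open>(1, \<kappa>)\<close>; by the
    determinant the other one is \<open>1 / l\<close>.\<close>
  define l where "l = a + b * \<kappa>"
  have l0: "l > 0" using posU[OF \<kappa>(1)] by (simp add: l_def)
  have ck: "c + d * \<kappa> = \<kappa> * l" using \<kappa>(2) by (simp add: l_def)
  have lm: "l = a - c * p"
  proof -
    have "(a + b * \<kappa>) * (1 - p * \<kappa>) = (a - c * p) * (1 - p * \<kappa>)" using \<kappa>(2) p(2) det by algebra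
    then show ?thesis using pk by (simp add: l_def)
  qed
  have e1: "a * p + b = p / l" "c * p + d = 1 / l"
  proof -
    have "(a * p + b) * l = p" "(c * p + d) * l = 1" unfolding lm using p(2) det by algebra+
    then show "a * p + b = p / l" "c * p + d = 1 / l" using l0 by (simp_all add: field_simps)
  qed
  define n where "n = axis_frame p \<kappa>"
  note ne = axis_frame_entries[OF pk, folded n_def]
  have "U * n = n * dg l"
    using l0 e1 ck by (intro sl2_eqI) (simp_all add: ne dg_entries a_def[symmetric] b_def[symmetric] c_def[symmetric] d_def[symmetric]
      l_def add_divide_distrib[symmetric] mult.commute)
  then have Un: "U = n * dg l * minv n"
  proof -
    assume "U * n = n * dg l"
    then have "U * n * minv n = n * dg l * minv n" by simp
    then show ?thesis by (simp add: mult.assoc)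
  qed
  \<comment> \<open>The first eigenvector plus \<open>t\<close> times the second. Up to a scalar
    \<open>U\<close> divides \<open>t\<close> by \<open>l * l\<close>, so the iterates of
    \<open>U\<close> are powers of that factor.\<close>
  define cc where "cc t = Complex (1 + t * p) (\<kappa> + t)" for t
  have step: "coneI \<rho> (cc (t / (l * l)))" if "\<not> coneJ \<rho> (cc t)" for t
  proof -
    have "act U (cc t) = of_real l * cc (t / (l * l))"
    proof -
      have "a * (1 + t * p) + b * (\<kappa> + t) = l + t * (a * p + b)" by (simp add: l_def algebra_simps)
      moreover have "c * (1 + t * p) + d * (\<kappa> + t) = (c + d * \<kappa>) + t * (c * p + d)" by (simp add: algebra_simps)
      ultimately show ?thesis using l0 unfolding e1 ck
        by (simp add: complex_eq_iff cc_def a_def[symmetric] b_def[symmetric] c_def[symmetric] d_def[symmetric] field_simps)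
    qed
    then show ?thesis using U[OF that] coneI_scale[of l \<rho> "cc (t / (l * l))"] l0 by simp
  qed
  have notJ: "\<not> coneJ \<rho> (cc t)" if "coneI \<rho> (cc t)" for t
  proof
    assume "coneJ \<rho> (cc t)"
    then have "cc t = 0" using cones_disjoint[OF that] \<rho> by simp
    then have "1 + t * p = 0" "t = - \<kappa>" by (auto simp: cc_def complex_eq_iff)
    then show False using pk by (simp add: mult.commute)
  qed
  have "\<not> coneJ \<rho> (cc 1)"
  proof -
    have "\<rho> * \<bar>\<kappa> + 1\<bar> \<le> 1/4 * (5/4)" using \<rho> \<kappa>(1) by (intro mult_mono) auto
    moreover have "\<bar>1 + p\<bar> \<ge> 3/4" using p(1) \<rho> by linarith
    ultimately show ?thesis by (simp add: coneJ_def cc_def)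
  qed
  then have iter: "coneI \<rho> (cc ((1 / (l * l)) ^ Suc k))" for k
  proof (induction k)
    case 0 then show ?case using step[of 1] by simp
  next
    case (Suc k)
    then have "coneI \<rho> (cc ((1 / (l * l)) ^ Suc k / (l * l)))" by (intro step notJ)
    then show ?case by (simp add: power_divide mult_ac)
  qed
  \<comment> \<open>For \<open>l = 1\<close> the map would be the identity, which moves nothing into
    the upper cone; for \<open>l < 1\<close> the iterates of \<open>cc 1\<close> would turn towards
    \<open>(p, 1)\<close>, although they remain in the upper cone.\<close>
  have "l > 1"
  proof (rule ccontr)
    assume "\<not> l > 1"
    then consider "l = 1" | "l < 1" by linarith
    then show False
    proof cases
      case 1
      then have "U = 1" unfolding Un by (simp add: dg_def one_sl2_def[symmetric])
      then have "coneI \<rho> (Complex 1 1)" using U[of "Complex 1 1"] \<rho> by (simp add: coneJ_def)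
      then show False using \<rho> by (simp add: coneI_def)
    next
      case 2
      then have "l * l < 1 * 1" using l0 by (intro mult_strict_mono) auto
      then have "1 / (l * l) > 1" using l0 by simp
      then obtain k where k: "(1 / (l * l)) ^ k > 2" using real_arch_pow by blast
      define t where "t = (1 / (l * l)) ^ Suc k"
      have "t > 2"
      proof -
        have "1 * 2 < (1 / (l * l)) * (1 / (l * l)) ^ k" using k \<open>1 / (l * l) > 1\<close> l0 by (intro mult_strict_mono) auto
        then show ?thesis by (simp add: t_def)
      qed
      have "\<bar>\<kappa> + t\<bar> \<le> \<rho> * \<bar>1 + t * p\<bar>" using iter[of k] by (simp add: coneI_def cc_def t_def)
      also have "\<dots> \<le> 1/4 * (1 + t * (1/4))"
      proof (rule mult_mono)
        have "\<bar>t * p\<bar> \<le> t * (1/4)" unfolding abs_mult using \<open>t > 2\<close> p(1) \<rho> by (intro mult_mono) auto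
        then show "\<bar>1 + t * p\<bar> \<le> 1 + t * (1/4)" by linarith
      qed (use \<rho> in auto)
      finally have "\<bar>\<kappa> + t\<bar> \<le> 1/4 + t / 16" by simp
      then have "\<kappa> + t \<le> 1/4 + t / 16" using abs_ge_self[of "\<kappa> + t"] by linarith
      moreover have "- \<kappa> \<le> 1/4" using \<kappa>(1) \<rho>(2) by linarith
      ultimately show False using \<open>t > 2\<close> by linarith
    qed
  qed
  then show ?thesis using p(1) \<kappa>(1) Un unfolding n_def by blast
qed

text \<open>\<open>U\<close> maps the vector \<open>1\<close> into the upper cone, so its upper left
  entry is nonzero; the sign is then adjusted, as cones are symmetric.\<close>

lemma cone_axis:
  assumes \<rho>: "0 < \<rho>" "\<rho> \<le> 1/4" and U: "\<And>v. \<not> coneJ \<rho> v \<Longrightarrow> coneI \<rho> (act U v)"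
  shows "\<exists>p \<kappa> l s. \<bar>p\<bar> \<le> \<rho> \<and> \<bar>\<kappa>\<bar> \<le> \<rho> \<and> l > 1 \<and> (s = U \<or> s = mneg U) \<and> s = axis_frame p \<kappa> * dg l * minv (axis_frame p \<kappa>)"
proof -
  have "\<not> coneJ \<rho> 1" by (simp add: coneJ_def)
  then have "coneI \<rho> (act U 1)" by (rule U)
  then have "ea U \<noteq> 0" using sl2_det[of U] by (auto simp: coneI_def)
  then consider "ea U > 0" | "ea (mneg U) > 0" by force
  then show ?thesis
  proof cases
    case 1 then show ?thesis using cone_axis_pos[OF \<rho> U] by metis
  next
    case 2
    have "coneI \<rho> (act (mneg U) v)" if "\<not> coneJ \<rho> v" for v
    proof -
      have "act (mneg U) v = of_real (- 1) * act U v" by (simp add: complex_eq_iff)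
      then show ?thesis using U[OF that] coneI_scale[of "- 1" \<rho> "act U v"] by simp
    qed
    from cone_axis_pos[OF \<rho> this 2] show ?thesis by metis
  qed
qed

text \<open>\<open>minv N * N'\<close> conjugates one diagonal matrix into the other up to sign.
  Since both multipliers exceed 1, it is itself diagonal: it preserves the imaginary axis, and
  \<open>N\<close> and \<open>N'\<close> parametrise the same axis.\<close>

lemma axis_frame_unique:
  assumes l: "l > 1" "l' > 1" and e: "N * dg l * minv N = N' * dg l' * minv N' \<or> N * dg l * minv N = mneg (N' * dg l' * minv N')"
  shows "l = l' \<and> (\<exists>s. s \<noteq> 0 \<and> N' = N * dg s)"
proof -
  define E where "E = minv N * N'"
  obtain \<sigma> :: real where \<sigma>: "\<sigma> = 1 \<or> \<sigma> = -1" and c: "ea (dg l * E) = \<sigma> * ea (E * dg l')" "eb (dg l * E) = \<sigma> * eb (E * dg l')"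
    "ec (dg l * E) = \<sigma> * ec (E * dg l')" "ed (dg l * E) = \<sigma> * ed (E * dg l')"
  proof (cases "N * dg l * minv N = N' * dg l' * minv N'")
    case True
    then have "minv N * (N * dg l * minv N) * N' = minv N * (N' * dg l' * minv N') * N'" by simp
    then have "dg l * E = E * dg l'" by (simp add: E_def mult.assoc)
    then show ?thesis using that[of 1] by simp
  next
    case False
    then have "minv N * (N * dg l * minv N) * N' = minv N * mneg (N' * dg l' * minv N') * N'" using e by simp
    then have "dg l * E = mneg (E * dg l')" by (simp add: E_def mult.assoc mneg_mult_left mneg_mult_right)
    then show ?thesis using that[of "-1"] by simp
  qed
  have nz: "l \<noteq> 0" "l' \<noteq> 0" using l by auto
  have ll: "l * l' > 1" using l by (simp add: less_1_mult)
  have 11: "l * ea E = \<sigma> * (ea E * l')" and 12: "l * eb E = \<sigma> * (eb E / l')" and 21: "ec E / l = \<sigma> * (ec E * l')"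
    using c nz by (simp_all add: dg_entries)
  have "(l * l' - \<sigma>) * eb E = 0" using 12 nz by (simp add: field_simps)
  then have b: "eb E = 0" using ll \<sigma> by auto
  have "(1 - \<sigma> * (l * l')) * ec E = 0" using 21 nz by (simp add: field_simps)
  then have cc: "ec E = 0" using ll \<sigma> by auto
  have ad: "ea E * ed E = 1" using sl2_det[of E] b by simp
  then have a: "ea E \<noteq> 0" by auto
  then have "l = \<sigma> * l'" using 11 by simp
  then have "l = l'" using \<sigma> l by auto
  moreover have "E = dg (ea E)" using a ad b cc by (intro sl2_eqI) (simp_all add: dg_entries field_simps)
  then have "N' = N * dg (ea E)" by (metis E_def minv_right_assoc)
  ultimately show ?thesis using a by blast
qed

context fuchs
begin

text \<open>Seen from the frame \<open>h k * mm k\<close>, the full product is the word read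
  cyclically from position \<open>k\<close>, and the cone argument applies there. Each
  \<open>k\<close> yields an axis of the one element \<open>h K\<close>; by
  \<open>axis_frame_unique\<close> it is the same axis for all \<open>k\<close>, and
  \<open>minv (h k)\<close> brings it close to the segment of the frame \<open>ms k\<close>.\<close>

theorem axis_through_frames:
  "\<exists>C\<ge>0. \<forall>(ms :: nat \<Rightarrow> sl2) K \<rho>. K \<ge> 1 \<longrightarrow> (\<forall>k<K. disp \<i> (ms k) \<le> S) \<longrightarrow> 0 < \<rho> \<longrightarrow> \<rho> \<le> 1/4 \<longrightarrow>
     (\<exists>N l. l > 1 \<and> N * dg l * minv N \<in> G \<and> 2 * ln l \<le> real K * (C + 4 * ln (1 / \<rho>)) \<and>
       (\<forall>k<K. \<exists>A\<in>G. \<exists>p \<kappa>. \<bar>p\<bar> \<le> \<rho> \<and> \<bar>\<kappa>\<bar> \<le> \<rho> \<and> (\<forall>\<tau>>0. \<exists>t.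
          mob A (mob N (of_real (exp t) * \<i>)) =
          mob (ms k) ((of_real \<tau> * \<i> + of_real p) / (of_real \<kappa> * (of_real \<tau> * \<i>) + 1)))))"
proof -
  obtain C where C0: "C \<ge> 0" and C: "\<And>m m' \<rho>. disp \<i> m \<le> S \<Longrightarrow> disp \<i> m' \<le> S \<Longrightarrow> 0 < \<rho> \<Longrightarrow> \<rho> \<le> 1 \<Longrightarrow> \<exists>g\<in>G. disp \<i> g \<le> C + 4 * ln (1 / \<rho>) \<and>
     (\<forall>v. \<not> coneJ \<rho> (act (minv m') v) \<longrightarrow> coneI \<rho> (act (minv m) (act g v)))"
    using connect[of S] by blast
  have main: "\<exists>N l. l > 1 \<and> N * dg l * minv N \<in> G \<and> 2 * ln l \<le> real K * (C + 4 * ln (1 / \<rho>)) \<and>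
       (\<forall>k<K. \<exists>A\<in>G. \<exists>p \<kappa>. \<bar>p\<bar> \<le> \<rho> \<and> \<bar>\<kappa>\<bar> \<le> \<rho> \<and> (\<forall>\<tau>>0. \<exists>t.
          mob A (mob N (of_real (exp t) * \<i>)) =
          mob (ms k) ((of_real \<tau> * \<i> + of_real p) / (of_real \<kappa> * (of_real \<tau> * \<i>) + 1))))"
    if K: "K \<ge> 1" and ms: "\<forall>k<K. disp \<i> (ms k) \<le> S" and \<rho>: "0 < \<rho>" "\<rho> \<le> 1/4" for ms :: "nat \<Rightarrow> sl2" and K \<rho>
  proof -
    \<comment> \<open>Indices modulo \<open>K\<close> close the chain up: the link after the last
      frame leads back to the first.\<close>
    define mm where "mm k = ms (k mod K)" for k
    have mm: "disp \<i> (mm k) \<le> S" for k using ms K by (simp add: mm_def)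
    have mmK: "mm (k + K) = mm k" for k by (simp add: mm_def)
    define Q where "Q k g \<longleftrightarrow> g \<in> G \<and> disp \<i> g \<le> C + 4 * ln (1 / \<rho>) \<and>
      (\<forall>v. \<not> coneJ \<rho> (act (minv (mm (Suc k))) v) \<longrightarrow> coneI \<rho> (act (minv (mm k)) (act g v)))" for k g
    have exQ: "\<exists>g. Q k g" for k
      using C[OF mm[of k] mm[of "Suc k"], of \<rho>] \<rho> unfolding Q_def by auto
    \<comment> \<open>The choice depends on the residue of \<open>k\<close> only, which makes the
      links periodic and gives \<open>h (K + k) = h K * h k\<close>.\<close>
    define g where "g k = (SOME g. Q (k mod K) g)" for k
    have Qmod: "Q (k mod K) = Q k" for k
    proof -
      have "mm (k mod K) = mm k" "mm (Suc (k mod K)) = mm (Suc k)" by (simp_all add: mm_def mod_Suc_eq)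
      then show ?thesis by (simp add: Q_def fun_eq_iff)
    qed
    have g: "Q k (g k)" for k
      using someI_ex[OF exQ[of "k mod K"]] unfolding g_def Qmod .
    have gK: "g (K + k) = g k" for k by (simp add: g_def)
    define h where "h k = prod_list (map g [0..<k])" for k
    have h0: "h 0 = 1" and hS: "h (Suc k) = h k * g k" for k by (simp_all add: h_def)
    have hG: "h k \<in> G" for k
      by (induction k) (use g in \<open>auto simp: h0 hS Q_def intro: G_one G_mult\<close>)
    have hdisp: "disp \<i> (h k) \<le> real k * (C + 4 * ln (1 / \<rho>))" for k
    proof (induction k)
      case (Suc k)
      have "disp \<i> (h (Suc k)) \<le> disp \<i> (h k) + disp \<i> (g k)" unfolding hS by (rule disp_ii_mult)
      also have "disp \<i> (g k) \<le> C + 4 * ln (1 / \<rho>)" using g[of k] by (simp add: Q_def)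
      finally show ?case using Suc by (simp add: algebra_simps)
    qed (simp add: h0)
    have hK: "h (K + k) = h K * h k" for k
      by (induction k) (simp_all add: h0 hS gK mult.assoc)
    \<comment> \<open>Ping-pong: the vector lands in the upper cone of a frame, which meets the
      lower cone of that frame only in 0, so the next link applies to it.\<close>
    have chain: "coneI \<rho> (act (minv (mm k)) (act (minv (h k) * h (k + Suc j)) v))"
      if "\<not> coneJ \<rho> (act (minv (mm (k + Suc j))) v)" for k j v
      using that
    proof (induction j arbitrary: v)
      case 0
      then show ?case using g[of k] by (simp add: hS Q_def)
    next
      case (Suc j)
      define w where "w = act (g (k + Suc j)) v"
      have I: "coneI \<rho> (act (minv (mm (k + Suc j))) w)" using g[of "k + Suc j"] Suc.prems by (simp add: Q_def w_def)
      have "\<not> coneJ \<rho> (act (minv (mm (k + Suc j))) w)"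
      proof
        assume "coneJ \<rho> (act (minv (mm (k + Suc j))) w)"
        then have "act (minv (mm (k + Suc j))) w = 0" using cones_disjoint[OF I] \<rho> by simp
        then have "v = 0" by (simp only: w_def act_eq_0_iff)
        then have "act (minv (mm (k + Suc (Suc j)))) v = 0" by (simp only: act_eq_0_iff)
        then show False using Suc.prems by (simp only: coneJ_def) simp
      qed
      from Suc.IH[OF this] show ?case by (simp add: w_def hS act_mult)
    qed
    have axis: "\<exists>p \<kappa> l N. \<bar>p\<bar> \<le> \<rho> \<and> \<bar>\<kappa>\<bar> \<le> \<rho> \<and> l > 1 \<and> N = h k * mm k * axis_frame p \<kappa> \<and>
       (N * dg l * minv N = h K \<or> N * dg l * minv N = mneg (h K))" for k
    proof -
      \<comment> \<open>A cyclic rotation of the full word, in the coordinates of the frame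
        \<open>mm k\<close>; \<open>chain\<close> is used with \<open>j = K - 1\<close> because it
        speaks of \<open>Suc j\<close> links.\<close>
      define U where "U = minv (mm k) * (minv (h k) * h (k + K)) * mm k"
      have KS: "Suc (K - 1) = K" using K by simp
      have UI: "coneI \<rho> (act U v)" if "\<not> coneJ \<rho> v" for v
        using chain[of k "K - 1" "act (mm k) v"] that unfolding KS mmK U_def by (simp add: act_mult)
      obtain p \<kappa> l s where s: "\<bar>p\<bar> \<le> \<rho>" "\<bar>\<kappa>\<bar> \<le> \<rho>" "l > 1" "s = U \<or> s = mneg U"
        "s = axis_frame p \<kappa> * dg l * minv (axis_frame p \<kappa>)" using cone_axis[OF \<rho> UI] by blast
      define N where "N = h k * mm k * axis_frame p \<kappa>"
      have "N * dg l * minv N = (h k * mm k) * s * minv (h k * mm k)"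
        unfolding s(5) by (simp add: N_def minv_mult mult.assoc)
      moreover have "(h k * mm k) * U * minv (h k * mm k) = h K"
        using hK[of k] by (simp add: U_def minv_mult mult.assoc add.commute)
      ultimately have "N * dg l * minv N = h K \<or> N * dg l * minv N = mneg (h K)"
        using s(4) by (auto simp: mneg_mult_left mneg_mult_right)
      then show ?thesis using s(1-3) N_def by blast
    qed
    obtain p0 \<kappa>0 l N where N: "l > 1" "N * dg l * minv N = h K \<or> N * dg l * minv N = mneg (h K)" using axis[of 0] by blast
    have TG: "N * dg l * minv N \<in> G" using N(2) hG[of K] G_neg by auto
    \<comment> \<open>The trace of the product is \<open>l + 1/l\<close> up to sign, so the
      translation length \<open>2 * ln l\<close> is at most the displacement of \<open>\<i>\<close>,
      which is subadditive along the word.\<close>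
    have len: "2 * ln l \<le> real K * (C + 4 * ln (1 / \<rho>))"
    proof -
      have "tr (N * dg l * minv N) = l + 1 / l" unfolding tr_conj using N(1) by (simp add: tr_def dg_entries)
      then have "(l + 1 / l)\<^sup>2 \<le> 2 * cosh (disp \<i> (N * dg l * minv N)) + 2" using disp_tr_bound[of \<i> "N * dg l * minv N"] by simp
      moreover have "2 * cosh (2 * ln l) + 2 = (l + 1 / l)\<^sup>2"
      proof -
        have "cosh (2 * ln l) = cosh (ln (l * l))" using N(1) by (simp add: ln_mult)
        also have "\<dots> = (l * l + inverse (l * l)) / 2" using N(1) by (subst cosh_ln_real) auto
        finally show ?thesis using N(1) by (simp add: power2_eq_square field_simps)
      qed
      ultimately have "cosh (2 * ln l) \<le> cosh (disp \<i> (N * dg l * minv N))" by linarith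
      then have "2 * ln l \<le> disp \<i> (N * dg l * minv N)"
        using N(1) hyp_dist_nonneg[of \<i> "mob (N * dg l * minv N) \<i>"] by (subst (asm) cosh_mono_iff) auto
      also have "\<dots> = disp \<i> (h K)"
      proof -
        have "mob (N * dg l * minv N) \<i> = mob (h K) \<i>" using N(2) by (elim disjE) (simp_all only: mob_mneg)
        then show ?thesis by simp
      qed
      finally show ?thesis using hdisp[of K] by simp
    qed
    have pts: "\<exists>A\<in>G. \<exists>p \<kappa>. \<bar>p\<bar> \<le> \<rho> \<and> \<bar>\<kappa>\<bar> \<le> \<rho> \<and> (\<forall>\<tau>>0. \<exists>t.
          mob A (mob N (of_real (exp t) * \<i>)) =
          mob (ms k) ((of_real \<tau> * \<i> + of_real p) / (of_real \<kappa> * (of_real \<tau> * \<i>) + 1)))" if k: "k < K" for k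
    proof -
      have msk: "mm k = ms k" using k by (simp add: mm_def)
      obtain p \<kappa> l' N' where N': "\<bar>p\<bar> \<le> \<rho>" "\<bar>\<kappa>\<bar> \<le> \<rho>" "l' > 1" "N' = h k * mm k * axis_frame p \<kappa>"
         "N' * dg l' * minv N' = h K \<or> N' * dg l' * minv N' = mneg (h K)" using axis[of k] by blast
      have "N * dg l * minv N = N' * dg l' * minv N' \<or> N * dg l * minv N = mneg (N' * dg l' * minv N')"
        using N(2) N'(5) by (metis mneg_mneg)
      then obtain s where s: "s \<noteq> 0" "N' = N * dg s" using axis_frame_unique[OF N(1) N'(3)] by blast
      have "\<bar>p * \<kappa>\<bar> \<le> 1/4 * (1/4)" unfolding abs_mult using N'(1,2) \<rho> by (intro mult_mono) auto
      then have pk: "p * \<kappa> < 1" by linarith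
      have "\<exists>t. mob (minv (h k)) (mob N (of_real (exp t) * \<i>)) =
          mob (ms k) ((of_real \<tau> * \<i> + of_real p) / (of_real \<kappa> * (of_real \<tau> * \<i>) + 1))" if \<tau>: "\<tau> > 0" for \<tau>
      proof -
        have i1: "Im (of_real \<tau> * \<i>) > 0" using \<tau> by simp
        define t where "t = ln (s\<^sup>2 * \<tau>)"
        have "exp t = s\<^sup>2 * \<tau>" using s(1) \<tau> by (simp add: t_def)
        then have "mob N (of_real (exp t) * \<i>) = mob N (mob (dg s) (of_real \<tau> * \<i>))" by (simp add: mob_dg[OF s(1)] mult.assoc)
        also have "\<dots> = mob N' (of_real \<tau> * \<i>)" unfolding s(2) by (rule mob_mult[OF i1, symmetric])
        also have "\<dots> = mob (h k * (mm k * axis_frame p \<kappa>)) (of_real \<tau> * \<i>)" unfolding N'(4) by (simp add: mult.assoc)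
        also have "\<dots> = mob (h k) (mob (mm k * axis_frame p \<kappa>) (of_real \<tau> * \<i>))" by (rule mob_mult[OF i1])
        finally have "mob (minv (h k)) (mob N (of_real (exp t) * \<i>)) = mob (mm k * axis_frame p \<kappa>) (of_real \<tau> * \<i>)"
          using i1 by simp
        also have "\<dots> = mob (ms k) ((of_real \<tau> * \<i> + of_real p) / (of_real \<kappa> * (of_real \<tau> * \<i>) + 1))"
          unfolding mob_mult[OF i1] mob_axis_frame[OF pk] msk ..
        finally show ?thesis by blast
      qed
      then show ?thesis using N'(1,2) G_inv[OF hG[of k]] by blast
    qed
    show ?thesis using N(1) TG len pts by (intro exI[of _ N] exI[of _ l] conjI allI impI)
  qed
  show ?thesis using C0 main by (intro exI[of _ C] conjI allI impI)
qed

end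

section \<open>The dense closed geodesic\<close>

lemma curve_length_le:
  assumes d: "\<And>s t. s \<le> t \<Longrightarrow> d (c s) (c t) \<le> t - s" and ab: "a \<le> b"
  shows "curve_length d c a b \<le> ereal (b - a)"
  unfolding curve_length_def
proof (rule SUP_least)
  fix ts assume "ts \<in> {ts. sorted ts \<and> set ts \<subseteq> {a..b}}"
  then have ts: "sorted ts" "set ts \<subseteq> {a..b}" by auto
  have "(\<Sum>i<length ts - 1. d (c (ts ! i)) (c (ts ! Suc i))) \<le> b - a"
  proof (cases "ts = []")
    case True then show ?thesis using ab by simp
  next
    case False
    have "(\<Sum>i<length ts - 1. d (c (ts ! i)) (c (ts ! Suc i))) \<le> (\<Sum>i<length ts - 1. ts ! Suc i - ts ! i)"
      by (intro sum_mono d) (use ts(1) in \<open>auto simp: sorted_iff_nth_mono\<close>)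
    also have "\<dots> = ts ! (length ts - 1) - ts ! 0" by (rule sum_lessThan_telescope)
    also have "\<dots> \<le> b - a"
    proof -
      have "ts ! (length ts - 1) \<in> set ts" "ts ! 0 \<in> set ts" using False by auto
      then have "ts ! (length ts - 1) \<in> {a..b}" "ts ! 0 \<in> {a..b}" using ts(2) by blast+
      then show ?thesis by auto
    qed
    finally show ?thesis .
  qed
  then show "ereal (\<Sum>i<length ts - 1. d (c (ts ! i)) (c (ts ! Suc i))) \<le> ereal (b - a)" by simp
qed

lemma hyp_dist_scale:
  assumes "s > 0" "Im z > 0" "Im w > 0"
  shows "hyp_dist (z / of_real s) (w / of_real s) = hyp_dist z w"
proof -
  have e: "u / of_real s = mob (dg (1 / sqrt s)) u" for u
    using assms(1) by (simp add: mob_dg power_divide)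
  show ?thesis unfolding e using assms by simp
qed

text \<open>The second point runs through the geodesic from \<open>p\<close> to \<open>1 / \<kappa>\<close>.\<close>

lemma near_vertical:
  assumes \<epsilon>: "0 < \<epsilon>" "\<epsilon> \<le> 2" and Y: "1 \<le> Y" and y: "1 \<le> y" "y \<le> Y" and x: "\<bar>x\<bar> \<le> \<epsilon> / 16"
    and \<rho>: "\<rho> = \<epsilon> / (64 * Y\<^sup>2)" and p: "\<bar>p\<bar> \<le> \<rho>" "\<bar>\<kappa>\<bar> \<le> \<rho>"
  shows "hyp_dist (Complex x y) ((of_real y * \<i> + of_real p) / (of_real \<kappa> * (of_real y * \<i>) + 1)) \<le> \<epsilon> / 4"
    and "Im ((of_real y * \<i> + of_real p) / (of_real \<kappa> * (of_real y * \<i>) + 1)) > 0"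
proof -
  define w0 where "w0 = Complex x y"
  define D where "D = of_real \<kappa> * (of_real y * \<i>) + (1 :: complex)"
  define w1 where "w1 = (of_real y * \<i> + of_real p) / D"
  have ReD: "Re D = 1" by (simp add: D_def)
  have D1: "cmod D \<ge> 1" using complex_Re_le_cmod[of D] ReD by simp
  then have D0: "D \<noteq> 0" by auto
  have Y2: "Y\<^sup>2 \<ge> 1" using Y by simp
  have \<rho>0: "\<rho> > 0" using \<rho> \<epsilon> Y by simp
  have \<rho>Y: "\<rho> * Y\<^sup>2 = \<epsilon> / 64" using \<rho> Y by simp
  have "\<rho> * 1 \<le> \<rho> * Y\<^sup>2" using Y2 \<rho>0 by (intro mult_left_mono) auto
  then have \<rho>le: "\<rho> \<le> \<epsilon> / 64" using \<rho>Y by simp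
  have w0n: "cmod w0 \<le> 2 * Y"
    using cmod_le[of w0] x y \<epsilon> Y unfolding w0_def by simp
  have "(w1 - w0) * D = of_real y * \<i> + of_real p - w0 * D" using D0 by (simp add: w1_def left_diff_distrib)
  also have "\<dots> = of_real (p - x) - w0 * (of_real (\<kappa> * y) * \<i>)"
    by (simp add: D_def w0_def complex_eq_iff algebra_simps)
  finally have "cmod (w1 - w0) * cmod D = cmod (of_real (p - x) - w0 * (of_real (\<kappa> * y) * \<i>))" by (metis norm_mult)
  also have "\<dots> \<le> cmod (of_real (p - x)) + cmod (w0 * (of_real (\<kappa> * y) * \<i>))" by (rule norm_triangle_ineq4)
  also have "\<dots> = \<bar>p - x\<bar> + cmod w0 * (\<bar>\<kappa>\<bar> * y)" using y by (simp add: norm_mult abs_mult del: of_real_diff)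
  also have "\<dots> \<le> (\<rho> + \<epsilon> / 16) + (2 * Y) * (\<rho> * Y)"
  proof (intro add_mono mult_mono w0n p(2) y(2))
    show "\<bar>p - x\<bar> \<le> \<rho> + \<epsilon> / 16" using p(1) x by linarith
  qed (use Y y \<rho>0 in auto)
  also have "(2 * Y) * (\<rho> * Y) = 2 * (\<rho> * Y\<^sup>2)" by (simp add: power2_eq_square)
  \<comment> \<open>With \<open>\<rho> * Y\<^sup>2 = \<epsilon>/64\<close> and
    \<open>\<rho> \<le> \<epsilon>/64\<close> the three errors are \<open>1/64\<close>,
    \<open>4/64\<close> and \<open>2/64\<close> of \<open>\<epsilon>\<close>: the lower end, the
    offset of the segment, and the upper end.\<close>
  finally have "cmod (w1 - w0) * cmod D \<le> 7 * \<epsilon> / 64" using \<rho>Y \<rho>le by simp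
  moreover have "cmod (w1 - w0) * 1 \<le> cmod (w1 - w0) * cmod D" using D1 by (intro mult_left_mono) auto
  ultimately have dist: "cmod (w0 - w1) \<le> 7 * \<epsilon> / 64" by (simp add: norm_minus_commute)
  have "\<bar>Im (w0 - w1)\<bar> \<le> 7 * \<epsilon> / 64" using dist abs_Im_le_cmod order_trans by blast
  then have "y - Im w1 \<le> 7 * \<epsilon> / 64" using abs_ge_self[of "y - Im w1"] by (simp add: w0_def)
  then have im1: "Im w1 \<ge> 1/2" using y \<epsilon> by linarith
  have im0: "Im w0 \<ge> 1" using y by (simp add: w0_def)
  have "1 * (1/2) \<le> Im w0 * Im w1" using im0 im1 by (intro mult_mono) auto
  then have "(1/2)\<^sup>2 \<le> Im w0 * Im w1" by (simp add: power2_eq_square)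
  then have sq: "1/2 \<le> sqrt (Im w0 * Im w1)" by (rule real_le_rsqrt)
  have "hyp_dist w0 w1 \<le> cmod (w0 - w1) / sqrt (Im w0 * Im w1)" by (rule hyp_dist_le_euclid) (use im0 im1 in auto)
  also have "\<dots> \<le> (7 * \<epsilon> / 64) / (1/2)" using dist sq \<epsilon>(1) by (intro frac_le) auto
  also have "\<dots> \<le> \<epsilon> / 4" using \<epsilon> by simp
  finally show "hyp_dist (Complex x y) ((of_real y * \<i> + of_real p) / (of_real \<kappa> * (of_real y * \<i>) + 1)) \<le> \<epsilon> / 4"
    by (simp add: w0_def w1_def D_def)
  show "Im ((of_real y * \<i> + of_real p) / (of_real \<kappa> * (of_real y * \<i>) + 1)) > 0"
    using im1 by (simp add: w1_def D_def)
qed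

section \<open>From the group back to the surface\<close>

context dsurf
begin

lemma fuchs_Gam:
  assumes "surface_area M d < \<infinity>" shows "fuchs Gam"
proof
  fix R show "finite {A \<in> Gam. disp \<i> A \<le> R}" by (rule Gam_discrete)
next
  fix c :: real assume "c > 0"
  then show "\<exists>D. \<forall>z. Im z > 0 \<longrightarrow> thick Gam c z \<longrightarrow> (\<exists>A\<in>Gam. hyp_dist \<i> (mob A z) \<le> D)"
    by (rule thick_cobounded[OF assms])
qed (use Gam_one Gam_mult Gam_inv Gam_neg Gam_free in auto)

text \<open>Dividing by \<open>\<xi>\<close> passes from translation width \<open>\<xi>\<close> to
  the unit width of the frame, and takes height 1 to height \<open>1/\<xi> \<ge> 1\<close>. There
  \<open>horoballs_disjoint_or_equal\<close> shows that only integer translations identify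
  points.\<close>

lemma cusp_frame_region:
  assumes F: "fuchs Gam" and m: "cusp_frame Gam m" and \<xi>: "0 < \<xi>" "\<xi> \<le> 1"
  shows "cusp_region M d \<xi> ((\<lambda>w. P (mob m (w / of_real \<xi>))) ` {z. Im z \<ge> 1})"
proof -
  interpret F: fuchs Gam by (rule F)
  define f where "f w = P (mob m (w / of_real \<xi>))" for w
  have imd: "Im (w / of_real \<xi>) = Im w / \<xi>" for w by (simp add: Im_divide_of_real)
  have ge1: "Im (w / of_real \<xi>) \<ge> 1" if "Im w \<ge> 1" for w
    using that \<xi> by (simp add: imd le_divide_eq)
  have pos: "Im (w / of_real \<xi>) > 0" if "Im w \<ge> 1" for w using ge1[OF that] by linarith
  have period: "f z = f w \<longleftrightarrow> (\<exists>k::int. w = z + of_int k * of_real \<xi>)" if zw: "Im z \<ge> 1" "Im w \<ge> 1" for z w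
  proof
    assume "f z = f w"
    then obtain A where A: "A \<in> Gam" "mob A (mob m (z / of_real \<xi>)) = mob m (w / of_real \<xi>)"
      using deck[of "mob m (z / of_real \<xi>)" "mob m (w / of_real \<xi>)"] pos zw by (auto simp: f_def)
    define B where "B = minv m * A * m"
    have Bz: "mob B (z / of_real \<xi>) = w / of_real \<xi>" using pos[OF zw(1)] pos[OF zw(2)] A(2) by (simp add: B_def mob_mult)
    have c: "ec B = 0" "\<bar>ea B\<bar> = 1"
      using F.horoballs_disjoint_or_equal[OF m m A(1), of "z / of_real \<xi>"] ge1 zw Bz unfolding B_def by auto
    have ad: "ea B * ed B = 1" using sl2_det[of B] c(1) by simp
    define B' where "B' = (if ea B = 1 then B else mneg B)"
    have "B' = nn (eb B')" using c ad by (intro sl2_eqI) (auto simp: B'_def abs_if split: if_splits)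
    moreover have "m * B' * minv m \<in> Gam"
    proof -
      have "m * B * minv m = A" by (simp add: B_def mult.assoc)
      then show ?thesis using A(1) Gam_neg[OF A(1)] by (auto simp: B'_def mneg_mult_left mneg_mult_right)
    qed
    ultimately have "eb B' \<in> \<int>" using m unfolding cusp_frame_def by metis
    then obtain k where k: "eb B' = of_int k" by (auto elim: Ints_cases)
    have "mob B (z / of_real \<xi>) = mob B' (z / of_real \<xi>)" by (simp add: B'_def)
    also have "\<dots> = z / of_real \<xi> + of_int k" using \<open>B' = nn (eb B')\<close> k mob_nn by (metis of_real_of_int_eq)
    finally have "w / of_real \<xi> = z / of_real \<xi> + of_int k" using Bz by simp
    then have "w = z + of_int k * of_real \<xi>" using \<xi> by (simp add: field_simps)
    then show "\<exists>k::int. w = z + of_int k * of_real \<xi>" by blast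
  next
    assume "\<exists>k::int. w = z + of_int k * of_real \<xi>"
    then obtain k :: int where k: "w = z + of_int k * of_real \<xi>" by blast
    define A where "A = m * nn (of_int k) * minv m"
    have A: "A \<in> Gam" using m by (simp add: A_def cusp_frame_def)
    have "w / of_real \<xi> = mob (nn (of_int k)) (z / of_real \<xi>)" using k \<xi> by (simp add: mob_nn field_simps)
    then have "mob m (w / of_real \<xi>) = mob A (mob m (z / of_real \<xi>))" using pos[OF zw(1)] by (simp add: A_def mob_mult)
    then show "f z = f w" using GamD[OF A, of "mob m (z / of_real \<xi>)"] pos[OF zw(1)] by (simp add: f_def)
  qed
  have local: "\<exists>e>0. \<forall>u\<in>{z. Im z \<ge> 1}. \<forall>v\<in>{z. Im z \<ge> 1}. hyp_dist z u < e \<and> hyp_dist z v < e \<longrightarrow> d (f u) (f v) = hyp_dist u v"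
    if z: "Im z \<ge> 1" for z
  proof -
    define z' where "z' = mob m (z / of_real \<xi>)"
    have zp: "Im z' > 0" using pos[OF z] by (simp add: z'_def)
    obtain r where r: "r > 0" "\<And>u v. u \<in> hball z' r \<Longrightarrow> v \<in> hball z' r \<Longrightarrow> d (P u) (P v) = hyp_dist u v"
      using P_isom[OF zp] by blast
    have hd: "hyp_dist (mob m (u / of_real \<xi>)) (mob m (v / of_real \<xi>)) = hyp_dist u v" if "Im u \<ge> 1" "Im v \<ge> 1" for u v
      using pos that \<xi> by (simp add: hyp_dist_scale)
    have "d (f u) (f v) = hyp_dist u v" if uv: "Im u \<ge> 1" "Im v \<ge> 1" "hyp_dist z u < r" "hyp_dist z v < r" for u v
    proof -
      have "mob m (u / of_real \<xi>) \<in> hball z' r" "mob m (v / of_real \<xi>) \<in> hball z' r"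
        using hd[OF z uv(1)] hd[OF z uv(2)] uv pos by (simp_all add: hball_def z'_def)
      then show ?thesis using r(2) hd[OF uv(1,2)] by (simp add: f_def)
    qed
    then show ?thesis using r(1) by blast
  qed
  have "f ` {z. Im z \<ge> 1} \<subseteq> M" using pos P_in_M by (auto simp: f_def)
  then show ?thesis unfolding f_def[symmetric] cusp_region_def using period local by blast
qed

text \<open>\<open>dg l\<close> multiplies by \<open>l\<^sup>2\<close>, hence the period
  \<open>2 * ln l\<close> in the arc length parameter.\<close>

lemma axis_closed_geodesic:
  assumes l: "l > 1" and T: "N * dg l * minv N \<in> Gam"
  shows "closed_geodesic M d (\<lambda>t. P (mob N (of_real (exp t) * \<i>))) (2 * ln l)"
    and "curve_length d (\<lambda>t. P (mob N (of_real (exp t) * \<i>))) 0 (2 * ln l) \<le> ereal (2 * ln l)"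
proof -
  define \<gamma> where "\<gamma> t = P (mob N (of_real (exp t) * \<i>))" for t
  have per: "\<gamma> (t + 2 * ln l) = \<gamma> t" for t
  proof -
    have "exp (t + 2 * ln l) = l\<^sup>2 * exp t" using l by (simp add: exp_add exp_double power2_eq_square)
    then have "mob N (of_real (exp (t + 2 * ln l)) * \<i>) = mob N (mob (dg l) (of_real (exp t) * \<i>))" using l by (simp add: mob_dg mult.assoc)
    also have "\<dots> = mob (N * dg l * minv N) (mob N (of_real (exp t) * \<i>))" by (simp add: mob_mult)
    finally show ?thesis unfolding \<gamma>_def using GamD[OF T, of "mob N (of_real (exp t) * \<i>)"] by simp
  qed
  have loc: "\<exists>e>0. \<forall>s\<in>{t-e<..<t+e}. \<forall>s'\<in>{t-e<..<t+e}. d (\<gamma> s) (\<gamma> s') = \<bar>s - s'\<bar>" for t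
  proof -
    obtain e where e: "e > 0" "\<And>s s'. \<bar>s - t\<bar> < e \<Longrightarrow> \<bar>s' - t\<bar> < e \<Longrightarrow> d (\<gamma> s) (\<gamma> s') = \<bar>s - s'\<bar>"
      using P_geodesic[of t N] unfolding \<gamma>_def by blast
    have "\<bar>s - t\<bar> < e" if "s \<in> {t-e<..<t+e}" for s using that by auto
    then show ?thesis using e by blast
  qed
  show "closed_geodesic M d (\<lambda>t. P (mob N (of_real (exp t) * \<i>))) (2 * ln l)"
    unfolding closed_geodesic_def \<gamma>_def[symmetric] using l per loc P_in_M by (auto simp: \<gamma>_def)
  have "d (\<gamma> s) (\<gamma> t) \<le> t - s" if "s \<le> t" for s t
  proof -
    have "d (\<gamma> s) (\<gamma> t) \<le> hyp_dist (mob N (of_real (exp s) * \<i>)) (mob N (of_real (exp t) * \<i>))"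
      unfolding \<gamma>_def by (rule P_lipschitz) auto
    then show ?thesis using that by (simp add: hyp_dist_imag_axis)
  qed
  then show "curve_length d (\<lambda>t. P (mob N (of_real (exp t) * \<i>))) 0 (2 * ln l) \<le> ereal (2 * ln l)"
    using curve_length_le[of d \<gamma> 0 "2 * ln l"] l unfolding \<gamma>_def by simp
qed

text \<open>A point in a horoball but off the cusp regions has height between 1 and
  \<open>1/\<xi>\<close> in the cusp frame, and a translation brings its real part into the unit
  interval. The bounded part is rescaled to have the same shape, so that both cases are treated by
  one kind of rectangle.\<close>

lemma truncated_cover:
  assumes F: "fuchs Gam"
  shows "\<exists>Fr E. finite Fr \<and> E \<ge> 1 \<and> (\<forall>\<xi> z. 0 < \<xi> \<longrightarrow> \<xi> \<le> 1 \<longrightarrow> Im z > 0 \<longrightarrow> P z \<notin> \<Union>{R. cusp_region M d \<xi> R} \<longrightarrow>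
     (\<exists>A\<in>Gam. \<exists>m\<in>Fr. \<exists>x y. \<bar>x\<bar> \<le> E \<and> 1 \<le> y \<and> y \<le> E / \<xi> \<and> mob A z = mob m (Complex x y)))"
proof -
  interpret F: fuchs Gam by (rule F)
  obtain D CF where CF: "finite CF" "\<And>m. m \<in> CF \<Longrightarrow> cusp_frame Gam m" and tt: "\<And>z. Im z > 0 \<Longrightarrow>
     (\<exists>A\<in>Gam. hyp_dist \<i> (mob A z) \<le> D) \<or> (\<exists>A\<in>Gam. \<exists>m\<in>CF. Im (mob (minv m) (mob A z)) > 1)"
    using F.thick_thin by blast
  define s where "s = exp (\<bar>D\<bar> / 2)"
  define E where "E = exp (2 * \<bar>D\<bar>)"
  have s: "s > 0" "s\<^sup>2 = exp \<bar>D\<bar>" "exp \<bar>D\<bar> \<ge> 1" by (simp_all add: s_def exp_double[symmetric])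
  have E: "E = exp \<bar>D\<bar> * exp \<bar>D\<bar>" "E \<ge> 1" by (simp_all add: E_def exp_add[symmetric])
  \<comment> \<open>Scaling by \<open>s\<^sup>2 = exp \<bar>D\<bar>\<close> lifts the ball of radius
    \<open>\<bar>D\<bar>\<close> about \<open>\<i>\<close> above height 1 and keeps its moduli below
    \<open>E\<close>.\<close>
  define m0 where "m0 = minv (dg s)"
  have main: "\<exists>A\<in>Gam. \<exists>m\<in>insert m0 CF. \<exists>x y. \<bar>x\<bar> \<le> E \<and> 1 \<le> y \<and> y \<le> E / \<xi> \<and> mob A z = mob m (Complex x y)"
    if \<xi>: "0 < \<xi>" "\<xi> \<le> 1" and z: "Im z > 0" and out: "P z \<notin> \<Union>{R. cusp_region M d \<xi> R}" for \<xi> z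
  proof -
    consider A where "A \<in> Gam" "hyp_dist \<i> (mob A z) \<le> D"
      | A m where "A \<in> Gam" "m \<in> CF" "Im (mob (minv m) (mob A z)) > 1" using tt[OF z] by blast
    then show ?thesis
    proof cases
      case 1
      define w where "w = mob A z"
      have w: "Im w > 0" using z by (simp add: w_def)
      have dD: "hyp_dist \<i> w \<le> \<bar>D\<bar>" using 1 by (simp add: w_def)
      have a: "cmod w \<le> exp \<bar>D\<bar>"
        using cmod_le_exp_hyp_dist[OF w, of \<i>] dD by (simp add: hyp_dist_commute) (meson exp_le_cancel_iff order_trans)
      have b: "1 \<le> exp \<bar>D\<bar> * Im w"
      proof -
        have "1 \<le> exp (hyp_dist \<i> w) * Im w" using Im_le_exp_hyp_dist[of \<i> w] w by simp
        also have "\<dots> \<le> exp \<bar>D\<bar> * Im w" using dD w by (intro mult_right_mono) auto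
        finally show ?thesis .
      qed
      define u where "u = mob (dg s) w"
      have u: "u = of_real (exp \<bar>D\<bar>) * w" using s by (simp add: u_def mob_dg)
      have "cmod u \<le> E" using a s(3) unfolding u E(1) by (simp add: norm_mult)
      then have "\<bar>Re u\<bar> \<le> E" "\<bar>Im u\<bar> \<le> E" using abs_Re_le_cmod abs_Im_le_cmod order_trans by blast+
      moreover have "1 \<le> Im u" using b by (simp add: u)
      moreover have "E * 1 \<le> E / \<xi>" using \<xi> E(2) by (simp add: le_divide_eq mult_left_le)
      moreover have "mob A z = mob m0 (Complex (Re u) (Im u))" using w by (simp add: m0_def u_def w_def)
      ultimately show ?thesis using 1(1) by (intro bexI[of _ A] bexI[of _ m0] exI[of _ "Re u"] exI[of _ "Im u"]) auto
    next
      case 2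
      define w where "w = mob (minv m) (mob A z)"
      have w1: "Im w > 1" using 2 by (simp add: w_def)
      then have wp: "Im w > 0" by simp
      have mw: "mob m w = mob A z" using z by (simp add: w_def)
      have lt: "Im w \<le> 1 / \<xi>"
      proof (rule ccontr)
        assume "\<not> Im w \<le> 1 / \<xi>"
        then have "Im (of_real \<xi> * w) \<ge> 1" using \<xi> by (simp add: divide_less_eq mult.commute not_le)
        then have "P (mob m ((of_real \<xi> * w) / of_real \<xi>)) \<in> (\<lambda>w. P (mob m (w / of_real \<xi>))) ` {z. Im z \<ge> 1}" by blast
        moreover have "P (mob m ((of_real \<xi> * w) / of_real \<xi>)) = P z" using \<xi> mw GamD[OF 2(1) z] by simp
        ultimately show False using out cusp_frame_region[OF F CF(2)[OF 2(2)] \<xi>] by auto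
      qed
      define k where "k = - \<lfloor>Re w\<rfloor>"
      define B where "B = m * nn (of_int k) * minv m"
      have B: "B \<in> Gam" using CF(2)[OF 2(2)] by (simp add: B_def cusp_frame_def)
      have "mob (B * A) z = mob B (mob m w)" using z mw by (simp add: mob_mult)
      also have "\<dots> = mob m (w + of_int k)" using wp by (simp add: B_def mob_mult mob_nn)
      also have "w + of_int k = Complex (frac (Re w)) (Im w)" by (simp add: complex_eq_iff k_def frac_def)
      finally have "mob (B * A) z = mob m (Complex (frac (Re w)) (Im w))" .
      moreover have "\<bar>frac (Re w)\<bar> \<le> E" using frac_ge_0[of "Re w"] frac_lt_1[of "Re w"] E(2) by linarith
      moreover have "Im w \<le> E / \<xi>"
      proof -
        have "1 / \<xi> \<le> E / \<xi>" using E(2) \<xi> by (simp add: divide_right_mono)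
        then show ?thesis using lt by simp
      qed
      ultimately show ?thesis using Gam_mult[OF B 2(1)] 2(2) w1
        by (intro bexI[of _ "B * A"] bexI[of _ m] exI[of _ "frac (Re w)"] exI[of _ "Im w"]) auto
    qed
  qed
  show ?thesis
    by (rule exI[of _ "insert m0 CF"], rule exI[of _ E], intro conjI allI impI) (use CF(1) E(2) main in auto)
qed

end

lemma (in dsurf) dense_closed_geodesic:
  assumes area: "surface_area M d < \<infinity>"
  shows "\<exists>C>0. \<forall>\<xi> \<epsilon> :: real. 0 < \<xi> \<and> \<xi> \<le> 1 \<and> 0 < \<epsilon> \<and> \<epsilon> \<le> 2 \<longrightarrow>
           (\<exists>\<gamma> L. closed_geodesic M d \<gamma> L \<and>
                  dense_within d \<epsilon> \<gamma> (truncated_surface M d \<xi>) \<and>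
                  curve_length d \<gamma> 0 L
                    \<le> ereal (C * (1 / \<epsilon>) * max (ln 2) (ln (1 / \<epsilon>) + ln (1 / \<xi>))))"
proof -
  interpret F: fuchs Gam by (rule fuchs_Gam[OF area])
  obtain Fr E where Fr: "finite Fr" and E: "E \<ge> 1" and cov: "\<And>\<xi> z. 0 < \<xi> \<Longrightarrow> \<xi> \<le> 1 \<Longrightarrow> Im z > 0 \<Longrightarrow>
     P z \<notin> \<Union>{R. cusp_region M d \<xi> R} \<Longrightarrow>
     \<exists>A\<in>Gam. \<exists>m\<in>Fr. \<exists>x y. \<bar>x\<bar> \<le> E \<and> 1 \<le> y \<and> y \<le> E / \<xi> \<and> mob A z = mob m (Complex x y)"
    using truncated_cover[OF F.fuchs_axioms] by blast
  \<comment> \<open>The extra entry \<open>1\<close> keeps the list non-empty, so that at least one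
    frame is prescribed.\<close>
  obtain Ls where Ls: "set Ls = insert 1 Fr" using finite_list[of "insert 1 Fr"] Fr by auto
  define r where "r = length Ls"
  have r: "r \<ge> 1" using Ls by (cases Ls) (auto simp: r_def)
  define S where "S = Max (disp \<i> ` set Ls) + (E + 1)"
  have S: "disp \<i> (m * nn x) \<le> S" if "m \<in> set Ls" "\<bar>x\<bar> \<le> E + 1" for m x
  proof -
    have "disp \<i> m \<le> Max (disp \<i> ` set Ls)" using that(1) by (intro Max_ge) auto
    then show ?thesis using disp_ii_mult[of m "nn x"] disp_nn_le[of x] that(2) unfolding S_def by linarith
  qed
  obtain C where C0: "C \<ge> 0" and C: "\<And>(ms :: nat \<Rightarrow> sl2) K \<rho>. K \<ge> 1 \<Longrightarrow> \<forall>k<K. disp \<i> (ms k) \<le> S \<Longrightarrow> 0 < \<rho> \<Longrightarrow> \<rho> \<le> 1/4 \<Longrightarrow>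
     \<exists>N l. l > 1 \<and> N * dg l * minv N \<in> Gam \<and> 2 * ln l \<le> real K * (C + 4 * ln (1 / \<rho>)) \<and>
       (\<forall>k<K. \<exists>A\<in>Gam. \<exists>p \<kappa>. \<bar>p\<bar> \<le> \<rho> \<and> \<bar>\<kappa>\<bar> \<le> \<rho> \<and> (\<forall>\<tau>>0. \<exists>t.
          mob A (mob N (of_real (exp t) * \<i>)) =
          mob (ms k) ((of_real \<tau> * \<i> + of_real p) / (of_real \<kappa> * (of_real \<tau> * \<i>) + 1))))"
    using F.axis_through_frames[of S] by (elim exE conjE) (rule that, assumption, simp)
  \<comment> \<open>The part of \<open>C + 4 * ln (1 / \<rho>)\<close> that depends neither on
    \<open>\<xi>\<close> nor on \<open>\<epsilon>\<close>.\<close>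
  define c0 where "c0 = C + 4 * ln 64 + 8 * ln E"
  have c0: "c0 \<ge> 0" using C0 E by (simp add: c0_def)
  \<comment> \<open>\<open>r\<close> frames, at most \<open>(32 * E + 4) / \<epsilon>\<close>
    segments in each, and per link at most \<open>c0 + 12 * \<mu>\<close>; the constant
    \<open>c0\<close> is absorbed because \<open>\<mu> \<ge> ln 2\<close>.\<close>
  define Cf where "Cf = real r * (32 * E + 4) * (c0 / ln 2 + 12)"
  have Cf: "Cf > 0" using r E c0 by (simp add: Cf_def add_nonneg_pos)
  have main: "\<exists>\<gamma> L. closed_geodesic M d \<gamma> L \<and> dense_within d \<epsilon> \<gamma> (truncated_surface M d \<xi>) \<and>
      curve_length d \<gamma> 0 L \<le> ereal (Cf * (1 / \<epsilon>) * max (ln 2) (ln (1 / \<epsilon>) + ln (1 / \<xi>)))"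
    if \<xi>: "0 < \<xi>" "\<xi> \<le> 1" and \<epsilon>: "0 < \<epsilon>" "\<epsilon> \<le> 2" for \<xi> \<epsilon> :: real
  proof -
    define Y where "Y = E / \<xi>"
    have Y: "Y \<ge> 1" using E \<xi> by (simp add: Y_def le_divide_eq)
    define \<rho> where "\<rho> = \<epsilon> / (64 * Y\<^sup>2)"
    have Y2: "Y\<^sup>2 \<ge> 1" using Y by simp
    have Y0: "Y > 0" using Y by linarith
    have \<rho>: "0 < \<rho>" using \<epsilon> Y0 by (simp add: \<rho>_def)
    have "\<rho> \<le> 2 / (64 * 1)" unfolding \<rho>_def using \<epsilon> Y2 by (intro frac_le) auto
    then have \<rho>4: "\<rho> \<le> 1/4" by simp
    define \<delta> where "\<delta> = \<epsilon> / 16"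
    have \<delta>: "0 < \<delta>" "\<delta> \<le> 1" using \<epsilon> by (auto simp: \<delta>_def)
    \<comment> \<open>The grid with \<open>J + 1\<close> points and mesh \<open>\<delta>\<close>
      covers \<open>[-E, E]\<close>; it may overshoot by one mesh, at most 1, which explains the
      bound \<open>E + 1\<close> in \<open>S\<close>.\<close>
    define J where "J = nat \<lceil>2 * E / \<delta>\<rceil>"
    have pos: "2 * E / \<delta> > 0" using E \<delta> by simp
    have J: "2 * E / \<delta> \<le> real J" "real J \<le> 2 * E / \<delta> + 1" using pos unfolding J_def by linarith+
    define W where "W = Suc J"
    define K where "K = r * W"
    have K1: "K \<ge> 1" using r by (simp add: K_def W_def)
    define xs where "xs j = - E + real j * \<delta>" for j
    \<comment> \<open>One index runs over all pairs of a frame and a grid point. Translating the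
      frame by \<open>xs j\<close> turns the vertical segment above that grid point into its
      imaginary axis.\<close>
    define ms where "ms k = Ls ! (k div W) * nn (xs (k mod W))" for k
    have msS: "\<forall>k<K. disp \<i> (ms k) \<le> S"
    proof (intro allI impI)
      fix k assume k: "k < K"
      then have "Ls ! (k div W) \<in> set Ls" by (simp add: K_def r_def less_mult_imp_div_less)
      moreover have "\<bar>xs (k mod W)\<bar> \<le> E + 1"
      proof -
        have "k mod W < W" by (simp add: W_def)
        then have "real (k mod W) \<le> real J" unfolding W_def by linarith
        then have "real (k mod W) \<le> 2 * E / \<delta> + 1" using J(2) by linarith
        then have "real (k mod W) * \<delta> \<le> (2 * E / \<delta> + 1) * \<delta>" using \<delta> by (intro mult_right_mono) auto
        also have "\<dots> = 2 * E + \<delta>" using \<delta> by (simp add: distrib_right)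
        finally have "real (k mod W) * \<delta> \<le> 2 * E + 1" using \<delta> by simp
        moreover have "0 \<le> real (k mod W) * \<delta>" using \<delta> by simp
        ultimately show ?thesis using E unfolding xs_def by linarith
      qed
      ultimately show "disp \<i> (ms k) \<le> S" unfolding ms_def by (rule S)
    qed
    obtain N l where N: "l > 1" "N * dg l * minv N \<in> Gam" "2 * ln l \<le> real K * (C + 4 * ln (1 / \<rho>))"
      "\<forall>k<K. \<exists>A\<in>Gam. \<exists>p \<kappa>. \<bar>p\<bar> \<le> \<rho> \<and> \<bar>\<kappa>\<bar> \<le> \<rho> \<and> (\<forall>\<tau>>0. \<exists>t.
          mob A (mob N (of_real (exp t) * \<i>)) =
          mob (ms k) ((of_real \<tau> * \<i> + of_real p) / (of_real \<kappa> * (of_real \<tau> * \<i>) + 1)))"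
      using C[OF K1 msS \<rho> \<rho>4] by (elim exE conjE) (rule that)
    define \<gamma> where "\<gamma> t = P (mob N (of_real (exp t) * \<i>))" for t
    have near: "\<exists>t. d (P z) (\<gamma> t) \<le> \<epsilon> / 4" if z: "Im z > 0" and out: "P z \<notin> \<Union>{R. cusp_region M d \<xi> R}" for z
    proof -
      obtain A m x y where A: "A \<in> Gam" "m \<in> Fr" "\<bar>x\<bar> \<le> E" "1 \<le> y" "y \<le> E / \<xi>" "mob A z = mob m (Complex x y)"
        using cov[OF \<xi> z out] by blast
      have "m \<in> set Ls" using A(2) Ls by simp
      then obtain i where i: "i < r" "Ls ! i = m" unfolding r_def in_set_conv_nth by blast
      define j where "j = nat \<lfloor>(x + E) / \<delta>\<rfloor>"
      have q: "0 \<le> (x + E) / \<delta>" "(x + E) / \<delta> \<le> 2 * E / \<delta>"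
        using A(3) \<delta> by (auto intro!: divide_nonneg_pos divide_right_mono)
      have j: "real j \<le> (x + E) / \<delta>" "(x + E) / \<delta> \<le> real j + 1" using q(1) unfolding j_def by linarith+
      have jJ: "j < W" using j(1) q(2) J(1) by (simp add: W_def)
      have xj: "\<bar>x - xs j\<bar> \<le> \<epsilon> / 16"
      proof -
        have "real j * \<delta> \<le> x + E" "x + E \<le> (real j + 1) * \<delta>" using j \<delta> by (simp_all add: le_divide_eq divide_le_eq)
        then show ?thesis by (auto simp: xs_def \<delta>_def abs_le_iff algebra_simps)
      qed
      define k where "k = i * W + j"
      have k: "k div W = i" "k mod W = j" using jJ by (simp_all add: k_def)
      have kK: "k < K"
      proof -
        have "k < Suc i * W" using jJ by (simp add: k_def)
        also have "\<dots> \<le> r * W" using i(1) by (intro mult_le_mono1) simp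
        finally show ?thesis by (simp add: K_def)
      qed
      have msk: "ms k = m * nn (xs j)" by (simp add: ms_def k i(2))
      obtain B p \<kappa> where B: "B \<in> Gam" "\<bar>p\<bar> \<le> \<rho>" "\<bar>\<kappa>\<bar> \<le> \<rho>" "\<forall>\<tau>>0. \<exists>t.
          mob B (mob N (of_real (exp t) * \<i>)) = mob (ms k) ((of_real \<tau> * \<i> + of_real p) / (of_real \<kappa> * (of_real \<tau> * \<i>) + 1))"
        using N(4) kK by blast
      define w0 where "w0 = Complex (x - xs j) y"
      define w1 where "w1 = (of_real y * \<i> + of_real p) / (of_real \<kappa> * (of_real y * \<i>) + 1)"
      have "y > 0" using A(4) by simp
      then obtain t where t: "mob B (mob N (of_real (exp t) * \<i>)) = mob (ms k) w1" using B(4) unfolding w1_def by blast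
      have w: "hyp_dist w0 w1 \<le> \<epsilon> / 4" "Im w1 > 0"
        unfolding w0_def w1_def
        by (rule near_vertical[OF \<epsilon> Y A(4) A(5)[folded Y_def] xj \<rho>_def B(2,3)])+
      have w0: "Im w0 > 0" using A(4) by (simp add: w0_def)
      have "mob (ms k) w0 = mob A z"
        unfolding msk mob_mult[OF w0] mob_nn A(6) by (simp add: w0_def complex_eq_iff Complex_eq)
      then have Pz: "P (mob (ms k) w0) = P z" using GamD[OF A(1) z] by simp
      have "P (mob (ms k) w1) = \<gamma> t" using t GamD[OF B(1), of "mob N (of_real (exp t) * \<i>)"] by (simp add: \<gamma>_def)
      then have "d (P z) (\<gamma> t) \<le> hyp_dist (mob (ms k) w0) (mob (ms k) w1)"
        using P_lipschitz[of "mob (ms k) w0" "mob (ms k) w1"] w0 w(2) Pz by simp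
      also have "\<dots> = hyp_dist w0 w1" using w w0 by simp
      finally show ?thesis using w(1) by (intro exI[of _ t]) linarith
    qed
    have dense: "dense_within d \<epsilon> \<gamma> (truncated_surface M d \<xi>)"
      unfolding dense_within_def truncated_surface_def metric_closure_of
    proof
      fix q assume q: "q \<in> {x \<in> M. \<forall>r>0. \<exists>y\<in>M - \<Union> {R. cusp_region M d \<xi> R}. y \<in> mball x r}"
      \<comment> \<open>A point of the closure is approximated within \<open>\<epsilon>/2\<close> by
        one off the cusp regions, which is itself within \<open>\<epsilon>/4\<close> of the
        geodesic.\<close>
      then obtain p where p: "p \<in> M" "p \<notin> \<Union> {R. cusp_region M d \<xi> R}" "p \<in> mball q (\<epsilon>/2)" using half_gt_zero[OF \<epsilon>(1)] by blast
      obtain z where z: "Im z > 0" "P z = p" using P_surj[OF p(1)] by blast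
      obtain t where t: "d p (\<gamma> t) \<le> \<epsilon> / 4" using near[OF z(1)] p(2) z(2) by auto
      have "\<gamma> t \<in> M" by (simp add: \<gamma>_def P_in_M)
      then have "d q (\<gamma> t) \<le> d q p + d p (\<gamma> t)" using q p(1) by (intro triangle) auto
      then have "d q (\<gamma> t) \<le> \<epsilon>" using t p(3) \<epsilon>(1) by simp
      then show "\<exists>t. d q (\<gamma> t) \<le> \<epsilon>" by blast
    qed
    define \<mu> where "\<mu> = max (ln 2) (ln (1 / \<epsilon>) + ln (1 / \<xi>))"
    have \<mu>: "\<mu> \<ge> ln 2" "\<mu> \<ge> ln (1 / \<epsilon>) + ln (1 / \<xi>)" by (auto simp: \<mu>_def)
    have \<mu>0: "\<mu> > 0" using \<mu>(1) ln_gt_zero[of 2] by linarith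
    have len: "2 * ln l \<le> Cf * (1 / \<epsilon>) * \<mu>"
    proof -
      have l\<epsilon>: "ln (1 / \<epsilon>) \<ge> - ln 2"
      proof -
        have "ln \<epsilon> \<le> ln 2" using \<epsilon> by simp
        then show ?thesis using \<epsilon> by (simp add: ln_div)
      qed
      have "1 / \<rho> = 64 * (E * (1 / \<xi>)) ^ 2 * (1 / \<epsilon>)" using \<xi> \<epsilon> by (simp add: \<rho>_def Y_def)
      then have "ln (1 / \<rho>) = ln 64 + 2 * (ln E + ln (1 / \<xi>)) + ln (1 / \<epsilon>)"
        using \<xi> \<epsilon> E by (simp only:) (simp add: ln_mult ln_realpow ln_div)
      also have "\<dots> \<le> ln 64 + 2 * ln E + 3 * \<mu>"
      proof -
        \<comment> \<open>Here \<open>2 * v + u = 2 * (u + v) - u\<close>, where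
          \<open>u = ln (1 / \<epsilon>)\<close> may be negative but is at least
          \<open>- ln 2\<close>.\<close>
        have "a + 2 * (b + v) + u \<le> a + 2 * b + 3 * m" if "c \<le> m" "u + v \<le> m" "- c \<le> u" for a b c u v m :: real
        proof -
          have "2 * (u + v) \<le> 2 * m" using that(2) by simp
          moreover have "- u \<le> m" using that(1,3) by simp
          ultimately show ?thesis by (simp add: algebra_simps)
        qed
        from this[OF \<mu> l\<epsilon>] show ?thesis .
      qed
      finally have "C + 4 * ln (1 / \<rho>) \<le> c0 + 12 * \<mu>" by (simp add: c0_def)
      also have "c0 = c0 / ln 2 * ln 2" by simp
      also have "c0 / ln 2 * ln 2 \<le> c0 / ln 2 * \<mu>" using c0 \<mu>(1) by (intro mult_left_mono) auto
      finally have 1: "C + 4 * ln (1 / \<rho>) \<le> (c0 / ln 2 + 12) * \<mu>" by (simp add: distrib_right)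
      have "real W \<le> 32 * E / \<epsilon> + 2" using J(2) \<epsilon> by (simp add: W_def \<delta>_def)
      also have "\<dots> \<le> (32 * E + 4) / \<epsilon>" using \<epsilon> by (simp add: add_divide_distrib le_divide_eq)
      finally have "real K \<le> real r * ((32 * E + 4) / \<epsilon>)" unfolding K_def of_nat_mult by (intro mult_left_mono) auto
      then have "real K * (C + 4 * ln (1 / \<rho>)) \<le> (real r * ((32 * E + 4) / \<epsilon>)) * ((c0 / ln 2 + 12) * \<mu>)"
        using 1 C0 \<rho> \<rho>4 E \<epsilon> by (intro mult_mono) auto
      also have "\<dots> = Cf * (1 / \<epsilon>) * \<mu>" by (simp add: Cf_def)
      finally show ?thesis using N(3) by simp
    qed
    have "curve_length d \<gamma> 0 (2 * ln l) \<le> ereal (2 * ln l)"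
      unfolding \<gamma>_def[abs_def] by (rule axis_closed_geodesic(2)[OF N(1,2)])
    also have "\<dots> \<le> ereal (Cf * (1 / \<epsilon>) * \<mu>)" using len by simp
    finally have "curve_length d \<gamma> 0 (2 * ln l) \<le> ereal (Cf * (1 / \<epsilon>) * \<mu>)" .
    moreover have "closed_geodesic M d \<gamma> (2 * ln l)"
      unfolding \<gamma>_def[abs_def] by (rule axis_closed_geodesic(1)[OF N(1,2)])
    ultimately show ?thesis using dense unfolding \<mu>_def by blast
  qed
  show ?thesis using Cf main by (intro exI[of _ Cf] conjI allI impI) (auto simp del: times_divide_eq_right)
qed

theorem theoremA:
  fixes M :: "'a set" and d :: "'a \<Rightarrow> 'a \<Rightarrow> real" and g n :: nat
  assumes "2 * g + n \<ge> 3"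
    and "represents_moduli g n M d"
  shows "\<exists>C>0. \<forall>\<xi> \<epsilon> :: real. 0 < \<xi> \<and> \<xi> \<le> 1 \<and> 0 < \<epsilon> \<and> \<epsilon> \<le> 2 \<longrightarrow>
           (\<exists>\<gamma> L. closed_geodesic M d \<gamma> L \<and>
                  dense_within d \<epsilon> \<gamma> (truncated_surface M d \<xi>) \<and>
                  curve_length d \<gamma> 0 L
                    \<le> ereal (C * (1 / \<epsilon>) * max (ln 2) (ln (1 / \<epsilon>) + ln (1 / \<xi>))))"
proof -
  have h: "Metric_space M d" "M \<noteq> {}" "length_metric M d" "Metric_space.mcomplete M d"
    "connected_space (Metric_space.mtopology M d)" "orientable_surface M d" and area: "surface_area M d < \<infinity>"
    using assms(2) unfolding represents_moduli_def hyperbolic_surface_def by auto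
  obtain \<A> where \<A>: "\<forall>(U, \<phi>)\<in>\<A>. isometric_chart M d U \<phi>" "M \<subseteq> (\<Union>(U, \<phi>)\<in>\<A>. U)"
    "\<forall>(U, \<phi>)\<in>\<A>. \<forall>(V, \<psi>)\<in>\<A>. (\<psi> \<circ> inv_into U \<phi>) holomorphic_on \<phi> ` (U \<inter> V)"
    using h(6) unfolding orientable_surface_def by blast
  interpret hsurf M d \<A>
  proof (rule hsurf.intro[OF h(1)], unfold_locales)
    show "\<exists>U \<phi>. (U, \<phi>) \<in> \<A> \<and> p \<in> U" if "p \<in> M" for p using subsetD[OF \<A>(2) that] by (auto split: prod.splits)
  qed (use h \<A>(1,3) in auto)
  obtain P where P: "\<forall>z. Im z > 0 \<longrightarrow> dev P z" using developing_map_exists by blast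
  interpret dsurf M d \<A> P
    by unfold_locales (use P in blast)
  show ?thesis by (rule dense_closed_geodesic[OF area])
qed

end
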